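(* Let $W\colon\mathbb{R}^{d\times N}\to[0,+\infty)$ and $\psi\colon\mathbb{R}^d\times\mathbb{S}^{N-1}\to[0,+\infty)$ be any continuous functions satisfying (W1)–(W3) and ($\psi$1)–($\psi$3), and let $$H(A,B):=\inf\Big\{E(u;Q):\ u\in SBV(Q;\mathbb{R}^d),\ u=Ax\text{ on }\partial Q,\ \int_Q\nabla u\,dx=B\Big\},\qquad A,B\in\mathbb{R}^{d\times N}.$$ Then there exist $B_0\in\mathbb{R}^{d\times N}$ and $\xi\in\mathbb{R}^d$, $\nu\in\mathbb{R}^N$ with $|\xi|=|\nu|=1$ such that $$H(B_0+t\,\xi\otimes\nu,B_0)=W(B_0)+\psi(t\xi,\nu)\quad\text{for all }t>0.$$ In particular, for any possible choice of $W$ and $\psi$, $H\ne H_0$, where $H_0(A,B):=\sqrt{|A|^2+1}+|B|$, because the function $(0,+\infty)\ni t\mapsto H_0(B_0+t\,\xi\otimes\nu,B_0)$ is not affine.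
   Context: Assumptions, for all $A\in\mathbb{R}^{d\times N}$, $\lambda,\lambda_1,\lambda_2\in\mathbb{R}^d$, $\nu\in\mathbb{S}^{N-1}$, with positive constants $c_W,C_W,c_\psi,C_\psi$: (W1) $c_W|A|\le W(A)\le C_W(1+|A|)$. (W2) $W$ is globally Lipschitz continuous. (W3) There exist $c>0$ and $0<\alpha<1$ such that $\big|W^\infty(A)-\frac{W(tA)}{t}\big|\le \frac{c|A|^{1-\alpha}}{t^\alpha}$ whenever $t>0$ and $t|A|\ge1$, where $W^\infty(A):=\limsup_{t\to+\infty}\frac{W(tA)}{t}$. ($\psi$1) $c_\psi|\lambda|\le\psi(\lambda,\nu)\le C_\psi|\lambda|$. ($\psi$2) $\psi(t\lambda,\nu)=t\psi(\lambda,\nu)$ for all $t>0$, and $\psi(-\lambda,-\nu)=\psi(\lambda,\nu)$. ($\psi$3) $\psi(\lambda_1+\lambda_2,\nu)\le\psi(\lambda_1,\nu)+\psi(\lambda_2,\nu)$. $Q\subset\mathbb{R}^N$ is the open unit cube centered at the origin with faces perpendicular to the coordinate axes; boundary values are in the sense of traces. For $u\in SBV(Q;\mathbb{R}^d)$, with $\nabla u$ the density of the absolutely continuous part of $Du$, jump set $S_u$, jump $[u]$ and jump normal $\nu_u$, $E(u;Q):=\int_QW(\nabla u)\,dx+\int_{Q\cap S_u}\psi([u],\nu_u)\,d\mathcal{H}^{N-1}$. *)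

theory Defs
  imports "HOL-Analysis.Analysis"
begin

section \<open>Tensor product and unit cube\<close>

text \<open>A matrix in \<open>\<real>\<^sup>d\<^sup>\<times>\<^sup>N\<close> is an element of \<^typ>\<open>real^'n^'d\<close>; its \<^const>\<open>norm\<close> is the
  Frobenius norm.\<close>

definition tensor :: "real^'d \<Rightarrow> real^'n \<Rightarrow> real^'n^'d" (infixr "\<otimes>\<^sub>t" 75) where
  "a \<otimes>\<^sub>t b = (\<chi> i j. a $ i * b $ j)"

definition unit_cube :: "(real^'n) set" where
  "unit_cube = {x. \<forall>i. \<bar>x $ i\<bar> < 1 / 2}"

text \<open>Outward unit normal of the cube on its (relatively open) faces. On the lower-dimensional
  edges, which are null for the surface measure, the value is irrelevant.\<close>

definition cube_normal :: "real^'n \<Rightarrow> real^'n" where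
  "cube_normal x = (\<chi> j. if \<bar>x $ j\<bar> = 1 / 2 then sgn (x $ j) else 0)"


section \<open>Hausdorff measure\<close>

text \<open>The normalisation is the standard one, \<open>\<omega>\<^sub>k (diam C / 2)\<^sup>k\<close> with \<open>\<omega>\<^sub>k\<close> the volume of the
  \<open>k\<close>-dimensional unit ball. For \<open>k = 0\<close> a nonempty set counts \<open>0 ^ 0 = 1\<close> (counting measure), so
  the empty set has to be given size \<open>0\<close> separately; boundedness is required because
  \<^const>\<open>diameter\<close> is meaningless for unbounded sets.\<close>

definition hausdorff_size :: "nat \<Rightarrow> 'a::metric_space set \<Rightarrow> ennreal" where
  "hausdorff_size k C =
     (if C = {} then 0 else ennreal (unit_ball_vol (real k) * (diameter C / 2) ^ k))"

definition hausdorff_pre :: "nat \<Rightarrow> real \<Rightarrow> 'a::metric_space set \<Rightarrow> ennreal" where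
  "hausdorff_pre k \<delta> A =
     (INF C \<in> {C :: nat \<Rightarrow> 'a set. (\<forall>i. bounded (C i) \<and> diameter (C i) \<le> \<delta>) \<and> A \<subseteq> (\<Union>i. C i)}.
        \<Sum>i. hausdorff_size k (C i))"

definition hausdorff_outer :: "nat \<Rightarrow> 'a::metric_space set \<Rightarrow> ennreal" where
  "hausdorff_outer k A = (SUP \<delta> \<in> {0<..}. hausdorff_pre k \<delta> A)"

text \<open>The outer measure is a metric outer measure, hence countably additive on the Borel sets, so
  that \<^const>\<open>measure_of\<close> keeps its values there.\<close>

definition hausdorff_measure :: "nat \<Rightarrow> 'a::metric_space measure" where
  "hausdorff_measure k = measure_of UNIV (sets borel) (hausdorff_outer k)"

text \<open>The surface measure \<open>\<H>\<^sup>N\<^sup>-\<^sup>1\<close> on \<open>\<real>\<^sup>N\<close>.\<close>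

abbreviation surface_measure :: "(real^'n) measure" where
  "surface_measure \<equiv> hausdorff_measure (CARD('n) - 1)"


section \<open>Functions of bounded variation\<close>

definition C1_with_gradient :: "(real^'n \<Rightarrow> real) \<Rightarrow> (real^'n \<Rightarrow> real^'n) \<Rightarrow> bool" where
  "C1_with_gradient \<phi> d\<phi> \<longleftrightarrow> (\<forall>x. GDERIV \<phi> x :> d\<phi> x) \<and> continuous_on UNIV d\<phi>"

definition compactly_supported_in :: "(real^'n) set \<Rightarrow> (real^'n \<Rightarrow> real) \<Rightarrow> bool" where
  "compactly_supported_in \<Omega> \<phi> \<longleftrightarrow>
     compact (closure {x. \<phi> x \<noteq> 0}) \<and> closure {x. \<phi> x \<noteq> 0} \<subseteq> \<Omega>"

text \<open>\<open>deriv_measure \<Omega> u \<mu> \<sigma>\<close>: the distributional derivative of \<open>u\<close> on \<open>\<Omega>\<close> is the finite matrix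
  valued Radon measure \<open>Du = \<sigma> \<mu>\<close>, given through its polar decomposition: \<open>\<mu> = |Du|\<close> is the total
  variation measure and \<open>\<bar>\<sigma>\<bar> = 1\<close>. Thus \<open>Du(E)\<close> is \<open>LINT x:E|\<mu>. \<sigma> x\<close>. In components the last
  clause reads \<open>\<integral>\<^sub>\<Omega> u\<^sub>i \<partial>\<^sub>j\<phi> dx = - \<integral>\<^sub>\<Omega> \<phi> d(Du)\<^sub>i\<^sub>j\<close>.\<close>

definition deriv_measure ::
    "(real^'n) set \<Rightarrow> (real^'n \<Rightarrow> real^'d) \<Rightarrow> (real^'n) measure \<Rightarrow> (real^'n \<Rightarrow> real^'n^'d) \<Rightarrow> bool" where
  "deriv_measure \<Omega> u \<mu> \<sigma> \<longleftrightarrow>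
     finite_measure \<mu> \<and> sets \<mu> = sets borel \<and> emeasure \<mu> (- \<Omega>) = 0 \<and>
     \<sigma> \<in> borel_measurable borel \<and> (AE x in \<mu>. norm (\<sigma> x) = 1) \<and>
     (\<forall>\<phi> d\<phi>. C1_with_gradient \<phi> d\<phi> \<and> compactly_supported_in \<Omega> \<phi> \<longrightarrow>
        (LINT x:\<Omega>|lebesgue. u x \<otimes>\<^sub>t d\<phi> x) = - (LINT x|\<mu>. \<phi> x *\<^sub>R \<sigma> x))"

definition BV :: "(real^'n) set \<Rightarrow> (real^'n \<Rightarrow> real^'d) set" where
  "BV \<Omega> = {u. set_integrable lebesgue \<Omega> u \<and> (\<exists>\<mu> \<sigma>. deriv_measure \<Omega> u \<mu> \<sigma>)}"

text \<open>\<open>g\<close> is the density of the absolutely continuous part of \<open>Du\<close>: there is a Lebesgue null set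
  \<open>Z\<close> carrying the singular part of \<open>Du\<close>, while \<open>Du\<close> restricted to the complement of \<open>Z\<close> has
  Lebesgue density \<open>g\<close>. This determines \<open>g\<close> up to Lebesgue null sets.\<close>

definition ac_density ::
    "(real^'n) set \<Rightarrow> (real^'n \<Rightarrow> real^'d) \<Rightarrow> (real^'n \<Rightarrow> real^'n^'d) \<Rightarrow> bool" where
  "ac_density \<Omega> u g \<longleftrightarrow>
     set_integrable lebesgue \<Omega> g \<and>
     (\<exists>\<mu> \<sigma> Z. deriv_measure \<Omega> u \<mu> \<sigma> \<and> Z \<in> null_sets lborel \<and>
        (\<forall>E \<in> sets borel. E \<subseteq> \<Omega> \<longrightarrow>
           (LINT x:(E - Z)|\<mu>. \<sigma> x) = (LINT x:E|lebesgue. g x)))"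

definition grad :: "(real^'n) set \<Rightarrow> (real^'n \<Rightarrow> real^'d) \<Rightarrow> real^'n \<Rightarrow> real^'n^'d" where
  "grad \<Omega> u = (SOME g. ac_density \<Omega> u g)"


section \<open>Jump set, jump and jump normal\<close>

definition half_ball :: "real^'n \<Rightarrow> real \<Rightarrow> real^'n \<Rightarrow> (real^'n) set" where
  "half_ball x r \<nu> = {y \<in> ball x r. (y - x) \<bullet> \<nu> > 0}"

definition one_sided_limit ::
    "(real^'n \<Rightarrow> real^'d) \<Rightarrow> real^'n \<Rightarrow> real^'n \<Rightarrow> real^'d \<Rightarrow> bool" where
  "one_sided_limit u x \<nu> a \<longleftrightarrow>
     ((\<lambda>r. (LINT y:half_ball x r \<nu>|lebesgue. norm (u y - a)) / measure lebesgue (half_ball x r \<nu>))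
        \<longlongrightarrow> 0) (at_right 0)"

definition is_jump_triple ::
    "(real^'n \<Rightarrow> real^'d) \<Rightarrow> real^'n \<Rightarrow> real^'d \<Rightarrow> real^'d \<Rightarrow> real^'n \<Rightarrow> bool" where
  "is_jump_triple u x a b \<nu> \<longleftrightarrow>
     a \<noteq> b \<and> norm \<nu> = 1 \<and> one_sided_limit u x \<nu> a \<and> one_sided_limit u x (- \<nu>) b"

definition jump_set :: "(real^'n) set \<Rightarrow> (real^'n \<Rightarrow> real^'d) \<Rightarrow> (real^'n) set" where
  "jump_set \<Omega> u = {x \<in> \<Omega>. \<exists>a b \<nu>. is_jump_triple u x a b \<nu>}"

text \<open>At a jump point the triple \<open>(u\<^sup>+, u\<^sup>-, \<nu>)\<close> is unique up to replacing it by
  \<open>(u\<^sup>-, u\<^sup>+, -\<nu>)\<close>. The choice made here is immaterial (also for measurability), since jump and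
  normal are only used through expressions invariant under this change, namely
  \<open>[u] \<otimes> \<nu>\<close> and \<open>\<psi>([u], \<nu>)\<close>.\<close>

definition jump_triple :: "(real^'n \<Rightarrow> real^'d) \<Rightarrow> real^'n \<Rightarrow> (real^'d) \<times> (real^'d) \<times> (real^'n)" where
  "jump_triple u x = (SOME (a, b, \<nu>). is_jump_triple u x a b \<nu>)"

definition jump :: "(real^'n \<Rightarrow> real^'d) \<Rightarrow> real^'n \<Rightarrow> real^'d" where
  "jump u x = (case jump_triple u x of (a, b, \<nu>) \<Rightarrow> a - b)"

definition jump_normal :: "(real^'n \<Rightarrow> real^'d) \<Rightarrow> real^'n \<Rightarrow> real^'n" where
  "jump_normal u x = (case jump_triple u x of (a, b, \<nu>) \<Rightarrow> \<nu>)"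


section \<open>Special functions of bounded variation and traces\<close>

text \<open>\<open>u \<in> SBV\<close> iff \<open>Du\<close> has no Cantor part, i.e.
  \<open>Du = \<nabla>u \<L>\<^sup>N + [u] \<otimes> \<nu>\<^sub>u \<H>\<^sup>N\<^sup>-\<^sup>1\<lfloor>S\<^sub>u\<close> as measures on \<open>\<Omega>\<close>. The integrability of \<open>[u] \<otimes> \<nu>\<^sub>u\<close> is what
  makes the right-hand side a finite measure; it holds for every BV function.\<close>

definition SBV :: "(real^'n) set \<Rightarrow> (real^'n \<Rightarrow> real^'d) set" where
  "SBV \<Omega> = {u \<in> BV \<Omega>.
     set_integrable surface_measure (jump_set \<Omega> u) (\<lambda>x. jump u x \<otimes>\<^sub>t jump_normal u x) \<and>
     (\<exists>\<mu> \<sigma>. deriv_measure \<Omega> u \<mu> \<sigma> \<and>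
        (\<forall>E \<in> sets borel. E \<subseteq> \<Omega> \<longrightarrow>
           (LINT x:E|\<mu>. \<sigma> x) =
             (LINT x:E|lebesgue. grad \<Omega> u x) +
             (LINT x:(E \<inter> jump_set \<Omega> u)|surface_measure. jump u x \<otimes>\<^sub>t jump_normal u x)))}"

text \<open>\<open>T\<close> is the trace on \<open>\<partial>\<Omega>\<close> of the BV function \<open>u\<close>, where \<open>n\<close> is the outward unit normal: the
  \<open>\<H>\<^sup>N\<^sup>-\<^sup>1\<close>-a.e. uniquely determined integrable function with
  \<open>\<integral>\<^sub>\<Omega> u \<otimes> \<nabla>\<phi> dx = - \<integral>\<^sub>\<Omega> \<phi> dDu + \<integral>\<^sub>\<partial>\<^sub>\<Omega> \<phi> (T \<otimes> n) d\<H>\<^sup>N\<^sup>-\<^sup>1\<close> for all \<open>\<phi> \<in> C\<^sup>1(\<real>\<^sup>N)\<close>; see Evans and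
  Gariepy, Measure Theory and Fine Properties of Functions.\<close>

definition is_trace ::
    "(real^'n) set \<Rightarrow> (real^'n \<Rightarrow> real^'n) \<Rightarrow> (real^'n \<Rightarrow> real^'d) \<Rightarrow> (real^'n \<Rightarrow> real^'d) \<Rightarrow> bool" where
  "is_trace \<Omega> n u T \<longleftrightarrow>
     set_integrable surface_measure (frontier \<Omega>) T \<and>
     (\<exists>\<mu> \<sigma>. deriv_measure \<Omega> u \<mu> \<sigma> \<and>
        (\<forall>\<phi> d\<phi>. C1_with_gradient \<phi> d\<phi> \<longrightarrow>
           (LINT x:\<Omega>|lebesgue. u x \<otimes>\<^sub>t d\<phi> x) =
             - (LINT x|\<mu>. \<phi> x *\<^sub>R \<sigma> x) +
             (LINT x:frontier \<Omega>|surface_measure. \<phi> x *\<^sub>R (T x \<otimes>\<^sub>t n x))))"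


section \<open>Energies\<close>

text \<open>Under the linear growth condition the limes superior is finite.\<close>

definition recession :: "(real^'n^'d \<Rightarrow> real) \<Rightarrow> real^'n^'d \<Rightarrow> real" where
  "recession W A = real_of_ereal (Limsup at_top (\<lambda>t::real. ereal (W (t *\<^sub>R A) / t)))"

definition energy ::
    "(real^'n^'d \<Rightarrow> real) \<Rightarrow> (real^'d \<Rightarrow> real^'n \<Rightarrow> real) \<Rightarrow> (real^'n) set \<Rightarrow>
     (real^'n \<Rightarrow> real^'d) \<Rightarrow> ennreal" where
  "energy W \<psi> \<Omega> u =
     (\<integral>\<^sup>+x \<in> \<Omega>. ennreal (W (grad \<Omega> u x)) \<partial>lebesgue) +
     (\<integral>\<^sup>+x \<in> jump_set \<Omega> u. ennreal (\<psi> (jump u x) (jump_normal u x)) \<partial>surface_measure)"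

definition H :: "(real^'n^'d \<Rightarrow> real) \<Rightarrow> (real^'d \<Rightarrow> real^'n \<Rightarrow> real) \<Rightarrow>
    real^'n^'d \<Rightarrow> real^'n^'d \<Rightarrow> ennreal" where
  "H W \<psi> A B =
     Inf {energy W \<psi> unit_cube u | u. u \<in> SBV unit_cube \<and>
            is_trace unit_cube cube_normal u (\<lambda>x. A *v x) \<and>
            (LINT x:unit_cube|lebesgue. grad unit_cube u x) = B}"

definition H0 :: "real^'n^'d \<Rightarrow> real^'n^'d \<Rightarrow> real" where
  "H0 A B = sqrt ((norm A)\<^sup>2 + 1) + norm B"

end

theory Submission
  imports Defs
begin

text \<open>
  Lower bound. Let \<open>B\<^sub>0\<close> minimise \<open>W\<close> and let the linear form \<open>M\<close> on matrices satisfy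
  \<open>M \<bullet> (z \<otimes> n) \<le> \<psi> z n\<close> with equality at \<open>(\<xi>, \<nu>)\<close>. For an admissible \<open>u\<close> the trace gives
  \<open>Du(Q) = A\<close>, hence the jump part of \<open>Du\<close> has total mass \<open>A - B\<^sub>0 = t \<xi> \<otimes> \<nu>\<close>, and integrating the two
  pointwise bounds yields \<open>E(u) \<ge> W(B\<^sub>0) + t \<psi>(\<xi>, \<nu>)\<close>.

  Upper bound. Put \<open>u(x) = A x - s \<eta>(x) saw\<^sub>k(x \<bullet> \<nu>) \<xi>\<close>, where \<open>saw\<^sub>k\<close> is the sawtooth of slope \<open>1\<close> and
  period \<open>1/k\<close> and the \<open>C\<^sup>1\<close> cutoff \<open>\<eta>\<close> is positive exactly on the cube. The trace of \<open>u\<close> is \<open>A x\<close>, and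
  its jump set consists of pieces of parallel hyperplanes, without junctions, with jump a positive
  multiple of \<open>\<xi>\<close> and normal \<open>\<nu>\<close>. The factor \<open>s\<close> is chosen to make the mean gradient exactly \<open>B\<^sub>0\<close>; then
  the surface energy is exactly \<open>t \<psi>(\<xi>, \<nu>)\<close>. The gradient tends to \<open>B\<^sub>0\<close> in \<open>L\<^sup>1\<close> as first \<open>k\<close> and
  then \<open>\<eta>\<close> tend to their limits, and \<open>W\<close> is Lipschitz.

  All surface integrals are taken with respect to the Hausdorff measure, whose identification with
  Lebesgue measure on hyperplanes rests on the isodiametric inequality (Steiner symmetrisation) and
  on Vitali's covering theorem.
\<close>

section \<open>Hausdorff measure on Borel sets\<close>

text \<open>The lower bound gets by without convexity of \<open>W\<close> and without any
  ellipticity of \<psi>: a global minimiser bounds the bulk term pointwise, so no Jensen inequality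
  enters, and a linear form sees only the total jump, which trace and mean gradient fix. The freedom
  to choose the point and the direction is what makes both devices possible. In the upper bound the
  obstacle is the boundary value. A sharp laminate violates it, and repairing it by jumps along the
  faces leaves the direction in which the linear form touches \<psi>. With a cutoff the jumps fade
  out instead; the price is the term \<open>saw k (x \<bullet> \<nu>)\<close> times the gradient of
  \<eta>, at most that gradient divided by \<open>k\<close>, which forces \<eta> to be fixed before
  \<open>k\<close>. The amplitude \<open>s\<close> scales the total jump and the gradient deficit
  together, so correcting one corrects the other. Gradient and jump are chosen by
  \<open>SOME\<close>, and BV, SBV and trace each assert their own polar pair for \<open>Du\<close>.
  Uniqueness of \<open>Du\<close> as a set function has to come before these notions can be
  combined.\<close>

lemma hausdorff_size_mono:
  assumes "C \<subseteq> D" "bounded D"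
  shows "hausdorff_size k C \<le> hausdorff_size k D"
proof (cases "C = {}")
  case False
  with assms have "D \<noteq> {}" by auto
  have "diameter C \<le> diameter D" using assms by (rule diameter_subset)
  moreover have "0 \<le> diameter C" using assms by (meson bounded_subset diameter_ge_0)
  ultimately show ?thesis using False \<open>D \<noteq> {}\<close>
    by (auto simp: hausdorff_size_def intro!: ennreal_leI mult_left_mono power_mono)
qed (simp add: hausdorff_size_def)

lemma hausdorff_size_empty [simp]: "hausdorff_size k {} = 0"
  by (simp add: hausdorff_size_def)

lemma hausdorff_preI:
  assumes "\<And>i. bounded (C i)" "\<And>i. diameter (C i) \<le> \<delta>" "A \<subseteq> (\<Union>i. C i)"
  shows "hausdorff_pre k \<delta> A \<le> (\<Sum>i. hausdorff_size k (C i))"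
  unfolding hausdorff_pre_def using assms by (intro INF_lower) auto

lemma hausdorff_pre_empty:
  assumes "0 < \<delta>"
  shows "hausdorff_pre k \<delta> {} = 0"
  using hausdorff_preI[of "\<lambda>_. {}" \<delta> "{}" k] assms by simp

lemma hausdorff_pre_mono: "A \<subseteq> B \<Longrightarrow> hausdorff_pre k \<delta> A \<le> hausdorff_pre k \<delta> B"
  unfolding hausdorff_pre_def by (rule INF_superset_mono) auto

lemma hausdorff_pre_antimono: "\<delta> \<le> \<epsilon> \<Longrightarrow> hausdorff_pre k \<epsilon> A \<le> hausdorff_pre k \<delta> A"
  unfolding hausdorff_pre_def by (rule INF_superset_mono) (auto intro: order_trans)

lemma hausdorff_pre_countable_subadditive:
  fixes A :: "nat \<Rightarrow> 'a::metric_space set"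
  shows "hausdorff_pre k \<delta> (\<Union>i. A i) \<le> (\<Sum>i. hausdorff_pre k \<delta> (A i))"
proof (rule ennreal_le_epsilon)
  fix e :: real assume fin: "(\<Sum>i. hausdorff_pre k \<delta> (A i)) < top" and e: "0 < e"
  have ei: "0 < e * (1/2)^Suc i" for i using e by simp
  have "\<exists>C :: nat \<Rightarrow> 'a set. (\<forall>j. bounded (C j) \<and> diameter (C j) \<le> \<delta>) \<and> A i \<subseteq> (\<Union>j. C j) \<and>
          (\<Sum>j. hausdorff_size k (C j)) \<le> hausdorff_pre k \<delta> (A i) + ennreal (e * (1/2)^Suc i)" for i
  proof -
    have "hausdorff_pre k \<delta> (A i) \<noteq> top"
      using ennreal_suminf_lessD[OF fin, of i] by (simp add: less_top)
    then have "hausdorff_pre k \<delta> (A i) < hausdorff_pre k \<delta> (A i) + ennreal (e * (1/2)^Suc i)"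
      using ei[of i] by (simp add: ennreal_add_left_cancel_less less_top)
    then show ?thesis
      unfolding hausdorff_pre_def[of k \<delta> "A i"] INF_less_iff by (auto intro: less_imp_le)
  qed
  then obtain C :: "nat \<Rightarrow> nat \<Rightarrow> 'a set" where C:
      "\<And>i j. bounded (C i j)" "\<And>i j. diameter (C i j) \<le> \<delta>" "\<And>i. A i \<subseteq> (\<Union>j. C i j)"
      "\<And>i. (\<Sum>j. hausdorff_size k (C i j)) \<le> hausdorff_pre k \<delta> (A i) + ennreal (e * (1/2)^Suc i)"
    by metis
  have "hausdorff_pre k \<delta> (\<Union>i. A i) \<le> (\<Sum>n. hausdorff_size k (case prod_decode n of (i,j) \<Rightarrow> C i j))"
  proof (rule hausdorff_preI)
    have "x \<in> (\<Union>n. case prod_decode n of (i, j) \<Rightarrow> C i j)" if x: "x \<in> A i" for x i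
    proof -
      obtain j where "x \<in> C i j" using C(3) x by blast
      then show ?thesis by (auto intro!: exI[of _ "prod_encode (i,j)"])
    qed
    then show "(\<Union>i. A i) \<subseteq> (\<Union>n. case prod_decode n of (i, j) \<Rightarrow> C i j)" by blast
  qed (auto split: prod.split intro: C)
  also have "\<dots> = (\<Sum>n. (\<lambda>(i,j). hausdorff_size k (C i j)) (prod_decode n))"
    by (intro suminf_cong) (auto split: prod.split)
  also have "\<dots> = (\<Sum>i. \<Sum>j. hausdorff_size k (C i j))"
    by (rule suminf_ennreal_2dimen) simp
  also have "\<dots> \<le> (\<Sum>i. hausdorff_pre k \<delta> (A i) + ennreal (e * (1/2)^Suc i))"
    by (intro suminf_le C) auto
  also have "\<dots> = (\<Sum>i. hausdorff_pre k \<delta> (A i)) + (\<Sum>i. ennreal (e * (1/2)^Suc i))"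
    by (subst suminf_add) auto
  also have "(\<Sum>i. ennreal (e * (1/2)^Suc i)) = ennreal e"
    using sums_mult[OF power_half_series, of e] e
    by (intro suminf_ennreal_eq) auto
  finally show "hausdorff_pre k \<delta> (\<Union>i. A i) \<le> (\<Sum>i. hausdorff_pre k \<delta> (A i)) + ennreal e" .
qed

lemma hausdorff_pre_le_outer: "0 < \<delta> \<Longrightarrow> hausdorff_pre k \<delta> A \<le> hausdorff_outer k A"
  unfolding hausdorff_outer_def by (rule SUP_upper) simp

text \<open>Monotonicity in \<delta> reduces the supremum to a sequence, so that suprema of sums of
  extended reals can be split.\<close>

lemma hausdorff_outer_eq_SUP_nat:
  "hausdorff_outer k A = (SUP n. hausdorff_pre k (1 / Suc n) A)"
proof (rule antisym)
  show "hausdorff_outer k A \<le> (SUP n. hausdorff_pre k (1 / Suc n) A)"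
    unfolding hausdorff_outer_def
  proof (rule SUP_least)
    fix \<delta> :: real assume "\<delta> \<in> {0<..}"
    then obtain n where "inverse (Suc n) < \<delta>" using reals_Archimedean by auto
    then have "hausdorff_pre k \<delta> A \<le> hausdorff_pre k (1 / Suc n) A"
      by (intro hausdorff_pre_antimono) (simp add: inverse_eq_divide)
    then show "hausdorff_pre k \<delta> A \<le> (SUP n. hausdorff_pre k (1 / Suc n) A)"
      by (rule order_trans) (rule SUP_upper, simp)
  qed
qed (auto intro!: SUP_least hausdorff_pre_le_outer)

lemma incseq_hausdorff_pre: "incseq (\<lambda>n. hausdorff_pre k (1 / Suc n) A)"
  by (intro incseq_SucI hausdorff_pre_antimono) (simp add: field_simps)

lemma hausdorff_outer_mono: "A \<subseteq> B \<Longrightarrow> hausdorff_outer k A \<le> hausdorff_outer k B"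
  unfolding hausdorff_outer_def by (intro SUP_mono) (auto intro: hausdorff_pre_mono)

lemma hausdorff_outer_empty [simp]: "hausdorff_outer k {} = 0"
  unfolding hausdorff_outer_eq_SUP_nat by (simp add: hausdorff_pre_empty)

lemma hausdorff_outer_countable_subadditive:
  "hausdorff_outer k (\<Union>i. A i) \<le> (\<Sum>i. hausdorff_outer k (A i))"
  unfolding hausdorff_outer_def[of k "\<Union>i. A i"]
proof (rule SUP_least)
  fix \<delta> :: real assume "\<delta> \<in> {0<..}"
  then show "hausdorff_pre k \<delta> (\<Union>i. A i) \<le> (\<Sum>i. hausdorff_outer k (A i))"
    by (intro order_trans[OF hausdorff_pre_countable_subadditive] suminf_le
        hausdorff_pre_le_outer) auto
qed

lemma hausdorff_outer_subadditive:
  "hausdorff_outer k (A \<union> B) \<le> hausdorff_outer k A + hausdorff_outer k B"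
proof -
  let ?A = "\<lambda>i::nat. if i = 0 then A else if i = 1 then B else {}"
  have "A \<union> B = (\<Union>i. ?A i)" by (auto split: if_splits intro: exI[of _ 0] exI[of _ "Suc 0"])
  then have "hausdorff_outer k (A \<union> B) \<le> (\<Sum>i. hausdorff_outer k (?A i))"
    using hausdorff_outer_countable_subadditive[of k ?A] by simp
  also have "\<dots> = (\<Sum>i<2. hausdorff_outer k (?A i))"
    by (rule suminf_finite) auto
  also have "\<dots> = hausdorff_outer k A + hausdorff_outer k B"
    by (simp add: numeral_2_eq_2)
  finally show ?thesis .
qed

text \<open>A covering set of diameter below \<open>d\<close> cannot meet both \<open>A\<close> and
  \<open>B\<close>. A fine cover of the union therefore splits into a cover of \<open>A\<close> and
  a cover of \<open>B\<close> that share no nonempty member.\<close>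

lemma hausdorff_outer_separated:
  fixes A B :: "'a::metric_space set"
  assumes d: "0 < d" and sep: "\<And>x y. x \<in> A \<Longrightarrow> y \<in> B \<Longrightarrow> d \<le> dist x y"
  shows "hausdorff_outer k A + hausdorff_outer k B \<le> hausdorff_outer k (A \<union> B)"
proof -
  have pre: "hausdorff_pre k \<delta> A + hausdorff_pre k \<delta> B \<le> hausdorff_pre k \<delta> (A \<union> B)"
    if \<delta>: "0 < \<delta>" "\<delta> < d" for \<delta>
    unfolding hausdorff_pre_def[of k \<delta> "A \<union> B"]
  proof (rule INF_greatest)
    fix C :: "nat \<Rightarrow> 'a set"
    assume "C \<in> {C. (\<forall>i. bounded (C i) \<and> diameter (C i) \<le> \<delta>) \<and> A \<union> B \<subseteq> (\<Union>i. C i)}"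
    then have C: "\<And>i. bounded (C i)" "\<And>i. diameter (C i) \<le> \<delta>" "A \<subseteq> (\<Union>i. C i)" "B \<subseteq> (\<Union>i. C i)"
      by auto
    define CA where "CA i = (if C i \<inter> A = {} then {} else C i)" for i
    define CB where "CB i = (if C i \<inter> B = {} then {} else C i)" for i
    have le: "hausdorff_size k (CA i) + hausdorff_size k (CB i) \<le> hausdorff_size k (C i)" for i
    proof (cases "C i \<inter> A = {} \<or> C i \<inter> B = {}")
      case False
      then obtain x y where xy: "x \<in> C i" "x \<in> A" "y \<in> C i" "y \<in> B" by auto
      have "d \<le> dist x y" using xy sep by auto
      also have "\<dots> \<le> diameter (C i)" using C(1) xy by (intro diameter_bounded_bound)
      also have "\<dots> \<le> \<delta>" by (rule C)
      finally show ?thesis using \<delta> by simp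
    qed (auto simp: CA_def CB_def)
    have dia: "diameter ({}::'a set) \<le> \<delta>" using \<delta> by simp
    have "hausdorff_pre k \<delta> A + hausdorff_pre k \<delta> B
        \<le> (\<Sum>i. hausdorff_size k (CA i)) + (\<Sum>i. hausdorff_size k (CB i))"
    proof (intro add_mono hausdorff_preI)
      show "A \<subseteq> (\<Union>i. CA i)" "B \<subseteq> (\<Union>i. CB i)" using C(3,4) unfolding CA_def CB_def by fastforce+
    qed (use dia C in \<open>auto simp: CA_def CB_def\<close>)
    also have "\<dots> = (\<Sum>i. hausdorff_size k (CA i) + hausdorff_size k (CB i))"
      by (subst suminf_add) auto
    also have "\<dots> \<le> (\<Sum>i. hausdorff_size k (C i))"
      by (intro suminf_le le) auto
    finally show "hausdorff_pre k \<delta> A + hausdorff_pre k \<delta> B \<le> (\<Sum>i. hausdorff_size k (C i))" .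
  qed
  have "hausdorff_outer k A + hausdorff_outer k B
      = (SUP n. hausdorff_pre k (1 / Suc n) A + hausdorff_pre k (1 / Suc n) B)"
    unfolding hausdorff_outer_eq_SUP_nat
    by (rule ennreal_SUP_add[symmetric]) (rule incseq_hausdorff_pre)+
  also have "\<dots> \<le> hausdorff_outer k (A \<union> B)"
  proof (rule SUP_least)
    fix n
    define \<delta> where "\<delta> = min (1 / Suc n) (d/2)"
    have \<delta>: "0 < \<delta>" "\<delta> < d" "\<delta> \<le> 1 / Suc n" using d by (auto simp: \<delta>_def min_less_iff_disj)
    have "hausdorff_pre k (1 / Suc n) A + hausdorff_pre k (1 / Suc n) B
        \<le> hausdorff_pre k \<delta> A + hausdorff_pre k \<delta> B"
      by (intro add_mono hausdorff_pre_antimono \<delta>)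
    also have "\<dots> \<le> hausdorff_outer k (A \<union> B)"
      using pre[OF \<delta>(1,2)] hausdorff_pre_le_outer[OF \<delta>(1)] by (rule order_trans)
    finally show "hausdorff_pre k (1 / Suc n) A + hausdorff_pre k (1 / Suc n) B
        \<le> hausdorff_outer k (A \<union> B)" .
  qed
  finally show ?thesis .
qed

lemma hausdorff_outer_sum_separated:
  fixes R :: "nat \<Rightarrow> 'a::metric_space set"
  assumes "\<And>i j. i < j \<Longrightarrow> \<exists>d>0. \<forall>x \<in> R i. \<forall>y \<in> R j. d \<le> dist x y"
  shows "(\<Sum>i<n. hausdorff_outer k (R i)) \<le> hausdorff_outer k (\<Union>i<n. R i)"
proof (induction n)
  case (Suc n)
  have "\<exists>d>0. \<forall>i<n. \<forall>x \<in> R i. \<forall>y \<in> R n. d \<le> dist x y"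
  proof -
    have "\<forall>i. \<exists>d. i < n \<longrightarrow> d > 0 \<and> (\<forall>x \<in> R i. \<forall>y \<in> R n. d \<le> dist x y)"
      using assms by blast
    then obtain d where d: "\<And>i. i < n \<Longrightarrow> d i > 0 \<and> (\<forall>x \<in> R i. \<forall>y \<in> R n. d i \<le> dist x y)"
      unfolding choice_iff by blast
    \<comment> \<open>The extra element 1 keeps the set nonempty when \<open>n = 0\<close>, so that
      its minimum is meaningful.\<close>
    have fin: "finite (insert 1 (d ` {..<n}))" by simp
    have "\<forall>i<n. Min (insert 1 (d ` {..<n})) \<le> d i"
      using fin by (auto intro!: Min_le)
    moreover have "Min (insert 1 (d ` {..<n})) > 0" using d by (subst Min_gr_iff) auto
    ultimately show ?thesis using d by (meson order_trans)
  qed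
  then obtain d where d: "d > 0" "\<And>i x y. i < n \<Longrightarrow> x \<in> R i \<Longrightarrow> y \<in> R n \<Longrightarrow> d \<le> dist x y" by blast
  have "(\<Sum>i<Suc n. hausdorff_outer k (R i))
      \<le> hausdorff_outer k (\<Union>i<n. R i) + hausdorff_outer k (R n)"
    using Suc by (simp add: add_right_mono)
  also have "\<dots> \<le> hausdorff_outer k ((\<Union>i<n. R i) \<union> R n)"
    using d by (intro hausdorff_outer_separated[of d]) auto
  also have "(\<Union>i<n. R i) \<union> R n = (\<Union>i<Suc n. R i)" by (auto simp: lessThan_Suc)
  finally show ?case .
qed simp

lemma tendsto_suminf_tail_ennreal:
  fixes f :: "nat \<Rightarrow> ennreal"
  assumes "(\<Sum>i. f i) \<noteq> top"
  shows "(\<lambda>n. \<Sum>i. f (i + n)) \<longlonglongrightarrow> 0"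
proof -
  define r where "r i = enn2real (f i)" for i
  have "f i < top" for i
    using assms ennreal_suminf_lessD[of f top i] by (simp add: less_top)
  then have f: "f i = ennreal (r i)" for i by (simp add: r_def)
  have r: "0 \<le> r i" for i by (simp add: r_def)
  have "(\<Sum>i. ennreal (r i)) \<noteq> top" using assms by (simp add: f)
  with r have "summable r" by (rule summable_suminf_not_top)
  then have sum: "summable (\<lambda>i. r (i + n))" for n by (simp add: summable_iff_shift)
  have "(\<lambda>n. suminf r - (\<Sum>i<n. r i)) \<longlonglongrightarrow> suminf r - suminf r"
    by (intro tendsto_diff tendsto_const summable_LIMSEQ \<open>summable r\<close>)
  then have "(\<lambda>n. \<Sum>i. r (i + n)) \<longlonglongrightarrow> 0"
    using \<open>summable r\<close> by (simp add: suminf_minus_initial_segment)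
  then have "(\<lambda>n. ennreal (\<Sum>i. r (i + n))) \<longlonglongrightarrow> ennreal 0" by (rule tendsto_ennrealI)
  moreover have "(\<Sum>i. f (i + n)) = ennreal (\<Sum>i. r (i + n))" for n
    unfolding f by (rule suminf_ennreal2) (use r sum in auto)
  ultimately show ?thesis by simp
qed

text \<open>Caratheodory's criterion. With \<open>X\<^sub>n = {x \<in> X. infdist x C \<ge> 1/(n+1)}\<close> the outer measure of
  \<open>X - C - X\<^sub>n\<close> is a tail of the series of the measures of shells, which converges because the
  shells of even index, and those of odd index, are pairwise separated.\<close>

lemma hausdorff_outer_closed_le:
  fixes C X :: "'a::metric_space set"
  assumes "closed C" "C \<noteq> {}"
  shows "hausdorff_outer k (X \<inter> C) + hausdorff_outer k (X - C) \<le> hausdorff_outer k X"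
proof (cases "hausdorff_outer k X = top")
  case False
  define Y where "Y n = {x \<in> X. 1 / Suc n \<le> infdist x C}" for n
  define R where "R n = {x \<in> X. 1 / Suc (Suc n) \<le> infdist x C \<and> infdist x C < 1 / Suc n}" for n
  let ?H = "hausdorff_outer k"
  have sep: "\<exists>d>0. \<forall>x \<in> R i. \<forall>y \<in> R j. d \<le> dist x y" if "Suc i < j" for i j
  proof (intro exI conjI ballI)
    \<comment> \<open>The lower edge of shell \<open>i\<close> minus the upper edge of shell
      \<open>j\<close>. For \<open>j = Suc i\<close> this is zero, which is why neighbouring shells
      have to be treated in two parity classes.\<close>
    let ?d = "1 / real (Suc (Suc i)) - 1 / real (Suc j)"
    show "0 < ?d" using that by (simp add: frac_less2)
    fix x y assume "x \<in> R i" "y \<in> R j"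
    then have "1 / real (Suc (Suc i)) \<le> infdist x C" "infdist y C < 1 / real (Suc j)"
      by (auto simp: R_def)
    then show "?d \<le> dist x y" using infdist_triangle[of x C y] by simp
  qed
  have half: "(\<Sum>i<n. ?H (R (2*i+b))) \<le> ?H X" for n b
  proof (rule order_trans[OF hausdorff_outer_sum_separated hausdorff_outer_mono])
    show "\<exists>d>0. \<forall>x \<in> R (2*i+b). \<forall>y \<in> R (2*j+b). d \<le> dist x y" if "i < j" for i j
      using that by (intro sep) simp
  qed (auto simp: R_def)
  have "(\<Sum>i<n. ?H (R i)) \<le> ?H X + ?H X" for n
  proof -
    have "(\<Sum>i<n. ?H (R i)) \<le> (\<Sum>i<2*n. ?H (R i))" by (rule sum_mono2) auto
    also have "\<dots> = (\<Sum>i<n. ?H (R (2*i+0))) + (\<Sum>i<n. ?H (R (2*i+1)))"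
      by (induction n) (auto simp: algebra_simps)
    also have "\<dots> \<le> ?H X + ?H X" by (intro add_mono half)
    finally show ?thesis .
  qed
  then have "(\<Sum>i. ?H (R i)) \<le> ?H X + ?H X"
    by (subst suminf_eq_SUP) (auto intro: SUP_least)
  also have "\<dots> < top" using False by (simp add: less_top)
  finally have fin: "(\<Sum>i. ?H (R i)) \<noteq> \<infinity>" by simp
  have main: "?H (X \<inter> C) + ?H (X - C) \<le> ?H X + (\<Sum>i. ?H (R (i + n)))" for n
  proof -
    have "X - C \<subseteq> Y n \<union> (\<Union>i. R (i + n))"
    proof
      fix x assume x: "x \<in> X - C"
      then have pos: "0 < infdist x C"
        using assms by (simp add: infdist_pos_not_in_closed)
      then obtain m where m: "1 / Suc m \<le> infdist x C"
        using reals_Archimedean[OF pos] by (auto simp: inverse_eq_divide intro: less_imp_le)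
      define l where "l = (LEAST m. 1 / Suc m \<le> infdist x C)"
      have l: "1 / Suc l \<le> infdist x C" unfolding l_def by (rule LeastI[of _ m]) (rule m)
      have l': "infdist x C < 1 / Suc j" if "j < l" for j
        using not_less_Least[of j] that unfolding l_def by force
      show "x \<in> Y n \<union> (\<Union>i. R (i + n))"
      proof (cases "l \<le> n")
        case True
        then have "1 / real (Suc n) \<le> 1 / real (Suc l)" by (simp add: field_simps)
        with l x show ?thesis by (auto simp: Y_def)
      next
        case False
        then obtain i where i: "l = Suc (i + n)"
          by (metis add.commute less_imp_Suc_add not_le)
        have "x \<in> R (i + n)" using l l'[of "i+n"] x i by (auto simp: R_def)
        then show ?thesis by auto
      qed
    qed
    then have "?H (X - C) \<le> ?H (Y n \<union> (\<Union>i. R (i + n)))" by (rule hausdorff_outer_mono)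
    also have "\<dots> \<le> ?H (Y n) + (\<Sum>i. ?H (R (i + n)))"
      by (rule order_trans[OF hausdorff_outer_subadditive add_left_mono])
         (rule hausdorff_outer_countable_subadditive)
    finally have "?H (X \<inter> C) + ?H (X - C) \<le> (?H (X \<inter> C) + ?H (Y n)) + (\<Sum>i. ?H (R (i + n)))"
      by (simp add: add.assoc add_left_mono)
    also have "?H (X \<inter> C) + ?H (Y n) \<le> ?H ((X \<inter> C) \<union> Y n)"
    proof (rule hausdorff_outer_separated)
      fix x y assume "x \<in> X \<inter> C" "y \<in> Y n"
      then show "1 / real (Suc n) \<le> dist x y"
        using infdist_le[of x C y] by (auto simp: Y_def dist_commute)
    qed simp
    also have "\<dots> \<le> ?H X" by (rule hausdorff_outer_mono) (auto simp: Y_def)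
    finally show ?thesis by (simp add: add_right_mono)
  qed
  have "(\<lambda>n. \<Sum>i. ?H (R (i + n))) \<longlonglongrightarrow> 0"
    using fin by (intro tendsto_suminf_tail_ennreal) simp
  then have "(\<lambda>n. ?H X + (\<Sum>i. ?H (R (i + n)))) \<longlonglongrightarrow> ?H X + 0"
    by (intro tendsto_add tendsto_const)
  then show ?thesis using main by (intro LIMSEQ_le_const[of _ "?H X"]) auto
qed simp

text \<open>\<open>measure_of\<close> falls back to the zero measure when its argument is not a
  measure, so every evaluation of the surface measure rests on this fact. Closed sets satisfy the
  Caratheodory condition, and they generate the Borel sets.\<close>

lemma measure_space_hausdorff: "measure_space UNIV (sets borel) (hausdorff_outer k)"
proof -
  interpret S: sigma_algebra UNIV "Pow UNIV :: 'a::metric_space set set" by (rule sigma_algebra_Pow)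
  let ?L = "lambda_system UNIV (Pow UNIV) (hausdorff_outer k) :: 'a set set"
  have oms: "outer_measure_space (Pow UNIV) (hausdorff_outer k :: 'a set \<Rightarrow> ennreal)"
    unfolding outer_measure_space_def positive_def increasing_def countably_subadditive_def
    by (auto intro: hausdorff_outer_mono hausdorff_outer_countable_subadditive)
  have ms: "measure_space UNIV ?L (hausdorff_outer k)"
    by (rule S.caratheodory_lemma[OF oms])
  have closed: "C \<in> ?L" if "closed C" for C :: "'a set"
  proof (cases "C = {}")
    case False
    have "hausdorff_outer k (C \<inter> x) + hausdorff_outer k ((UNIV - C) \<inter> x) = hausdorff_outer k x" for x
    proof (rule antisym)
      show "hausdorff_outer k (C \<inter> x) + hausdorff_outer k ((UNIV - C) \<inter> x) \<le> hausdorff_outer k x"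
        using hausdorff_outer_closed_le[OF that False, of k x]
        by (simp add: Int_commute Diff_eq)
      have "x = (C \<inter> x) \<union> ((UNIV - C) \<inter> x)" by auto
      then show "hausdorff_outer k x \<le> hausdorff_outer k (C \<inter> x) + hausdorff_outer k ((UNIV - C) \<inter> x)"
        using hausdorff_outer_subadditive[of k "C \<inter> x" "(UNIV - C) \<inter> x"] by simp
    qed
    then show ?thesis by (simp add: lambda_system_def)
  qed (simp add: lambda_system_def)
  have sa: "sigma_algebra UNIV ?L" using ms by (simp add: measure_space_def)
  have "sets (borel :: 'a measure) = sigma_sets UNIV (Collect closed)"
    by (simp add: borel_eq_closed)
  also have "\<dots> \<subseteq> ?L" using closed by (intro sigma_algebra.sigma_sets_subset[OF sa]) auto
  finally have sub: "sets (borel :: 'a measure) \<subseteq> ?L" .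
  show ?thesis
    by (rule measure_down[OF ms _ sub]) (metis sets.sigma_algebra_axioms space_borel)
qed

lemma sets_hausdorff_measure [simp, measurable_cong]: "sets (hausdorff_measure k) = sets borel"
  unfolding hausdorff_measure_def by (metis sets.sets_measure_of_eq space_borel)

lemma space_hausdorff_measure [simp]: "space (hausdorff_measure k) = UNIV"
  unfolding hausdorff_measure_def by simp

lemma emeasure_hausdorff_measure:
  fixes E :: "'a::metric_space set"
  assumes "E \<in> sets borel"
  shows "emeasure (hausdorff_measure k) E = hausdorff_outer k E"
proof (rule emeasure_measure_of[OF hausdorff_measure_def])
  have "measure_space UNIV (sets (borel :: 'a measure)) (hausdorff_outer k)"
    by (rule measure_space_hausdorff)
  then
  show "positive (sets (hausdorff_measure k)) (hausdorff_outer k :: 'a set \<Rightarrow> ennreal)"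
    "countably_additive (sets (hausdorff_measure k)) (hausdorff_outer k :: 'a set \<Rightarrow> ennreal)"
    by (simp_all add: measure_space_def)
qed (use assms in auto)

section \<open>The isodiametric inequality\<close>

text \<open>Lebesgue measure is the image of a product over the basis vectors; splitting off one
  factor is Fubini's theorem along the axis that is symmetrised.\<close>

lemma nn_integral_lborel_slice:
  fixes f :: "'a::euclidean_space \<Rightarrow> ennreal"
  assumes b: "b \<in> Basis" and [measurable]: "f \<in> borel_measurable borel"
  shows "(\<integral>\<^sup>+x. f x \<partial>lborel) =
    (\<integral>\<^sup>+y. (\<integral>\<^sup>+s. f ((\<Sum>b'\<in>Basis - {b}. y b' *\<^sub>R b') + s *\<^sub>R b) \<partial>lborel)
       \<partial>(\<Pi>\<^sub>M b'\<in>Basis - {b}. lborel))"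
proof -
  interpret product_sigma_finite "\<lambda>_::'a. lborel :: real measure" by standard
  have B: "Basis = insert b (Basis - {b})" using b by auto
  have "(\<integral>\<^sup>+x. f x \<partial>lborel) =
      (\<integral>\<^sup>+y. f (\<Sum>b'\<in>Basis. y b' *\<^sub>R b') \<partial>(\<Pi>\<^sub>M b'\<in>Basis. lborel))"
    by (subst lborel_eq) (simp add: nn_integral_distr)
  also have "\<dots> = (\<integral>\<^sup>+y. f (\<Sum>b'\<in>Basis. y b' *\<^sub>R b') \<partial>(\<Pi>\<^sub>M b'\<in>insert b (Basis - {b}). lborel))"
    using B by simp
  also have "\<dots> = (\<integral>\<^sup>+y. (\<integral>\<^sup>+s. f (\<Sum>b'\<in>Basis. (y(b := s)) b' *\<^sub>R b') \<partial>lborel)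
       \<partial>(\<Pi>\<^sub>M b'\<in>Basis - {b}. lborel))"
    by (rule product_nn_integral_insert) (simp_all add: insert_absorb[OF b])
  also have "\<dots> = (\<integral>\<^sup>+y. (\<integral>\<^sup>+s. f ((\<Sum>b'\<in>Basis - {b}. y b' *\<^sub>R b') + s *\<^sub>R b) \<partial>lborel)
       \<partial>(\<Pi>\<^sub>M b'\<in>Basis - {b}. lborel))"
    by (intro nn_integral_cong arg_cong[of _ _ f])
       (simp add: sum.remove[OF finite_Basis b] add.commute)
  finally show ?thesis .
qed

text \<open>The set is the open interval of length \<open>m\<close> centred at 0, or the whole line
  if \<open>m\<close> is infinite. Sections of infinite measure thus need no separate treatment in
  the symmetrisation.\<close>

lemma emeasure_less_half_abs:
  "emeasure lborel {s::real. ennreal (2 * \<bar>s\<bar>) < m} = m"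
proof (cases m)
  case (real r)
  have "{s::real. ennreal (2 * \<bar>s\<bar>) < m} = {- r/2<..<r/2}"
    using real by (auto simp: ennreal_less_iff abs_less_iff)
  then show ?thesis using real by simp
next
  case top
  then show ?thesis by simp
qed

text \<open>Otherwise both \<open>Sup X - Inf Y\<close> and \<open>Sup Y - Inf X\<close> are at most
  \<open>p + q\<close>. Adding them bounds the sum of the two spans by \<open>2 * (p + q)\<close>,
  whereas the measures force it to be larger.\<close>

lemma exists_far_points:
  fixes X Y :: "real set"
  assumes X: "ennreal (2 * p) < emeasure lborel X" and Y: "ennreal (2 * q) < emeasure lborel Y"
    and pq: "0 \<le> p" "0 \<le> q"
  shows "\<exists>s\<in>X. \<exists>t\<in>Y. p + q \<le> \<bar>s - t\<bar>"
proof (rule ccontr)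
  assume "\<not> ?thesis"
  then have less: "\<And>s t. s \<in> X \<Longrightarrow> t \<in> Y \<Longrightarrow> \<bar>s - t\<bar> < p + q" by force
  have "X \<noteq> {}" "Y \<noteq> {}" using X Y by auto
  then obtain x0 y0 where x0: "x0 \<in> X" and y0: "y0 \<in> Y" by auto
  have bX: "bdd_above X" "bdd_below X"
    using less[OF _ y0] by (auto intro!: bdd_aboveI[of _ "y0 + p + q"] bdd_belowI[of _ "y0 - p - q"])
      (smt (verit))+
  have bY: "bdd_above Y" "bdd_below Y"
    using less[OF x0] by (auto intro!: bdd_aboveI[of _ "x0 + p + q"] bdd_belowI[of _ "x0 - p - q"])
      (smt (verit))+
  have 1: "Sup X \<le> Inf Y + (p + q)"
  proof (rule cSup_least[OF \<open>X \<noteq> {}\<close>])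
    fix x assume "x \<in> X"
    then have "x - (p + q) \<le> Inf Y"
      using less \<open>Y \<noteq> {}\<close> by (intro cInf_greatest) (auto, smt (verit))
    then show "x \<le> Inf Y + (p + q)" by simp
  qed
  have 2: "Sup Y \<le> Inf X + (p + q)"
  proof (rule cSup_least[OF \<open>Y \<noteq> {}\<close>])
    fix y assume "y \<in> Y"
    then have "y - (p + q) \<le> Inf X"
      using less \<open>X \<noteq> {}\<close> by (intro cInf_greatest) (auto, smt (verit))
    then show "y \<le> Inf X + (p + q)" by simp
  qed
  have le: "emeasure lborel Z \<le> ennreal (Sup Z - Inf Z)"
    if "bdd_above Z" "bdd_below Z" "Z \<noteq> {}" for Z :: "real set"
  proof -
    have "Inf Z \<le> Sup Z" using that by (meson cInf_le_cSup)
    have "emeasure lborel Z \<le> emeasure lborel {Inf Z..Sup Z}"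
      using that by (intro emeasure_mono) (auto intro: cInf_lower cSup_upper)
    then show ?thesis using \<open>Inf Z \<le> Sup Z\<close> by simp
  qed
  have "ennreal (2 * p) < ennreal (Sup X - Inf X)" "ennreal (2 * q) < ennreal (Sup Y - Inf Y)"
    using X Y le[OF bX \<open>X \<noteq> {}\<close>] le[OF bY \<open>Y \<noteq> {}\<close>] by (auto intro: less_le_trans)
  then have "2 * p < Sup X - Inf X" "2 * q < Sup Y - Inf Y" using pq by (auto simp: ennreal_less_iff)
  with 1 2 show False by simp
qed

text \<open>Every line parallel to \<open>b\<close> is replaced by the centred open interval with
  the measure of its section. The shift by \<open>x \<bullet> b\<close> makes \<open>s\<close> the
  coordinate along \<open>b\<close>, so the section depends only on the line through
  \<open>x\<close>, not on \<open>x\<close>.\<close>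

definition steiner :: "'a::euclidean_space \<Rightarrow> 'a set \<Rightarrow> 'a set" where
  "steiner b C = {x. ennreal (2 * \<bar>x \<bullet> b\<bar>) < emeasure lborel {s. x + (s - x \<bullet> b) *\<^sub>R b \<in> C}}"

lemma sets_steiner [measurable]:
  fixes C :: "'a::euclidean_space set"
  assumes [measurable]: "C \<in> sets borel"
  shows "steiner b C \<in> sets borel"
proof -
  let ?E = "(\<lambda>(x, s). x + (s - x \<bullet> b) *\<^sub>R b) -` C \<inter> space (borel \<Otimes>\<^sub>M lborel)"
  have "(\<lambda>x. emeasure lborel (Pair x -` ?E)) \<in> borel_measurable (borel :: 'a measure)"
    by (intro lborel.measurable_emeasure_Pair measurable_sets[OF _ assms]) measurable
  then have [measurable]: "(\<lambda>x. emeasure lborel {s. x + (s - x \<bullet> b) *\<^sub>R b \<in> C}) \<in> borel_measurable (borel :: 'a measure)"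
    by (simp add: vimage_def space_pair_measure)
  show ?thesis unfolding steiner_def by measurable
qed

lemma emeasure_steiner:
  fixes C :: "'a::euclidean_space set"
  assumes b: "b \<in> Basis" and [measurable]: "C \<in> sets borel"
  shows "emeasure lborel (steiner b C) = emeasure lborel C"
proof -
  let ?p = "\<lambda>y::'a\<Rightarrow>real. (\<Sum>b'\<in>Basis - {b}. y b' *\<^sub>R b')"
  have ort: "?p y \<bullet> b = 0" for y
    using b by (auto simp: inner_sum_left inner_Basis intro!: sum.neutral)
  have slice: "emeasure lborel E = (\<integral>\<^sup>+y. emeasure lborel {s. ?p y + s *\<^sub>R b \<in> E}
       \<partial>(\<Pi>\<^sub>M b'\<in>Basis - {b}. lborel))" if [measurable]: "E \<in> sets borel" for E
  proof -
    have "emeasure lborel E = (\<integral>\<^sup>+x. indicator E x \<partial>lborel)" by simp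
    also have "\<dots> = (\<integral>\<^sup>+y. (\<integral>\<^sup>+s. indicator E (?p y + s *\<^sub>R b) \<partial>lborel)
       \<partial>(\<Pi>\<^sub>M b'\<in>Basis - {b}. lborel))"
      by (rule nn_integral_lborel_slice[OF b]) simp
    also have "\<dots> = (\<integral>\<^sup>+y. (\<integral>\<^sup>+s. indicator {s. ?p y + s *\<^sub>R b \<in> E} s \<partial>lborel)
       \<partial>(\<Pi>\<^sub>M b'\<in>Basis - {b}. lborel))"
      by (intro nn_integral_cong) (auto simp: indicator_def)
    finally show ?thesis by (simp add: nn_integral_indicator)
  qed
  have "{s. ?p y + s *\<^sub>R b \<in> steiner b C} = {s. ennreal (2 * \<bar>s\<bar>) < emeasure lborel {s. ?p y + s *\<^sub>R b \<in> C}}" for y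
    using b by (simp add: steiner_def inner_add_left ort algebra_simps)
  then have "emeasure lborel {s. ?p y + s *\<^sub>R b \<in> steiner b C} = emeasure lborel {s. ?p y + s *\<^sub>R b \<in> C}" for y
    by (simp add: emeasure_less_half_abs)
  then show ?thesis by (subst (1 2) slice) auto
qed

text \<open>The components orthogonal to \<open>b\<close> are unchanged, and the sections of
  \<open>C\<close> through \<open>x\<close> and \<open>y\<close> contain points whose coordinates
  along \<open>b\<close> differ by at least
  \<open>\<bar>x \<bullet> b\<bar> + \<bar>y \<bullet> b\<bar>\<close>. By Pythagoras these two
  points of \<open>C\<close> are at least as far apart as \<open>x\<close> and
  \<open>y\<close>.\<close>

lemma dist_steiner_le:
  fixes C :: "'a::euclidean_space set"
  assumes b: "b \<in> Basis" and C: "\<And>x y. x \<in> C \<Longrightarrow> y \<in> C \<Longrightarrow> dist x y \<le> d"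
    and x: "x \<in> steiner b C" and y: "y \<in> steiner b C"
  shows "dist x y \<le> d"
proof -
  from x y exists_far_points[of "\<bar>x \<bullet> b\<bar>" "{s. x + (s - x \<bullet> b) *\<^sub>R b \<in> C}" "\<bar>y \<bullet> b\<bar>" "{s. y + (s - y \<bullet> b) *\<^sub>R b \<in> C}"]
  obtain s t where st: "x + (s - x \<bullet> b) *\<^sub>R b \<in> C" "y + (t - y \<bullet> b) *\<^sub>R b \<in> C"
    and le: "\<bar>x \<bullet> b\<bar> + \<bar>y \<bullet> b\<bar> \<le> \<bar>s - t\<bar>"
    by (auto simp: steiner_def)
  define P where "P = (x - (x \<bullet> b) *\<^sub>R b) - (y - (y \<bullet> b) *\<^sub>R b)"
  have "P \<bullet> b = 0" using b by (simp add: P_def inner_diff_left)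
  then have "(P + r *\<^sub>R b) \<bullet> (P + r *\<^sub>R b) = P \<bullet> P + r * r" for r
    using b by (simp add: inner_add_left inner_add_right inner_commute[of b P])
  then have pyth: "(norm (P + r *\<^sub>R b))\<^sup>2 = (norm P)\<^sup>2 + r\<^sup>2" for r
    unfolding power2_norm_eq_inner by (simp add: power2_eq_square)
  have "x - y = P + (x \<bullet> b - y \<bullet> b) *\<^sub>R b" by (simp add: P_def algebra_simps)
  then have "(norm (x - y))\<^sup>2 = (norm P)\<^sup>2 + (x \<bullet> b - y \<bullet> b)\<^sup>2" by (simp add: pyth)
  also have "(x \<bullet> b - y \<bullet> b)\<^sup>2 \<le> (s - t)\<^sup>2"
    using le abs_triangle_ineq4[of "x \<bullet> b" "y \<bullet> b"] by (subst abs_le_square_iff[symmetric]) linarith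
  also have "(norm P)\<^sup>2 + (s - t)\<^sup>2 = (norm (P + (s - t) *\<^sub>R b))\<^sup>2" by (simp add: pyth)
  also have "P + (s - t) *\<^sub>R b = (x + (s - x \<bullet> b) *\<^sub>R b) - (y + (t - y \<bullet> b) *\<^sub>R b)"
    by (simp add: P_def algebra_simps)
  finally have "(norm (x - y))\<^sup>2 \<le> (norm ((x + (s - x \<bullet> b) *\<^sub>R b) - (y + (t - y \<bullet> b) *\<^sub>R b)))\<^sup>2"
    by simp
  then have "norm (x - y) \<le> norm ((x + (s - x \<bullet> b) *\<^sub>R b) - (y + (t - y \<bullet> b) *\<^sub>R b))"
    by (rule power2_le_imp_le[OF _ norm_ge_zero])
  then show ?thesis using C[OF st] by (simp add: dist_norm)
qed

lemma steiner_reflect_same: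
  assumes "b \<in> Basis" "x \<in> steiner b C"
  shows "x - (2 * (x \<bullet> b)) *\<^sub>R b \<in> steiner b C"
proof -
  define a where "a = x \<bullet> b"
  have "(2 * a) *\<^sub>R b = a *\<^sub>R b + a *\<^sub>R b"
    by (simp flip: scaleR_left_distrib)
  then have eq: "x - (2 * a) *\<^sub>R b + (s + a) *\<^sub>R b = x + (s - a) *\<^sub>R b" for s
    by (simp add: scaleR_left_distrib scaleR_left_diff_distrib)
  have "{s. x - (2 * a) *\<^sub>R b + (s + a) *\<^sub>R b \<in> C} = {s. x + (s - a) *\<^sub>R b \<in> C}"
    by (simp only: eq)
  then show ?thesis
    using assms by (simp add: steiner_def inner_diff_left flip: a_def)
qed

text \<open>Symmetries gained along other axes survive a symmetrisation, which is what allows the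
  axes to be processed one after the other.\<close>

lemma steiner_reflect_other:
  assumes "b \<in> Basis" "b' \<in> Basis" "b \<noteq> b'" and x: "x \<in> steiner b C"
    and C: "\<And>x. x \<in> C \<Longrightarrow> x - (2 * (x \<bullet> b')) *\<^sub>R b' \<in> C"
  shows "x - (2 * (x \<bullet> b')) *\<^sub>R b' \<in> steiner b C"
proof -
  have o: "b \<bullet> b' = 0" "b' \<bullet> b = 0" using assms by (simp_all add: inner_not_same_Basis)
  let ?x = "x - (2 * (x \<bullet> b')) *\<^sub>R b'"
  have C': "y - (2 * (y \<bullet> b')) *\<^sub>R b' \<in> C \<longleftrightarrow> y \<in> C" for y
  proof
    assume "y - (2 * (y \<bullet> b')) *\<^sub>R b' \<in> C"
    from C[OF this] show "y \<in> C" using assms(2) by (simp add: inner_diff_left algebra_simps)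
  qed (rule C)
  have "?x + (s - x \<bullet> b) *\<^sub>R b \<in> C \<longleftrightarrow> x + (s - x \<bullet> b) *\<^sub>R b \<in> C" for s
    using C'[of "x + (s - x \<bullet> b) *\<^sub>R b"] by (simp add: o inner_add_left algebra_simps)
  moreover have "?x \<bullet> b = x \<bullet> b" by (simp add: o inner_diff_left)
  ultimately show ?thesis using x by (simp add: steiner_def)
qed

text \<open>The isodiametric inequality: symmetrising along all coordinate axes makes the set symmetric
  about the origin, hence contained in a ball whose diameter is that of the set.\<close>

theorem isodiametric:
  fixes C :: "'a::euclidean_space set"
  assumes C: "C \<in> sets borel" "\<And>x y. x \<in> C \<Longrightarrow> y \<in> C \<Longrightarrow> dist x y \<le> d" and d: "0 \<le> d"
  shows "emeasure lborel C \<le> ennreal (unit_ball_vol (DIM('a)) * (d / 2) ^ DIM('a))"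
proof -
  have "\<exists>S. S \<in> sets borel \<and> emeasure lborel S = emeasure lborel C \<and>
      (\<forall>x\<in>S. \<forall>y\<in>S. dist x y \<le> d) \<and> (\<forall>b\<in>T. \<forall>x\<in>S. x - (2 * (x \<bullet> b)) *\<^sub>R b \<in> S)"
    if "finite T" "T \<subseteq> Basis" for T :: "'a set"
    using that
  proof (induction T)
    case empty
    then show ?case using C by (intro exI[of _ C]) auto
  next
    case (insert b T)
    then obtain S :: "'a set" where S: "S \<in> sets borel" "emeasure lborel S = emeasure lborel C"
      "\<And>x y. x \<in> S \<Longrightarrow> y \<in> S \<Longrightarrow> dist x y \<le> d" "\<And>b x. b \<in> T \<Longrightarrow> x \<in> S \<Longrightarrow> x - (2 * (x \<bullet> b)) *\<^sub>R b \<in> S"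
      by auto
    have "x - (2 * (x \<bullet> b')) *\<^sub>R b' \<in> steiner b S" if "b' \<in> insert b T" "x \<in> steiner b S" for b' x
    proof (cases "b' = b")
      case True
      then show ?thesis using insert.prems that steiner_reflect_same[of b x S] by auto
    next
      case False
      then show ?thesis using insert.prems that S(4) by (intro steiner_reflect_other) auto
    qed
    moreover have "b \<in> Basis" using insert.prems by simp
    ultimately show ?case
      using S dist_steiner_le[of b S d] emeasure_steiner[of b S]
      by (intro exI[of _ "steiner b S"]) auto
  qed
  from this[of Basis] obtain S :: "'a set" where S: "S \<in> sets borel" "emeasure lborel S = emeasure lborel C"
      "\<And>x y. x \<in> S \<Longrightarrow> y \<in> S \<Longrightarrow> dist x y \<le> d" "\<And>b x. b \<in> Basis \<Longrightarrow> x \<in> S \<Longrightarrow> x - (2 * (x \<bullet> b)) *\<^sub>R b \<in> S"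
    by auto
  have minus: "- x \<in> S" if x: "x \<in> S" for x
  proof -
    \<comment> \<open>Composing the reflections in all coordinate hyperplanes gives the point
      reflection; each one acts on a coordinate that the previous ones left alone.\<close>
    have "x - (\<Sum>b\<in>T. (2 * (x \<bullet> b)) *\<^sub>R b) \<in> S" if "finite T" "T \<subseteq> Basis" for T
      using that
    proof (induction T)
      case (insert b T)
      let ?y = "x - (\<Sum>b\<in>T. (2 * (x \<bullet> b)) *\<^sub>R b)"
      have "(\<Sum>b'\<in>T. (2 * (x \<bullet> b')) *\<^sub>R b') \<bullet> b = 0"
        using insert by (auto simp: inner_sum_left intro!: sum.neutral inner_not_same_Basis)
      then have "?y \<bullet> b = x \<bullet> b" by (simp add: inner_diff_left)
      then show ?case using S(4)[of b ?y] insert by (simp add: algebra_simps)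
    qed (simp add: x)
    from this[of Basis] have "x - 2 *\<^sub>R x \<in> S"
      by (simp add: scaleR_scaleR[symmetric] scaleR_sum_right[symmetric] euclidean_representation
          del: scaleR_scaleR)
    then show ?thesis by (simp add: scaleR_2)
  qed
  have "S \<subseteq> cball 0 (d / 2)"
  proof
    fix x assume x: "x \<in> S"
    have "dist x (- x) = 2 * norm x" by (simp add: dist_norm flip: scaleR_2)
    then show "x \<in> cball 0 (d / 2)" using S(3)[OF x minus[OF x]] by simp
  qed
  then have "emeasure lborel S \<le> emeasure lborel (cball (0::'a) (d / 2))" by (rule emeasure_mono) simp
  also have "\<dots> = ennreal (unit_ball_vol (DIM('a)) * (d / 2) ^ DIM('a))"
    using d by (intro emeasure_cball) simp
  finally show ?thesis by (simp add: S)
qed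

section \<open>Hausdorff and Lebesgue measure\<close>

lemma hausdorff_pre_subadditive:
  assumes "0 < \<delta>"
  shows "hausdorff_pre k \<delta> (A \<union> B) \<le> hausdorff_pre k \<delta> A + hausdorff_pre k \<delta> B"
proof -
  let ?A = "\<lambda>i::nat. if i = 0 then A else if i = 1 then B else {}"
  have "A \<union> B = (\<Union>i. ?A i)" by (auto split: if_splits intro: exI[of _ 0] exI[of _ "Suc 0"])
  then have "hausdorff_pre k \<delta> (A \<union> B) \<le> (\<Sum>i. hausdorff_pre k \<delta> (?A i))"
    using hausdorff_pre_countable_subadditive[of k \<delta> ?A] by simp
  also have "\<dots> = (\<Sum>i<2. hausdorff_pre k \<delta> (?A i))"
    by (rule suminf_finite) (use assms in \<open>auto simp: hausdorff_pre_empty\<close>)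
  also have "\<dots> = hausdorff_pre k \<delta> A + hausdorff_pre k \<delta> B"
    by (simp add: numeral_2_eq_2)
  finally show ?thesis .
qed

text \<open>Vitali's theorems deliver covers indexed by a countable set of points or of balls,
  whereas the definition asks for sequences; missing indices are filled with empty sets, which have
  size 0.\<close>

lemma hausdorff_pre_le_countable:
  assumes I: "countable I" and \<delta>: "0 < \<delta>"
    and C: "\<And>i. i \<in> I \<Longrightarrow> bounded (C i)" "\<And>i. i \<in> I \<Longrightarrow> diameter (C i) \<le> \<delta>" "A \<subseteq> (\<Union>i\<in>I. C i)"
  shows "hausdorff_pre k \<delta> A \<le> (\<integral>\<^sup>+i. hausdorff_size k (C i) \<partial>count_space I)"
proof -
  let ?J = "to_nat_on I ` I"
  define D where "D n = (if n \<in> ?J then C (from_nat_into I n) else {})" for n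
  have bij: "bij_betw (to_nat_on I) I ?J"
    by (rule inj_on_imp_bij_betw[OF inj_on_to_nat_on[OF I]])
  have "hausdorff_pre k \<delta> A \<le> (\<Sum>n. hausdorff_size k (D n))"
  proof (rule hausdorff_preI)
    show "A \<subseteq> (\<Union>n. D n)"
    proof
      fix x assume "x \<in> A"
      then obtain i where i: "i \<in> I" "x \<in> C i" using C(3) by auto
      then have "x \<in> D (to_nat_on I i)" using I by (simp add: D_def)
      then show "x \<in> (\<Union>n. D n)" by blast
    qed
  qed (use C I \<delta> in \<open>auto simp: D_def\<close>)
  also have "\<dots> = (\<integral>\<^sup>+n. hausdorff_size k (D n) \<partial>count_space UNIV)"
    by (simp add: nn_integral_count_space_nat)
  also have "\<dots> = (\<integral>\<^sup>+n. hausdorff_size k (D n) \<partial>count_space ?J)"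
    by (subst (2) nn_integral_count_space_indicator)
       (auto intro!: nn_integral_cong simp: indicator_def D_def)
  also have "\<dots> = (\<integral>\<^sup>+i. hausdorff_size k (D (to_nat_on I i)) \<partial>count_space I)"
    by (rule nn_integral_bij_count_space[OF bij, symmetric])
  also have "\<dots> = (\<integral>\<^sup>+i. hausdorff_size k (C i) \<partial>count_space I)"
    using I by (intro nn_integral_cong) (simp add: D_def)
  finally show ?thesis .
qed

lemma hausdorff_size_cball:
  fixes x :: "'a::euclidean_space"
  assumes "0 \<le> r"
  shows "hausdorff_size (DIM('a)) (cball x r) = emeasure lborel (cball x r)"
  using assms by (simp add: hausdorff_size_def emeasure_cball diameter_cball)

text \<open>Covering sets need not be measurable. Passing to closures makes them Borel without
  changing the diameter, and then the isodiametric inequality applies to each of them.\<close>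

lemma lborel_le_hausdorff_pre:
  fixes E :: "'a::euclidean_space set"
  assumes [measurable]: "E \<in> sets borel" and \<delta>: "0 < \<delta>"
  shows "emeasure lborel E \<le> hausdorff_pre (DIM('a)) \<delta> E"
  unfolding hausdorff_pre_def
proof (rule INF_greatest)
  fix C :: "nat \<Rightarrow> 'a set"
  assume "C \<in> {C. (\<forall>i. bounded (C i) \<and> diameter (C i) \<le> \<delta>) \<and> E \<subseteq> (\<Union>i. C i)}"
  then have C: "\<And>i. bounded (C i)" "E \<subseteq> (\<Union>i. C i)" by auto
  have "emeasure lborel E \<le> emeasure lborel (\<Union>i. closure (C i))"
    using C(2) closure_subset by (intro emeasure_mono) (auto, blast)
  also have "\<dots> \<le> (\<Sum>i. emeasure lborel (closure (C i)))"
    by (rule emeasure_subadditive_countably) auto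
  also have "\<dots> \<le> (\<Sum>i. hausdorff_size (DIM('a)) (C i))"
  proof (intro suminf_le)
    fix i
    show "emeasure lborel (closure (C i)) \<le> hausdorff_size (DIM('a)) (C i)"
    proof (cases "C i = {}")
      case False
      have "emeasure lborel (closure (C i))
          \<le> ennreal (unit_ball_vol (DIM('a)) * (diameter (C i) / 2) ^ DIM('a))"
        using C(1)[of i] diameter_bounded_bound[of "closure (C i)"]
        by (intro isodiametric) (auto simp: diameter_closure diameter_ge_0 bounded_closure)
      then show ?thesis using False by (simp add: hausdorff_size_def)
    qed simp
  qed auto
  finally show "emeasure lborel E \<le> (\<Sum>i. hausdorff_size (DIM('a)) (C i))" .
qed

text \<open>Disposes of the null remainder left by Vitali's covering theorem. The cruder covering
  lemma with fivefold radii suffices here, since a constant factor does no harm to a null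
  set.\<close>

lemma hausdorff_pre_negligible:
  fixes N :: "'a::euclidean_space set"
  assumes "negligible N" and \<delta>: "0 < \<delta>"
  shows "hausdorff_pre (DIM('a)) \<delta> N = 0"
proof -
  obtain N' where N': "N' \<in> null_sets lborel" "N \<subseteq> N'"
    using assms(1) unfolding negligible_iff_null_sets null_sets_completion_iff2 by auto
  have "hausdorff_pre (DIM('a)) \<delta> N \<le> 0 + ennreal e" if e: "0 < e" for e
  proof -
    \<comment> \<open>Compensates the volume factor of the balls with fivefold radius.\<close>
    let ?e = "e / 5 ^ DIM('a)"
    have pos: "0 < ?e" using e by simp
    have N'b: "N' \<in> sets borel" using N' by (auto simp: null_sets_def)
    obtain U where U: "open U" "N' \<subseteq> U" "emeasure lborel (U - N') \<le> ennreal ?e"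
      using outer_regular_lborel_le[OF N'b pos] by blast
    have "emeasure lborel U \<le> emeasure lborel (U - N') + emeasure lborel N'"
    proof -
      have "emeasure lborel U \<le> emeasure lborel ((U - N') \<union> N')"
        using U N' by (intro emeasure_mono) auto
      also have "\<dots> \<le> emeasure lborel (U - N') + emeasure lborel N'"
        using U N' by (intro emeasure_subadditive) auto
      finally show ?thesis .
    qed
    then have Ue: "emeasure lborel U \<le> ennreal ?e" using U N' by (simp add: null_sets_def)
    \<comment> \<open>The enlarged ball of radius \<open>5 * r\<close> has diameter
      \<open>10 * r\<close>, which must not exceed \<delta>.\<close>
    have "\<exists>r. 0 < r \<and> 10 * r \<le> \<delta> \<and> cball x r \<subseteq> U" if "x \<in> N" for x
    proof -
      have "x \<in> U" using U N' that by auto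
      then obtain r where r: "0 < r" "cball x r \<subseteq> U"
        using U(1) unfolding open_contains_cball by blast
      have "cball x (min r (\<delta> / 10)) \<subseteq> cball x r" by (rule subset_cball) simp
      with r(2) have "cball x (min r (\<delta> / 10)) \<subseteq> U" by (rule order_trans[rotated])
      then show ?thesis using r \<delta> by (intro exI[of _ "min r (\<delta> / 10)"]) auto
    qed
    then obtain r where r: "\<And>x. x \<in> N \<Longrightarrow> 0 < r x" "\<And>x. x \<in> N \<Longrightarrow> 10 * r x \<le> \<delta>"
      "\<And>x. x \<in> N \<Longrightarrow> cball x (r x) \<subseteq> U" by metis
    obtain C where C: "countable C" "C \<subseteq> N"
      "pairwise (\<lambda>i j. disjnt (cball i (r i)) (cball j (r j))) C"
      "N \<subseteq> (\<Union>i\<in>C. cball i (5 * r i))"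
    proof (rule Vitali_covering_lemma_cballs[of N "\<lambda>x. x" r N "\<delta>/10"])
      show "N \<subseteq> (\<Union>i\<in>N. cball i (r i))" using r(1) by (force simp: less_imp_le)
      show "0 < r i \<and> r i \<le> \<delta> / 10" if "i \<in> N" for i using r(1,2)[OF that] by simp
    qed (rule that)
    have "hausdorff_pre (DIM('a)) \<delta> N \<le> (\<integral>\<^sup>+i. hausdorff_size (DIM('a)) (cball i (5 * r i)) \<partial>count_space C)"
    proof (rule hausdorff_pre_le_countable[OF C(1) \<delta> _ _ C(4)])
      fix i assume "i \<in> C"
      then have "0 < r i" "10 * r i \<le> \<delta>" using r C(2) by auto
      then show "diameter (cball i (5 * r i)) \<le> \<delta>" by (simp add: diameter_cball)
    qed auto
    also have "\<dots> = (\<integral>\<^sup>+i. ennreal (5 ^ DIM('a)) * emeasure lborel (cball i (r i)) \<partial>count_space C)"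
    proof (rule nn_integral_cong)
      fix i assume "i \<in> space (count_space C)"
      then have "0 < r i" using r C(2) by auto
      then show "hausdorff_size (DIM('a)) (cball i (5 * r i)) = ennreal (5 ^ DIM('a)) * emeasure lborel (cball i (r i))"
        by (simp add: hausdorff_size_cball emeasure_cball power_mult_distrib mult_ac
            ennreal_mult'[symmetric] del: ennreal_power)
    qed
    also have "\<dots> = ennreal (5 ^ DIM('a)) * (\<integral>\<^sup>+i. emeasure lborel (cball i (r i)) \<partial>count_space C)"
      by (rule nn_integral_cmult) simp
    also have "(\<integral>\<^sup>+i. emeasure lborel (cball i (r i)) \<partial>count_space C)
        = emeasure lborel (\<Union>i\<in>C. cball i (r i))"
      using C(1,3) by (intro emeasure_UN_countable[symmetric])
        (auto simp: disjoint_family_on_def pairwise_def disjnt_def)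
    also have "\<dots> \<le> emeasure lborel U"
      using r(3) C(2) U(1) by (intro emeasure_mono) auto
    also note Ue
    finally have "hausdorff_pre (DIM('a)) \<delta> N \<le> ennreal (5 ^ DIM('a)) * ennreal ?e"
      by (simp add: mult_left_mono)
    also have "\<dots> = ennreal e" using e by (simp add: ennreal_mult'[symmetric] del: ennreal_power)
    finally show ?thesis by simp
  qed
  then have "hausdorff_pre (DIM('a)) \<delta> N \<le> 0" by (rule ennreal_le_epsilon)
  then show ?thesis by simp
qed

text \<open>Vitali's theorem fills \<open>U\<close> up to a null set with disjoint balls of diameter
  at most \<delta>. For balls the size in the Hausdorff premeasure is exactly the volume, so no
  constant is lost.\<close>

lemma hausdorff_pre_open_le:
  fixes U :: "'a::euclidean_space set"
  assumes U: "open U" and \<delta>: "0 < \<delta>"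
  shows "hausdorff_pre (DIM('a)) \<delta> U \<le> emeasure lborel U"
proof -
  let ?K = "{(x, r). 0 < r \<and> 2 * r \<le> \<delta> \<and> cball x r \<subseteq> U}"
  obtain C where C: "countable C" "C \<subseteq> ?K"
    "pairwise (\<lambda>i j. disjnt (cball (fst i) (snd i)) (cball (fst j) (snd j))) C"
    "negligible (U - (\<Union>i\<in>C. cball (fst i) (snd i)))"
  proof (rule Vitali_covering_theorem_cballs[of ?K snd U fst])
    fix x d assume x: "x \<in> U" and d: "0 < (d::real)"
    obtain r where r: "0 < r" "cball x r \<subseteq> U"
      using U x unfolding open_contains_cball by blast
    define s where "s = min r (min (\<delta> / 2) (d / 2))"
    have s: "0 < s" "s \<le> r" "2 * s \<le> \<delta>" "s < d" using r d \<delta> by (auto simp: s_def)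
    have "cball x s \<subseteq> U" using order_trans[OF subset_cball[OF s(2)] r(2)] .
    then show "\<exists>i. i \<in> ?K \<and> x \<in> cball (fst i) (snd i) \<and> snd i < d"
      using s by (intro exI[of _ "(x, s)"]) auto
  next
    show "0 < snd i" if "i \<in> ?K" for i using that by auto
  qed (rule that)
  let ?V = "\<Union>i\<in>C. cball (fst i) (snd i)"
  have "hausdorff_pre (DIM('a)) \<delta> U \<le> hausdorff_pre (DIM('a)) \<delta> (?V \<union> (U - ?V))"
    by (rule hausdorff_pre_mono) auto
  also have "\<dots> \<le> hausdorff_pre (DIM('a)) \<delta> ?V + hausdorff_pre (DIM('a)) \<delta> (U - ?V)"
    by (rule hausdorff_pre_subadditive[OF \<delta>])
  also have "hausdorff_pre (DIM('a)) \<delta> (U - ?V) = 0"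
    by (rule hausdorff_pre_negligible[OF C(4) \<delta>])
  also have "hausdorff_pre (DIM('a)) \<delta> ?V
      \<le> (\<integral>\<^sup>+i. hausdorff_size (DIM('a)) (cball (fst i) (snd i)) \<partial>count_space C)"
    using C(2) by (intro hausdorff_pre_le_countable[OF C(1) \<delta>]) (auto simp: diameter_cball)
  also have "\<dots> = (\<integral>\<^sup>+i. emeasure lborel (cball (fst i) (snd i)) \<partial>count_space C)"
    using C(2) by (intro nn_integral_cong hausdorff_size_cball) auto
  also have "\<dots> = emeasure lborel ?V"
    using C(1,3) by (intro emeasure_UN_countable[symmetric])
      (auto simp: disjoint_family_on_def pairwise_def disjnt_def)
  also have "\<dots> \<le> emeasure lborel U"
    using C(2) U by (intro emeasure_mono) (force, simp)
  finally show ?thesis by simp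
qed

theorem hausdorff_outer_eq_lborel:
  fixes E :: "'a::euclidean_space set"
  assumes E: "E \<in> sets borel"
  shows "hausdorff_outer (DIM('a)) E = emeasure lborel E"
proof (rule antisym)
  show "hausdorff_outer (DIM('a)) E \<le> emeasure lborel E"
  proof (rule ennreal_le_epsilon)
    fix e :: real assume e: "0 < e"
    obtain U where U: "open U" "E \<subseteq> U" "emeasure lborel (U - E) \<le> ennreal e"
      using outer_regular_lborel_le[OF E e] by auto
    have "hausdorff_outer (DIM('a)) E \<le> hausdorff_outer (DIM('a)) U"
      by (rule hausdorff_outer_mono) fact
    also have "\<dots> \<le> emeasure lborel U"
      unfolding hausdorff_outer_def by (rule SUP_least) (auto intro: hausdorff_pre_open_le U)
    also have "\<dots> = emeasure lborel (E \<union> (U - E))" using U(2) by (intro arg_cong[of _ _ "emeasure _"]) auto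
    also have "\<dots> \<le> emeasure lborel E + emeasure lborel (U - E)"
      using U E by (intro emeasure_subadditive) auto
    also have "\<dots> \<le> emeasure lborel E + ennreal e" using U(3) by (rule add_left_mono)
    finally show "hausdorff_outer (DIM('a)) E \<le> emeasure lborel E + ennreal e" .
  qed
  show "emeasure lborel E \<le> hausdorff_outer (DIM('a)) E"
    using lborel_le_hausdorff_pre[OF E zero_less_one] hausdorff_pre_le_outer[OF zero_less_one]
    by (rule order_trans)
qed

lemma diameter_isometry:
  fixes f :: "'a::metric_space \<Rightarrow> 'b::metric_space"
  assumes "\<And>x y. dist (f x) (f y) = dist x y"
  shows "diameter (f ` C) = diameter C"
proof -
  have "(\<lambda>(x, y). dist x y) ` (f ` C \<times> f ` C) = (\<lambda>(x, y). dist x y) ` (C \<times> C)"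
    using assms by (force simp: image_iff)
  then show ?thesis by (simp add: diameter_def)
qed

lemma hausdorff_size_isometry:
  fixes f :: "'a::metric_space \<Rightarrow> 'b::metric_space"
  assumes "\<And>x y. dist (f x) (f y) = dist x y"
  shows "hausdorff_size k (f ` C) = hausdorff_size k C"
  by (simp add: hausdorff_size_def diameter_isometry[OF assms])

lemma bounded_isometry:
  fixes f :: "'a::metric_space \<Rightarrow> 'b::metric_space"
  assumes "\<And>x y. dist (f x) (f y) = dist x y"
  shows "bounded (f ` C) = bounded C"
  unfolding bounded_two_points by (auto simp: assms)

text \<open>The isometry need not be onto. Covers of the image are pulled back by preimages, and
  passing to the part of a covering set inside the range can only decrease its size.\<close>

lemma hausdorff_outer_isometry:
  fixes f :: "'a::metric_space \<Rightarrow> 'b::metric_space"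
  assumes iso: "\<And>x y. dist (f x) (f y) = dist x y"
  shows "hausdorff_outer k (f ` A) = hausdorff_outer k A"
proof -
  have inj: "inj f" using iso by (metis dist_eq_0_iff injI)
  have "hausdorff_pre k \<delta> (f ` A) = hausdorff_pre k \<delta> A" for \<delta>
  proof (rule antisym)
    show "hausdorff_pre k \<delta> (f ` A) \<le> hausdorff_pre k \<delta> A"
      unfolding hausdorff_pre_def[of k \<delta> A]
    proof (rule INF_greatest)
      fix C :: "nat \<Rightarrow> 'a set"
      assume "C \<in> {C. (\<forall>i. bounded (C i) \<and> diameter (C i) \<le> \<delta>) \<and> A \<subseteq> (\<Union>i. C i)}"
      then have C: "\<And>i. bounded (C i)" "\<And>i. diameter (C i) \<le> \<delta>" "A \<subseteq> (\<Union>i. C i)" by auto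
      have "f ` A \<subseteq> (\<Union>i. f ` C i)" using C(3) by blast
      then have "hausdorff_pre k \<delta> (f ` A) \<le> (\<Sum>i. hausdorff_size k (f ` C i))"
        using C by (intro hausdorff_preI) (auto simp: bounded_isometry[OF iso] diameter_isometry[OF iso])
      then show "hausdorff_pre k \<delta> (f ` A) \<le> (\<Sum>i. hausdorff_size k (C i))"
        by (simp add: hausdorff_size_isometry[OF iso])
    qed
    show "hausdorff_pre k \<delta> A \<le> hausdorff_pre k \<delta> (f ` A)"
      unfolding hausdorff_pre_def[of k \<delta> "f ` A"]
    proof (rule INF_greatest)
      fix C :: "nat \<Rightarrow> 'b set"
      assume "C \<in> {C. (\<forall>i. bounded (C i) \<and> diameter (C i) \<le> \<delta>) \<and> f ` A \<subseteq> (\<Union>i. C i)}"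
      then have C: "\<And>i. bounded (C i)" "\<And>i. diameter (C i) \<le> \<delta>" "f ` A \<subseteq> (\<Union>i. C i)" by auto
      have sub: "f ` (f -` C i) \<subseteq> C i" for i by auto
      have b: "bounded (f -` C i)" for i
        using bounded_subset[OF C(1) sub] by (simp only: bounded_isometry[OF iso])
      have d: "diameter (f -` C i) \<le> \<delta>" for i
        using order_trans[OF diameter_subset[OF sub C(1)] C(2)] by (simp only: diameter_isometry[OF iso])
      have "hausdorff_pre k \<delta> A \<le> (\<Sum>i. hausdorff_size k (f -` C i))"
        using C(3) by (intro hausdorff_preI b d) blast
      also have "\<dots> = (\<Sum>i. hausdorff_size k (f ` (f -` C i)))"
        by (simp only: hausdorff_size_isometry[OF iso])
      also have "\<dots> \<le> (\<Sum>i. hausdorff_size k (C i))"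
        by (intro suminf_le hausdorff_size_mono sub C) auto
      finally show "hausdorff_pre k \<delta> A \<le> (\<Sum>i. hausdorff_size k (C i))" .
    qed
  qed
  then show ?thesis by (simp add: hausdorff_outer_def)
qed

text \<open>Since Lebesgue measure is a Hausdorff measure, it is preserved by isometries between different
  Euclidean spaces of the same dimension.\<close>

lemma lborel_distr_isometry:
  fixes f :: "'a::euclidean_space \<Rightarrow> 'b::euclidean_space"
  assumes iso: "\<And>x y. dist (f x) (f y) = dist x y" and "surj f" and dim: "DIM('a) = DIM('b)"
  shows "distr lborel borel f = lborel"
proof (rule measure_eqI)
  have cont: "continuous_on UNIV f"
    unfolding continuous_on_iff by (auto simp: iso)
  then have [measurable]: "f \<in> borel_measurable borel" by (rule borel_measurable_continuous_onI)
  fix E assume "E \<in> sets (distr lborel borel f)"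
  then have E[measurable]: "E \<in> sets borel" by simp
  have "emeasure (distr lborel borel f) E = emeasure lborel (f -` E)"
    by (subst emeasure_distr) auto
  also have "\<dots> = hausdorff_outer (DIM('a)) (f -` E)"
    using measurable_sets[of f borel borel E] by (intro hausdorff_outer_eq_lborel[symmetric]) simp
  also have "\<dots> = hausdorff_outer (DIM('a)) (f ` (f -` E))"
    by (rule hausdorff_outer_isometry[OF iso, symmetric])
  also have "f ` (f -` E) = E" using \<open>surj f\<close> by auto
  also have "hausdorff_outer (DIM('a)) E = emeasure lborel E"
    unfolding dim by (rule hausdorff_outer_eq_lborel[OF E])
  finally show "emeasure (distr lborel borel f) E = emeasure lborel E" .
qed simp

section \<open>Slicing by hyperplanes\<close>

text \<open>An index type with one element less, so that \<open>real^'n del\<close> models a hyperplane in \<open>real^'n\<close>.\<close>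

typedef 'n del = "{x::'n. x \<noteq> undefined \<or> (\<forall>y. y = x)}"
  by blast

lemma finite_UNIV_del: "finite (UNIV :: 'n::finite del set)"
  by (metis finite_imageD finite_subset Rep_del_inject finite_class.finite_UNIV inj_on_def subset_UNIV)

instance del :: (finite) finite
  by standard (rule finite_UNIV_del)

text \<open>For a one-element type the new type keeps that element, because types are nonempty.
  Dimension one therefore has to be treated separately.\<close>

lemma CARD_del:
  assumes "CARD('n::finite) \<noteq> 1"
  shows "CARD('n del) = CARD('n) - 1"
proof -
  have "\<not> (\<forall>y. y = x)" for x :: 'n
  proof
    assume "\<forall>y. y = x"
    then have "UNIV = {x}" by auto
    then have "CARD('n) = card {x}" by (simp only:)
    then show False using assms by simp
  qed
  then have "{x::'n. x \<noteq> undefined \<or> (\<forall>y. y = x)} = UNIV - {undefined}" by auto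
  moreover have "CARD('n del) = card {x::'n. x \<noteq> undefined \<or> (\<forall>y. y = x)}"
    using type_definition.card[OF type_definition_del] .
  ultimately show ?thesis by (simp add: card_Diff_singleton)
qed

text \<open>In dimension one hyperplanes are points, and the surface measure is counting
  measure.\<close>

lemma hausdorff_outer_0_singleton: "hausdorff_outer 0 {x} = 1"
proof -
  have pre: "hausdorff_pre 0 \<delta> {x} = 1" if \<delta>: "0 < \<delta>" for \<delta>
  proof (rule antisym)
    let ?C = "\<lambda>n::nat. if n = 0 then {x} else {}"
    have "hausdorff_pre 0 \<delta> {x} \<le> (\<Sum>n. hausdorff_size 0 (?C n))"
      using \<delta> by (intro hausdorff_preI) auto
    also have "\<dots> = (\<Sum>n\<in>{0}. hausdorff_size 0 (?C n))"
      by (rule suminf_finite) auto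
    also have "\<dots> = 1" by (simp add: hausdorff_size_def)
    finally show "hausdorff_pre 0 \<delta> {x} \<le> 1" .
    show "1 \<le> hausdorff_pre 0 \<delta> {x}"
      unfolding hausdorff_pre_def
    proof (rule INF_greatest)
      fix C :: "nat \<Rightarrow> 'a set"
      assume "C \<in> {C. (\<forall>i. bounded (C i) \<and> diameter (C i) \<le> \<delta>) \<and> {x} \<subseteq> (\<Union>i. C i)}"
      then obtain i where "x \<in> C i" by auto
      then have "1 = hausdorff_size 0 (C i)" by (auto simp: hausdorff_size_def)
      also have "\<dots> = (\<Sum>n\<in>{i}. hausdorff_size 0 (C n))" by simp
      also have "\<dots> \<le> (\<Sum>n. hausdorff_size 0 (C n))" by (rule sum_le_suminf) auto
      finally show "1 \<le> (\<Sum>n. hausdorff_size 0 (C n))" .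
    qed
  qed
  have "hausdorff_outer 0 {x} = (SUP \<delta>\<in>{0::real<..}. (1::ennreal))"
    unfolding hausdorff_outer_def by (rule SUP_cong) (auto simp: pre)
  then show ?thesis by simp
qed

text \<open>\<kappa> is the area on the hyperplane through 0 orthogonal to \<nu>. It is described by
  what is used of it: local finiteness, concentration on the hyperplane, Fubini in the direction
  \<nu>, and agreement with Hausdorff measure on all parallel hyperplanes. The predicate hides the
  difference between dimension one and higher dimensions.\<close>

definition hyperplane_measure :: "real^'n \<Rightarrow> (real^'n) measure \<Rightarrow> bool" where
  "hyperplane_measure \<nu> \<kappa> \<longleftrightarrow>
     sets \<kappa> = sets borel \<and> (\<forall>r. emeasure \<kappa> (ball 0 r) < top) \<and> emeasure \<kappa> {x. x \<bullet> \<nu> \<noteq> 0} = 0 \<and>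
     distr (lborel \<Otimes>\<^sub>M \<kappa>) borel (\<lambda>(r, y). r *\<^sub>R \<nu> + y) = lborel \<and>
     (\<forall>s. \<forall>E\<in>sets borel.
        hausdorff_outer (CARD('n) - 1) (E \<inter> {x. x \<bullet> \<nu> = s}) = emeasure \<kappa> {y. s *\<^sub>R \<nu> + y \<in> E})"

lemma sigma_finite_measure_ball:
  fixes \<kappa> :: "'a::real_normed_vector measure"
  assumes "sets \<kappa> = sets borel" "\<And>r. emeasure \<kappa> (ball 0 r) < top"
  shows "sigma_finite_measure \<kappa>"
proof
  have "space \<kappa> = UNIV" using sets_eq_imp_space_eq[OF assms(1)] by simp
  moreover have "\<exists>n. x \<in> ball 0 (real n)" for x :: 'a
    using reals_Archimedean2[of "norm x"] by auto
  ultimately show "\<exists>A. countable A \<and> A \<subseteq> sets \<kappa> \<and> \<Union> A = space \<kappa> \<and> (\<forall>a\<in>A. emeasure \<kappa> a \<noteq> \<infinity>)"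
    using assms by (intro exI[of _ "range (\<lambda>n. ball 0 (real n))"]) (auto simp: less_top)
qed

text \<open>A linear isometry \<open>J\<close> from the space of one dimension less onto the
  hyperplane transports Lebesgue measure. Then
  \<open>(r, z) \<mapsto> r *\<^sub>R \<nu> + J z\<close> is an isometry onto the whole space, which
  gives the product formula, and for fixed \<open>r\<close> an isometry onto a slice, which gives
  the Hausdorff formula.\<close>

lemma hyperplane_measure_exists_dim_neq_1:
  fixes \<nu> :: "real^'n"
  assumes \<nu>: "norm \<nu> = 1" and N: "CARD('n) \<noteq> 1"
  shows "\<exists>\<kappa>. hyperplane_measure \<nu> \<kappa>"
proof -
  let ?P = "{x. \<nu> \<bullet> x = 0}"
  have "\<nu> \<noteq> 0" using \<nu> by auto
  have dimeq: "DIM(real^'n del) = CARD('n) - 1" by (simp add: CARD_del[OF N])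
  have "dim (UNIV :: (real^'n del) set) = dim ?P"
    using dimeq dim_hyperplane[OF \<open>\<nu> \<noteq> 0\<close>] by simp
  from isometries_subspaces[OF subspace_UNIV subspace_hyperplane this]
  obtain J :: "real^'n del \<Rightarrow> real^'n" where J: "linear J" "range J = ?P" "\<And>x. norm (J x) = norm x"
    by (metis UNIV_I)
  have [measurable]: "J \<in> borel_measurable borel"
    using J(1) by (intro borel_measurable_continuous_onI linear_continuous_on linear_linear[THEN iffD2])
  have J0: "J z \<bullet> \<nu> = 0" for z using J(2) by (auto simp: inner_commute)
  define \<kappa> where "\<kappa> = distr lborel borel J"
  have [measurable_cong, simp]: "sets \<kappa> = sets borel" by (simp add: \<kappa>_def)
  have fin: "emeasure \<kappa> (ball 0 r) < top" for r
  proof -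
    have "emeasure \<kappa> (ball 0 r) = emeasure lborel (J -` ball 0 r)"
      unfolding \<kappa>_def by (subst emeasure_distr) auto
    also have "J -` ball 0 r = ball 0 r" using J(3) by auto
    finally show ?thesis using emeasure_bounded_finite[OF bounded_ball, of "0::real^'n del" r] by simp
  qed
  have null: "emeasure \<kappa> {x. x \<bullet> \<nu> \<noteq> 0} = 0"
    unfolding \<kappa>_def by (subst emeasure_distr) (auto simp: J0)
  let ?L = "\<lambda>(r, z). r *\<^sub>R \<nu> + J z"
  have linL: "?L p - ?L q = ?L (p - q)" for p q
    using linear_diff[OF J(1)] by (auto simp: algebra_simps split: prod.splits)
  have normL: "norm (?L p) = norm p" for p
  proof -
    obtain r z where p: "p = (r, z)" by (cases p)
    have "(r *\<^sub>R \<nu> + J z) \<bullet> (r *\<^sub>R \<nu> + J z) = r * r * (\<nu> \<bullet> \<nu>) + J z \<bullet> J z"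
      using J0[of z] inner_commute[of \<nu> "J z"] by (simp add: inner_add_left inner_add_right)
    also have "\<dots> = r\<^sup>2 + (norm z)\<^sup>2"
      using J(3)[of z] \<nu> by (simp add: power2_eq_square flip: power2_norm_eq_inner)
    finally have "(norm (r *\<^sub>R \<nu> + J z))\<^sup>2 = (norm p)\<^sup>2"
      by (simp add: power2_norm_eq_inner p norm_Pair)
    then show ?thesis by (simp add: p)
  qed
  have "surj ?L"
  proof (rule surjI)
    fix x
    have "x - (x \<bullet> \<nu>) *\<^sub>R \<nu> \<in> ?P"
      using \<nu> by (simp add: inner_diff_right inner_commute flip: power2_norm_eq_inner)
    then have "x - (x \<bullet> \<nu>) *\<^sub>R \<nu> \<in> range J" using J(2) by simp
    then have "J (inv J (x - (x \<bullet> \<nu>) *\<^sub>R \<nu>)) = x - (x \<bullet> \<nu>) *\<^sub>R \<nu>" by (rule f_inv_into_f)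
    then show "?L (x \<bullet> \<nu>, inv J (x - (x \<bullet> \<nu>) *\<^sub>R \<nu>)) = x" by simp
  qed
  moreover have "CARD('n) \<ge> 1" by (simp add: Suc_leI)
  then have "DIM(real \<times> (real^'n del)) = DIM(real^'n)" using dimeq by simp
  ultimately have L: "distr lborel borel ?L = lborel"
    by (intro lborel_distr_isometry) (simp_all only: dist_norm linL normL)
  have "lborel \<Otimes>\<^sub>M \<kappa> = distr lborel borel (\<lambda>x::real. x) \<Otimes>\<^sub>M distr lborel borel J"
    unfolding \<kappa>_def by (simp add: distr_id2)
  also have "\<dots> = distr (lborel \<Otimes>\<^sub>M lborel) (borel \<Otimes>\<^sub>M borel) (\<lambda>(x, y). (x, J y))"
    by (rule pair_measure_distr) (auto intro!: sigma_finite_measure_ball fin[unfolded \<kappa>_def])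
  finally have "distr (lborel \<Otimes>\<^sub>M \<kappa>) borel (\<lambda>(r, y). r *\<^sub>R \<nu> + y) = distr (lborel \<Otimes>\<^sub>M lborel) borel ?L"
    by (simp add: distr_distr comp_def case_prod_unfold)
  also have "\<dots> = lborel" using L by (simp add: lborel_prod)
  finally have slice: "distr (lborel \<Otimes>\<^sub>M \<kappa>) borel (\<lambda>(r, y). r *\<^sub>R \<nu> + y) = lborel" .
  have haus: "hausdorff_outer (CARD('n) - 1) (E \<inter> {x. x \<bullet> \<nu> = s}) = emeasure \<kappa> {y. s *\<^sub>R \<nu> + y \<in> E}"
    if [measurable]: "E \<in> sets borel" for E s
  proof -
    let ?f = "\<lambda>z. s *\<^sub>R \<nu> + J z"
    have iso: "dist (?f x) (?f y) = dist x y" for x y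
      using normL[of "(0, x - y)"] linear_diff[OF J(1)] by (simp add: dist_norm norm_Pair)
    have "E \<inter> {x. x \<bullet> \<nu> = s} = ?f ` {z. ?f z \<in> E}"
    proof (intro set_eqI iffI)
      fix x assume x: "x \<in> E \<inter> {x. x \<bullet> \<nu> = s}"
      then have "x - s *\<^sub>R \<nu> \<in> ?P"
        using \<nu> by (simp add: inner_diff_right inner_commute flip: power2_norm_eq_inner)
      then obtain z where "x - s *\<^sub>R \<nu> = J z" using J(2) by blast
      then have "x = ?f z" by (simp add: algebra_simps)
      then show "x \<in> ?f ` {z. ?f z \<in> E}" using x by auto
    qed (use \<nu> in \<open>auto simp: J0 inner_add_left simp flip: power2_norm_eq_inner\<close>)
    then have "hausdorff_outer (CARD('n) - 1) (E \<inter> {x. x \<bullet> \<nu> = s}) = hausdorff_outer (CARD('n) - 1) {z. ?f z \<in> E}"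
      using hausdorff_outer_isometry[of ?f, OF iso] by simp
    also have "\<dots> = emeasure lborel {z. ?f z \<in> E}"
      unfolding dimeq[symmetric] by (rule hausdorff_outer_eq_lborel) measurable
    also have "\<dots> = emeasure \<kappa> {y. s *\<^sub>R \<nu> + y \<in> E}"
      unfolding \<kappa>_def by (subst emeasure_distr) (auto simp: vimage_def)
    finally show ?thesis .
  qed
  show ?thesis
    unfolding hyperplane_measure_def using fin null slice haus by (intro exI[of _ \<kappa>]) auto
qed

lemma hyperplane_measure_exists_dim_eq_1:
  fixes \<nu> :: "real^'n"
  assumes \<nu>: "norm \<nu> = 1" and N: "CARD('n) = 1"
  shows "\<exists>\<kappa>. hyperplane_measure \<nu> \<kappa>"
proof -
  have "\<nu> \<noteq> 0" using \<nu> by auto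
  have "\<nu> \<bullet> \<nu> = 1" using \<nu> by (simp flip: power2_norm_eq_inner)
  have x: "x = (x \<bullet> \<nu>) *\<^sub>R \<nu>" for x
  proof -
    have "dim {x. \<nu> \<bullet> x = 0} = 0" using dim_hyperplane[OF \<open>\<nu> \<noteq> 0\<close>] N by simp
    then have "{x. \<nu> \<bullet> x = 0} \<subseteq> {0}" by (simp only: dim_eq_0)
    moreover have "x - (x \<bullet> \<nu>) *\<^sub>R \<nu> \<in> {x. \<nu> \<bullet> x = 0}"
      using \<open>\<nu> \<bullet> \<nu> = 1\<close> by (simp add: inner_diff_right inner_commute)
    ultimately have "x - (x \<bullet> \<nu>) *\<^sub>R \<nu> = 0" by blast
    then show ?thesis by simp
  qed
  \<comment> \<open>The hyperplane is the origin alone, and its area is the Dirac mass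
    there.\<close>
  define \<kappa> :: "(real^'n) measure" where "\<kappa> = distr (count_space (UNIV :: unit set)) borel (\<lambda>_. 0)"
  have [measurable_cong, simp]: "sets \<kappa> = sets borel" by (simp add: \<kappa>_def)
  have em: "emeasure \<kappa> A = indicator A 0" if "A \<in> sets borel" for A
    using that unfolding \<kappa>_def by (subst emeasure_distr) (auto simp: indicator_def vimage_def)
  have fin: "emeasure \<kappa> (ball 0 r) < top" for r
    by (simp add: em indicator_def)
  have null: "emeasure \<kappa> {x. x \<bullet> \<nu> \<noteq> 0} = 0"
    by (subst em) auto
  interpret sigma_finite_measure \<kappa> by (rule sigma_finite_measure_ball) (simp_all add: fin)
  have iso: "distr lborel borel (\<lambda>r. r *\<^sub>R \<nu>) = lborel"
  proof (rule lborel_distr_isometry)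
    show "dist (a *\<^sub>R \<nu>) (b *\<^sub>R \<nu>) = dist a b" for a b
      using \<nu> by (simp add: dist_norm flip: scaleR_left_diff_distrib)
    show "surj (\<lambda>r. r *\<^sub>R \<nu>)" using x by (metis surjI)
  qed (simp add: N)
  have slice: "distr (lborel \<Otimes>\<^sub>M \<kappa>) borel (\<lambda>(r, y). r *\<^sub>R \<nu> + y) = lborel"
  proof (rule measure_eqI)
    fix E assume "E \<in> sets (distr (lborel \<Otimes>\<^sub>M \<kappa>) borel (\<lambda>(r, y). r *\<^sub>R \<nu> + y))"
    then have [measurable]: "E \<in> sets borel" by simp
    let ?X = "(\<lambda>(r, y). r *\<^sub>R \<nu> + y) -` E \<inter> space (lborel \<Otimes>\<^sub>M \<kappa>)"
    have "emeasure (distr (lborel \<Otimes>\<^sub>M \<kappa>) borel (\<lambda>(r, y). r *\<^sub>R \<nu> + y)) E = emeasure (lborel \<Otimes>\<^sub>M \<kappa>) ?X"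
      by (subst emeasure_distr) auto
    also have "\<dots> = (\<integral>\<^sup>+r. emeasure \<kappa> (Pair r -` ?X) \<partial>lborel)"
      by (rule emeasure_pair_measure_alt) measurable
    also have "\<dots> = (\<integral>\<^sup>+r. indicator {r. r *\<^sub>R \<nu> \<in> E} r \<partial>lborel)"
      by (intro nn_integral_cong, subst em)
         (auto simp: indicator_def space_pair_measure sets_eq_imp_space_eq[of \<kappa> borel] vimage_def)
    also have "\<dots> = emeasure (distr lborel borel (\<lambda>r. r *\<^sub>R \<nu>)) E"
      by (subst emeasure_distr) (auto simp: vimage_def)
    finally show "emeasure (distr (lborel \<Otimes>\<^sub>M \<kappa>) borel (\<lambda>(r, y). r *\<^sub>R \<nu> + y)) E = emeasure lborel E"
      by (simp add: iso)
  qed simp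
  have haus: "hausdorff_outer (CARD('n) - 1) (E \<inter> {x. x \<bullet> \<nu> = s}) = emeasure \<kappa> {y. s *\<^sub>R \<nu> + y \<in> E}"
    if [measurable]: "E \<in> sets borel" for E s
  proof -
    have "y = s *\<^sub>R \<nu>" if "y \<bullet> \<nu> = s" for y using x[of y] that by simp
    then have "{x. x \<bullet> \<nu> = s} = {s *\<^sub>R \<nu>}" using \<open>\<nu> \<bullet> \<nu> = 1\<close> by auto
    then show ?thesis
      by (subst em) (auto simp: N hausdorff_outer_0_singleton indicator_def)
  qed
  show ?thesis
    unfolding hyperplane_measure_def using fin null slice haus by (intro exI[of _ \<kappa>]) auto
qed

theorem hyperplane_measure_exists:
  fixes \<nu> :: "real^'n"
  assumes "norm \<nu> = 1"
  obtains \<kappa> where "hyperplane_measure \<nu> \<kappa>"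
  using assms hyperplane_measure_exists_dim_neq_1 hyperplane_measure_exists_dim_eq_1 by blast

section \<open>The sawtooth in one dimension\<close>

definition saw :: "nat \<Rightarrow> real \<Rightarrow> real" where
  "saw k r = frac (real k * r) / real k"

lemma saw_nonneg: "0 \<le> saw k r"
  by (simp add: saw_def frac_ge_0)

lemma saw_le: "saw k r \<le> 1 / real k"
  by (simp add: saw_def divide_right_mono frac_lt_1 less_imp_le)

lemma borel_measurable_saw [measurable]: "saw k \<in> borel_measurable borel"
  unfolding saw_def frac_def by measurable

lemma integrable_continuous_bounded_support:
  fixes f :: "'a::euclidean_space \<Rightarrow> 'b::{banach, second_countable_topology}"
  assumes "continuous_on UNIV f" "\<And>x. R < norm x \<Longrightarrow> f x = 0"
  shows "integrable lborel f"
proof -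
  have "f = (\<lambda>x. indicator (cball 0 R) x *\<^sub>R f x)"
    using assms(2) by (auto simp: indicator_def not_le)
  then show ?thesis
    using borel_integrable_compact[of "cball 0 R" f] assms(1) by (metis compact_cball continuous_on_subset subset_UNIV)
qed

text \<open>Up to the constant \<open>K\<close> the floor function becomes a finite sum of Heaviside
  functions, each of which integrates trivially against a derivative.\<close>

lemma card_integers_le:
  assumes "\<bar>x\<bar> < real_of_int K"
  shows "(\<Sum>i\<in>{-K+1..K}. if real_of_int i \<le> x then 1 else 0 :: real) = of_int \<lfloor>x\<rfloor> + of_int K"
proof -
  have fl: "- K \<le> \<lfloor>x\<rfloor>" "\<lfloor>x\<rfloor> < K" using assms by linarith+
  have "(\<Sum>i\<in>{-K+1..K}. if real_of_int i \<le> x then 1 else 0 :: real) = (\<Sum>i\<in>{-K+1..\<lfloor>x\<rfloor>}. 1)"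
    using fl by (intro sum.mono_neutral_cong_right) (auto simp: le_floor_iff)
  then show ?thesis using fl by simp
qed

text \<open>The sawtooth is the identity minus a step function. Integration by parts turns the
  identity into the integral of \<open>g\<close> and every step of height \<open>1/k\<close> into a
  point value of \<open>g\<close>. The bound on \<open>K\<close> ensures that all steps inside the
  support are counted.\<close>

lemma saw_integral:
  fixes g g' :: "real \<Rightarrow> real"
  assumes g: "\<And>r. (g has_real_derivative g' r) (at r)" and g': "continuous_on UNIV g'"
    and supp: "\<And>r. R < \<bar>r\<bar> \<Longrightarrow> g r = 0" "\<And>r. R < \<bar>r\<bar> \<Longrightarrow> g' r = 0"
    and k: "0 < k" and K: "real k * R < real_of_int K"
  shows "(\<integral>r. g' r \<partial>lborel) = 0"
    "(\<integral>r. saw k r * g' r \<partial>lborel) = - (\<integral>r. g r \<partial>lborel) + (\<Sum>i\<in>{-K..K}. g (of_int i / real k)) / real k"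
proof -
  have cg: "continuous_on UNIV g"
    using g by (intro continuous_at_imp_continuous_on) (auto intro: DERIV_isCont)
  have ints: "integrable lborel g" "integrable lborel g'" "integrable lborel (\<lambda>r. r * g' r)"
    using supp by (auto intro!: integrable_continuous_bounded_support[where R = R] continuous_intros cg g')
  have [measurable]: "g' \<in> borel_measurable borel" using g' by (rule borel_measurable_continuous_onI)
  have FTC: "(\<integral>r. indicator {a..b} r *\<^sub>R G' r \<partial>lborel) = G b - G a"
    if "a \<le> b" "\<And>r. (G has_real_derivative G' r) (at r)" "continuous_on UNIV G'" for a b and G G' :: "real \<Rightarrow> real"
  proof (rule integral_FTC_atLeastAtMost[OF that(1)])
    show "(G has_vector_derivative G' r) (at r within {a..b})" for r
      unfolding has_real_derivative_iff_has_vector_derivative[symmetric]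
      using that(2) by (rule has_field_derivative_at_within)
    show "continuous_on {a..b} G'" using that(3) by (rule continuous_on_subset) simp
  qed
  have half: "(\<integral>r. indicator {s..} r * g' r \<partial>lborel) = - g s" for s
  proof -
    \<comment> \<open>A right end beyond the support, where \<open>g\<close> vanishes; the maximum
      with \<open>s\<close> keeps the interval nonempty.\<close>
    define b where "b = max (\<bar>R\<bar> + 1) s"
    have "indicator {s..} r * g' r = indicator {s..b} r *\<^sub>R g' r" for r
      by (cases "R < \<bar>r\<bar>") (auto simp: supp indicator_def b_def max_def)
    then have "(\<integral>r. indicator {s..} r * g' r \<partial>lborel) = (\<integral>r. indicator {s..b} r *\<^sub>R g' r \<partial>lborel)"
      by (rule Bochner_Integration.integral_cong[OF refl])
    also have "\<dots> = g b - g s" by (intro FTC g g') (simp add: b_def)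
    also have "g b = 0" by (intro supp) (auto simp: b_def max_def)
    finally show ?thesis by simp
  qed
  define b where "b = \<bar>R\<bar> + 1"
  have b: "R < b" "- b \<le> b" by (auto simp: b_def)
  have gb: "g b = 0" "g (- b) = 0" using b by (auto intro!: supp simp: b_def)
  have "g' r = indicator {-b..b} r *\<^sub>R g' r" for r
    by (cases "R < \<bar>r\<bar>") (auto simp: supp indicator_def b_def)
  then have "(\<integral>r. g' r \<partial>lborel) = (\<integral>r. indicator {-b..b} r *\<^sub>R g' r \<partial>lborel)"
    by (rule Bochner_Integration.integral_cong[OF refl])
  also have "\<dots> = g b - g (- b)" by (intro FTC g g' b)
  finally show zero: "(\<integral>r. g' r \<partial>lborel) = 0" by (simp add: gb)
  have "r * g' r + g r = indicator {-b..b} r *\<^sub>R (r * g' r + g r)" for r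
    by (cases "R < \<bar>r\<bar>") (auto simp: supp indicator_def b_def)
  then have "(\<integral>r. r * g' r + g r \<partial>lborel) = (\<integral>r. indicator {-b..b} r *\<^sub>R (r * g' r + g r) \<partial>lborel)"
    by (rule Bochner_Integration.integral_cong[OF refl])
  also have "(\<integral>r. indicator {-b..b} r *\<^sub>R (r * g' r + g r) \<partial>lborel) = b * g b - (- b) * g (- b)"
    using b by (intro FTC[where G = "\<lambda>r. r * g r"]) (auto intro!: derivative_eq_intros g continuous_intros cg g')
  finally have "(\<integral>r. r * g' r + g r \<partial>lborel) = 0"
    by (simp add: gb)
  then have one: "(\<integral>r. r * g' r \<partial>lborel) = - (\<integral>r. g r \<partial>lborel)"
    using ints by simp
  \<comment> \<open>The floor of \<open>k * r\<close> is the sum of Heaviside functions minus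
    \<open>K\<close> only for \<open>\<bar>k * r\<bar> < K\<close>. Outside the support of
    \<open>g'\<close> both sides vanish, so the identity holds everywhere.\<close>
  have dec: "saw k r * g' r = r * g' r - (\<Sum>i\<in>{-K+1..K}. indicator {of_int i / real k..} r * g' r) / real k
      + (of_int K / real k) * g' r" for r
  proof (cases "R < \<bar>r\<bar>")
    case False
    have "\<bar>real k * r\<bar> = real k * \<bar>r\<bar>" by (simp add: abs_mult)
    also have "\<dots> \<le> real k * R" using False k by (intro mult_left_mono) auto
    finally have "\<bar>real k * r\<bar> < of_int K" using K by simp
    then have "(\<Sum>i\<in>{-K+1..K}. if of_int i \<le> real k * r then 1 else 0 :: real)
        = of_int \<lfloor>real k * r\<rfloor> + of_int K"
      by (rule card_integers_le)
    moreover have "indicat_real {of_int i / real k..} r = (if of_int i \<le> real k * r then 1 else 0)" for i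
      using k by (simp add: indicator_def pos_divide_le_eq mult.commute)
    ultimately have "(\<Sum>i\<in>{-K+1..K}. indicat_real {of_int i / real k..} r) = of_int \<lfloor>real k * r\<rfloor> + of_int K"
      by simp
    then have "(\<Sum>i\<in>{-K+1..K}. indicator {of_int i / real k..} r * g' r) = (of_int \<lfloor>real k * r\<rfloor> + of_int K) * g' r"
      by (simp add: sum_distrib_right[symmetric])
    then show ?thesis using k by (simp add: saw_def frac_def field_simps)
  qed (simp add: supp)
  define h where "h i r = indicator {of_int i / real k..} r * g' r" for i :: int and r :: real
  have h: "integrable lborel (h i)" "(\<integral>r. h i r \<partial>lborel) = - g (of_int i / real k)" for i
    using integrable_real_mult_indicator[of "{of_int i / real k..}" lborel g'] ints(2) half
    by (simp_all add: h_def[abs_def] mult.commute)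
  have "(\<integral>r. saw k r * g' r \<partial>lborel) = (\<integral>r. r * g' r - (\<Sum>i\<in>{-K+1..K}. h i r) / real k
      + (of_int K / real k) * g' r \<partial>lborel)"
    unfolding dec h_def ..
  also have "\<dots> = (\<integral>r. r * g' r \<partial>lborel)
      - (\<Sum>i\<in>{-K+1..K}. \<integral>r. h i r \<partial>lborel) / real k
      + (of_int K / real k) * (\<integral>r. g' r \<partial>lborel)"
    using ints h(1) by simp
  also have "\<dots> = - (\<integral>r. g r \<partial>lborel) + (\<Sum>i\<in>{-K+1..K}. g (of_int i / real k)) / real k"
    by (simp add: h(2) zero one sum_negf)
  \<comment> \<open>The index \<open>- K\<close> is added only to make the range symmetric:
    \<open>K / k\<close> exceeds \<open>R\<close>, so its term is zero.\<close>
  also have "(\<Sum>i\<in>{-K+1..K}. g (of_int i / real k)) = (\<Sum>i\<in>{-K..K}. g (of_int i / real k))"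
  proof (rule sum.mono_neutral_left)
    have "R < \<bar>of_int (- K) / real k\<bar>" using K k by (simp add: field_simps abs_if)
    moreover have "{-K..K} - {-K+1..K} \<subseteq> {- K}" by auto
    ultimately show "\<forall>i\<in>{-K..K} - {-K+1..K}. g (of_int i / real k) = 0"
      using supp(1) by blast
  qed auto
  finally show "(\<integral>r. saw k r * g' r \<partial>lborel) = - (\<integral>r. g r \<partial>lborel) + (\<Sum>i\<in>{-K..K}. g (of_int i / real k)) / real k" .
qed

section \<open>Fubini and surface integrals over parallel hyperplanes\<close>

lemma hyperplane_measureD:
  assumes "hyperplane_measure \<nu> \<kappa>"
  shows "sets \<kappa> = sets borel" "space \<kappa> = UNIV" "sigma_finite_measure \<kappa>" "AE y in \<kappa>. y \<bullet> \<nu> = 0"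
    "distr (lborel \<Otimes>\<^sub>M \<kappa>) borel (\<lambda>(r, y). r *\<^sub>R \<nu> + y) = lborel"
proof -
  show s: "sets \<kappa> = sets borel" using assms by (simp add: hyperplane_measure_def)
  show "space \<kappa> = UNIV" using sets_eq_imp_space_eq[OF s] by simp
  show "sigma_finite_measure \<kappa>" using assms
    by (intro sigma_finite_measure_ball) (auto simp: hyperplane_measure_def)
  have "{x. x \<bullet> \<nu> \<noteq> 0} \<in> null_sets \<kappa>"
    using assms by (intro null_setsI) (auto simp: hyperplane_measure_def)
  then show "AE y in \<kappa>. y \<bullet> \<nu> = 0" by (rule AE_I') auto
  show "distr (lborel \<Otimes>\<^sub>M \<kappa>) borel (\<lambda>(r, y). r *\<^sub>R \<nu> + y) = lborel"
    using assms by (simp add: hyperplane_measure_def)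
qed

lemma hyperplane_measure_Fubini:
  fixes f :: "real^'n \<Rightarrow> 'b::{banach, second_countable_topology}"
  assumes hm: "hyperplane_measure \<nu> \<kappa>" and int: "integrable lborel f"
  shows "(\<integral>x. f x \<partial>lborel) = (\<integral>y. (\<integral>r. f (r *\<^sub>R \<nu> + y) \<partial>lborel) \<partial>\<kappa>)"
    "AE y in \<kappa>. integrable lborel (\<lambda>r. f (r *\<^sub>R \<nu> + y))"
    "integrable \<kappa> (\<lambda>y. \<integral>r. f (r *\<^sub>R \<nu> + y) \<partial>lborel)"
proof -
  note D = hyperplane_measureD[OF hm]
  note D(1)[measurable_cong]
  interpret sigma_finite_measure \<kappa> by (rule D)
  interpret pair_sigma_finite lborel \<kappa> ..
  let ?L = "\<lambda>(r, y). r *\<^sub>R \<nu> + y"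
  have [measurable]: "f \<in> borel_measurable borel" using int by auto
  have "integrable (distr (lborel \<Otimes>\<^sub>M \<kappa>) borel ?L) f" using int D(5) by simp
  then have int': "integrable (lborel \<Otimes>\<^sub>M \<kappa>) (\<lambda>(r, y). f (r *\<^sub>R \<nu> + y))"
    by (subst (asm) integrable_distr_eq) (auto simp: case_prod_unfold)
  have "(\<integral>x. f x \<partial>lborel) = (\<integral>x. f x \<partial>distr (lborel \<Otimes>\<^sub>M \<kappa>) borel ?L)" using D(5) by simp
  also have "\<dots> = (\<integral>p. (\<lambda>(r, y). f (r *\<^sub>R \<nu> + y)) p \<partial>(lborel \<Otimes>\<^sub>M \<kappa>))"
    by (subst integral_distr) (auto simp: case_prod_unfold)
  also have "\<dots> = (\<integral>y. (\<integral>r. f (r *\<^sub>R \<nu> + y) \<partial>lborel) \<partial>\<kappa>)"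
    using integral_snd[OF int'] by simp
  finally show "(\<integral>x. f x \<partial>lborel) = (\<integral>y. (\<integral>r. f (r *\<^sub>R \<nu> + y) \<partial>lborel) \<partial>\<kappa>)" .
  show "AE y in \<kappa>. integrable lborel (\<lambda>r. f (r *\<^sub>R \<nu> + y))"
    "integrable \<kappa> (\<lambda>y. \<integral>r. f (r *\<^sub>R \<nu> + y) \<partial>lborel)"
    using AE_integrable_snd[OF int'] integrable_snd[OF int'] by simp_all
qed

text \<open>As an identity of measures rather than of values on sets, this transfers integrability
  and Bochner integrals between \<kappa> and the surface measure in one stroke.\<close>

lemma hyperplane_measure_distr:
  fixes \<nu> :: "real^'n"
  assumes hm: "hyperplane_measure \<nu> \<kappa>"
  shows "distr \<kappa> borel (\<lambda>y. s *\<^sub>R \<nu> + y) = density surface_measure (indicator {x. x \<bullet> \<nu> = s})"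
proof (rule measure_eqI)
  note D = hyperplane_measureD[OF hm]
  note D(1)[measurable_cong]
  fix E assume "E \<in> sets (distr \<kappa> borel (\<lambda>y. s *\<^sub>R \<nu> + y))"
  then have [measurable]: "E \<in> sets borel" by simp
  have P[measurable]: "{x. x \<bullet> \<nu> = s} \<in> sets borel" by measurable
  have "emeasure (density surface_measure (indicator {x. x \<bullet> \<nu> = s})) E
      = (\<integral>\<^sup>+x. indicator {x. x \<bullet> \<nu> = s} x * indicator E x \<partial>surface_measure)"
    by (subst emeasure_density) auto
  also have "\<dots> = (\<integral>\<^sup>+x. indicator (E \<inter> {x. x \<bullet> \<nu> = s}) x \<partial>surface_measure)"
    by (intro nn_integral_cong) (auto simp: indicator_def)
  also have "\<dots> = emeasure surface_measure (E \<inter> {x. x \<bullet> \<nu> = s})"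
    by (rule nn_integral_indicator) simp
  also have "\<dots> = hausdorff_outer (CARD('n) - 1) (E \<inter> {x. x \<bullet> \<nu> = s})"
    by (rule emeasure_hausdorff_measure) simp
  also have "\<dots> = emeasure \<kappa> {y. s *\<^sub>R \<nu> + y \<in> E}"
    using hm by (simp add: hyperplane_measure_def)
  also have "\<dots> = emeasure (distr \<kappa> borel (\<lambda>y. s *\<^sub>R \<nu> + y)) E"
    by (subst emeasure_distr) (auto simp: D(2) vimage_def)
  finally show "emeasure (distr \<kappa> borel (\<lambda>y. s *\<^sub>R \<nu> + y)) E
      = emeasure (density surface_measure (indicator {x. x \<bullet> \<nu> = s})) E" by simp
qed simp

lemma hyperplane_measure_surface:
  fixes \<nu> :: "real^'n" and f :: "real^'n \<Rightarrow> 'b::{banach, second_countable_topology}"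
  assumes hm: "hyperplane_measure \<nu> \<kappa>" and f[measurable]: "f \<in> borel_measurable borel"
  shows "set_integrable surface_measure {x. x \<bullet> \<nu> = s} f \<longleftrightarrow> integrable \<kappa> (\<lambda>y. f (s *\<^sub>R \<nu> + y))"
    "(LINT x:{x. x \<bullet> \<nu> = s}|surface_measure. f x) = (\<integral>y. f (s *\<^sub>R \<nu> + y) \<partial>\<kappa>)"
proof -
  note D = hyperplane_measureD[OF hm]
  note D(1)[measurable_cong]
  let ?g = "indicator {x. x \<bullet> \<nu> = s} :: real^'n \<Rightarrow> real"
  have eq: "distr \<kappa> borel (\<lambda>y. s *\<^sub>R \<nu> + y) = density surface_measure ?g"
    by (simp add: hyperplane_measure_distr[OF hm] ennreal_indicator)
  have P[measurable]: "{x. x \<bullet> \<nu> = s} \<in> sets borel" by measurable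
  show "set_integrable surface_measure {x. x \<bullet> \<nu> = s} f \<longleftrightarrow> integrable \<kappa> (\<lambda>y. f (s *\<^sub>R \<nu> + y))"
    using integrable_density[of f surface_measure ?g] integrable_distr_eq[of "\<lambda>y. s *\<^sub>R \<nu> + y" \<kappa> borel f]
    by (simp add: set_integrable_def eq)
  show "(LINT x:{x. x \<bullet> \<nu> = s}|surface_measure. f x) = (\<integral>y. f (s *\<^sub>R \<nu> + y) \<partial>\<kappa>)"
    using integral_density[of f surface_measure ?g] integral_distr[of "\<lambda>y. s *\<^sub>R \<nu> + y" \<kappa> borel f]
    by (simp add: set_lebesgue_integral_def eq)
qed

section \<open>Gauss-Green formulas\<close>

lemma C1_continuous:
  assumes "C1_with_gradient \<Psi> d"
  shows "continuous_on UNIV \<Psi>" "continuous_on UNIV d"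
    "\<Psi> \<in> borel_measurable borel" "d \<in> borel_measurable borel"
proof -
  show c: "continuous_on UNIV \<Psi>" "continuous_on UNIV d" using assms
    by (auto simp: C1_with_gradient_def gderiv_def intro!: continuous_at_imp_continuous_on has_derivative_continuous)
  show "\<Psi> \<in> borel_measurable borel" "d \<in> borel_measurable borel"
    using c by (auto intro: borel_measurable_continuous_onI)
qed

lemma C1_line_derivative:
  assumes "C1_with_gradient \<Psi> d"
  shows "((\<lambda>r. \<Psi> (r *\<^sub>R e + y)) has_real_derivative (d (r *\<^sub>R e + y) \<bullet> e)) (at r)"
proof -
  have "((\<lambda>r. r *\<^sub>R e + y) has_derivative (\<lambda>h. h *\<^sub>R e)) (at r)"
    by (auto intro!: derivative_eq_intros)
  moreover have "(\<Psi> has_derivative (\<lambda>h. h \<bullet> d (r *\<^sub>R e + y))) (at (r *\<^sub>R e + y))"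
    using assms by (simp add: C1_with_gradient_def gderiv_def)
  ultimately have "((\<lambda>r. \<Psi> (r *\<^sub>R e + y)) has_derivative (\<lambda>h. (h *\<^sub>R e) \<bullet> d (r *\<^sub>R e + y))) (at r)"
    by (rule has_derivative_compose)
  moreover have "(\<lambda>h. (h *\<^sub>R e) \<bullet> d (r *\<^sub>R e + y)) = (*) (d (r *\<^sub>R e + y) \<bullet> e)"
    by (auto simp: inner_commute)
  ultimately show ?thesis by (simp add: has_field_derivative_def)
qed

lemma C1_gradient_eq_0:
  assumes C1: "C1_with_gradient \<Psi> d" and "open U" "x \<in> U" "\<And>x. x \<in> U \<Longrightarrow> \<Psi> x = 0"
  shows "d x = 0"
proof -
  have "(\<Psi> has_derivative (\<lambda>h. h \<bullet> d x)) (at x)"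
    using C1 by (simp add: C1_with_gradient_def gderiv_def)
  moreover have "(\<Psi> has_derivative (\<lambda>h. 0)) (at x)"
    by (rule has_derivative_transform_within_open[of "\<lambda>_. 0" _ x UNIV U]) (use assms in auto)
  ultimately have "(\<lambda>h. h \<bullet> d x) = (\<lambda>h. 0)" by (rule has_derivative_unique)
  then show ?thesis by (metis inner_eq_zero_iff)
qed

lemma C1_gradient_bounded_support:
  assumes "C1_with_gradient \<Psi> d" "\<And>x. R < norm x \<Longrightarrow> \<Psi> x = 0" "R < norm x"
  shows "d x = 0"
proof (rule C1_gradient_eq_0[OF assms(1)])
  show "open {x :: real^'a. R < norm x}" by (intro open_Collect_less continuous_intros)
qed (use assms in auto)

lemma hyperplane_measure_integrable:
  fixes f :: "real^'n \<Rightarrow> 'b::{banach, second_countable_topology}"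
  assumes hm: "hyperplane_measure \<nu> \<kappa>" and [measurable]: "f \<in> borel_measurable borel"
    and bound: "\<And>x. norm (f x) \<le> B" and supp: "\<And>x. R < norm x \<Longrightarrow> f x = 0"
  shows "integrable \<kappa> (\<lambda>y. f (s *\<^sub>R \<nu> + y))"
proof -
  note D = hyperplane_measureD[OF hm]
  note D(1)[measurable_cong]
  let ?r = "R + norm (s *\<^sub>R \<nu>) + 1"
  show ?thesis
  proof (rule integrableI_bounded_set[where A = "ball 0 ?r" and B = B])
    show "emeasure \<kappa> (ball 0 ?r) < \<infinity>" using hm by (simp add: hyperplane_measure_def)
    have "f (s *\<^sub>R \<nu> + y) = 0" if "y \<notin> ball 0 ?r" for y
    proof (rule supp)
      have "norm y \<le> norm (s *\<^sub>R \<nu> + y) + norm (s *\<^sub>R \<nu>)"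
        using norm_triangle_ineq4[of "s *\<^sub>R \<nu> + y" "s *\<^sub>R \<nu>"] by simp
      then show "R < norm (s *\<^sub>R \<nu> + y)" using that by simp
    qed
    then show "AE y in \<kappa>. y \<notin> ball 0 ?r \<longrightarrow> f (s *\<^sub>R \<nu> + y) = 0" by simp
  qed (use bound D(1) in auto)
qed

lemma continuous_bounded_support_bounded:
  fixes f :: "'a::euclidean_space \<Rightarrow> 'b::real_normed_vector"
  assumes "continuous_on UNIV f" "\<And>x. R < norm x \<Longrightarrow> f x = 0"
  obtains B where "\<And>x. norm (f x) \<le> B"
proof -
  have "compact (f ` cball 0 R)"
    using assms(1) by (intro compact_continuous_image) (auto intro: continuous_on_subset)
  then obtain B where B: "\<And>x. x \<in> cball 0 R \<Longrightarrow> norm (f x) \<le> B"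
    by (metis compact_imp_bounded bounded_iff image_eqI)
  have "norm (f x) \<le> max B 0" for x
    using B[of x] assms(2)[of x] by (cases "R < norm x") auto
  then show thesis by (rule that)
qed

text \<open>Both parts come from slicing in the direction \<open>e\<close>: along lines orthogonal to \<open>\<nu>\<close> the sawtooth
  is constant.\<close>

lemma saw_gauss_green:
  fixes \<nu> :: "real^'n"
  assumes \<nu>: "norm \<nu> = 1" and C1: "C1_with_gradient \<Psi> d"
    and supp: "\<And>x. R < norm x \<Longrightarrow> \<Psi> x = 0" and k: "0 < k" and K: "real k * R < real_of_int K"
  shows "(\<integral>x. saw k (x \<bullet> \<nu>) *\<^sub>R d x \<partial>lborel) =
     ((\<Sum>i\<in>{-K..K}. LINT x:{x. x \<bullet> \<nu> = of_int i / real k}|surface_measure. \<Psi> x) / real k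
       - (\<integral>x. \<Psi> x \<partial>lborel)) *\<^sub>R \<nu>"
    "integrable lborel (\<lambda>x. saw k (x \<bullet> \<nu>) *\<^sub>R d x)"
proof -
  note c = C1_continuous[OF C1]
  note [measurable] = c(3,4)
  have dsupp: "d x = 0" if "R < norm x" for x
    using C1_gradient_bounded_support[OF C1 supp that] .
  have intd: "integrable lborel d" "integrable lborel \<Psi>"
    using integrable_continuous_bounded_support[OF c(2), of R] dsupp
      integrable_continuous_bounded_support[OF c(1), of R] supp by blast+
  show int: "integrable lborel (\<lambda>x. saw k (x \<bullet> \<nu>) *\<^sub>R d x)"
  proof (rule Bochner_Integration.integrable_bound[of lborel "\<lambda>x. (1 / real k) *\<^sub>R d x"])
    show "AE x in lborel. norm (saw k (x \<bullet> \<nu>) *\<^sub>R d x) \<le> norm ((1 / real k) *\<^sub>R d x)"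
    proof (intro AE_I2)
      fix x
      have "saw k (x \<bullet> \<nu>) * norm (d x) \<le> 1 / real k * norm (d x)"
        by (intro mult_right_mono saw_le norm_ge_zero)
      then show "norm (saw k (x \<bullet> \<nu>) *\<^sub>R d x) \<le> norm ((1 / real k) *\<^sub>R d x)"
        by (simp add: abs_of_nonneg[OF saw_nonneg])
    qed
  qed (use intd in auto)
  define V where "V = (\<integral>x. saw k (x \<bullet> \<nu>) *\<^sub>R d x \<partial>lborel)"
  have slice: "V \<bullet> e = (\<integral>y. (\<integral>r. saw k ((r *\<^sub>R e + y) \<bullet> \<nu>) * (d (r *\<^sub>R e + y) \<bullet> e) \<partial>lborel) \<partial>\<kappa>)"
    if "hyperplane_measure e \<kappa>" for e \<kappa>
  proof -
    have "V \<bullet> e = (\<integral>x. saw k (x \<bullet> \<nu>) * (d x \<bullet> e) \<partial>lborel)"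
      unfolding V_def using integral_inner_left[where M = lborel and f = "\<lambda>x. saw k (x \<bullet> \<nu>) *\<^sub>R d x" and c = e] int by simp
    moreover have "integrable lborel (\<lambda>x. saw k (x \<bullet> \<nu>) * (d x \<bullet> e))"
      using integrable_inner_left[where M = lborel and f = "\<lambda>x. saw k (x \<bullet> \<nu>) *\<^sub>R d x" and c = e] int by simp
    ultimately show ?thesis using hyperplane_measure_Fubini(1)[OF that, of "\<lambda>x. saw k (x \<bullet> \<nu>) * (d x \<bullet> e)"] by simp
  qed
  have far: "R < norm (r *\<^sub>R e + y)" if "norm e = 1" "y \<bullet> e = 0" "R < \<bar>r\<bar>" for r e and y :: "real^'n"
  proof -
    have "e \<bullet> e = 1" using that by (simp flip: power2_norm_eq_inner)
    then have "\<bar>r\<bar> = \<bar>(r *\<^sub>R e + y) \<bullet> e\<bar>" using that by (simp add: inner_add_left)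
    also have "\<dots> \<le> norm (r *\<^sub>R e + y)"
      using Cauchy_Schwarz_ineq2[of "r *\<^sub>R e + y" e] that by simp
    finally show ?thesis using that by simp
  qed
  have cline: "continuous_on UNIV (\<lambda>r. d (r *\<^sub>R e + y) \<bullet> e)" for e y
    by (intro continuous_intros continuous_on_compose2[OF c(2)]) auto
  note line = saw_integral[OF C1_line_derivative[OF C1] cline _ _ k K]
  have orth: "V \<bullet> e = 0" if e: "norm e = 1" "e \<bullet> \<nu> = 0" for e
  proof -
    obtain \<kappa> where \<kappa>: "hyperplane_measure e \<kappa>" using hyperplane_measure_exists[OF e(1)] .
    have "(\<integral>r. d (r *\<^sub>R e + y) \<bullet> e \<partial>lborel) = 0" if "y \<bullet> e = 0" for y
      by (rule line(1)) (use far[OF e(1) that] supp dsupp in auto)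
    then have "AE y in \<kappa>. (\<integral>r. saw k ((r *\<^sub>R e + y) \<bullet> \<nu>) * (d (r *\<^sub>R e + y) \<bullet> e) \<partial>lborel) = 0"
      using hyperplane_measureD(4)[OF \<kappa>] e(2) by (auto simp: inner_add_left elim!: AE_mp)
    then show ?thesis unfolding slice[OF \<kappa>] by (simp add: integral_eq_zero_AE)
  qed
  have "V = (V \<bullet> \<nu>) *\<^sub>R \<nu>"
  proof (rule ccontr)
    \<comment> \<open>The part of \<open>V\<close> orthogonal to \<nu>. Normalised, it is a
      direction to which \<open>orth\<close> applies, and being orthogonal to both \<open>V\<close>
      and \<nu> it is orthogonal to itself.\<close>
    define w where "w = V - (V \<bullet> \<nu>) *\<^sub>R \<nu>"
    assume "V \<noteq> (V \<bullet> \<nu>) *\<^sub>R \<nu>"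
    then have "w \<noteq> 0" by (simp add: w_def)
    have w\<nu>: "w \<bullet> \<nu> = 0" using \<nu> by (simp add: w_def inner_diff_left flip: power2_norm_eq_inner)
    have "V \<bullet> ((1 / norm w) *\<^sub>R w) = 0"
      by (rule orth) (use \<open>w \<noteq> 0\<close> w\<nu> in auto)
    then have "V \<bullet> w = 0" using \<open>w \<noteq> 0\<close> by simp
    then have "w \<bullet> w = 0" using w\<nu> by (simp add: w_def inner_diff_left inner_diff_right inner_commute)
    then show False using \<open>w \<noteq> 0\<close> by simp
  qed
  moreover have "V \<bullet> \<nu> = (\<Sum>i\<in>{-K..K}. LINT x:{x. x \<bullet> \<nu> = of_int i / real k}|surface_measure. \<Psi> x) / real k
       - (\<integral>x. \<Psi> x \<partial>lborel)"
  proof -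
    obtain \<kappa> where \<kappa>: "hyperplane_measure \<nu> \<kappa>" using hyperplane_measure_exists[OF \<nu>] .
    note D = hyperplane_measureD[OF \<kappa>]
    note D(1)[measurable_cong]
    interpret sigma_finite_measure \<kappa> by (rule D)
    have "\<nu> \<bullet> \<nu> = 1" using \<nu> by (simp flip: power2_norm_eq_inner)
    obtain B where B: "\<And>x. norm (\<Psi> x) \<le> B"
      using continuous_bounded_support_bounded[OF c(1), of R] supp by blast
    note hint = hyperplane_measure_integrable[OF \<kappa> c(3) B, of R, OF supp]
    have "V \<bullet> \<nu> = (\<integral>y. (\<integral>r. saw k ((r *\<^sub>R \<nu> + y) \<bullet> \<nu>) * (d (r *\<^sub>R \<nu> + y) \<bullet> \<nu>) \<partial>lborel) \<partial>\<kappa>)"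
      by (rule slice[OF \<kappa>])
    also have "\<dots> = (\<integral>y. - (\<integral>r. \<Psi> (r *\<^sub>R \<nu> + y) \<partial>lborel)
        + (\<Sum>i\<in>{-K..K}. \<Psi> ((of_int i / real k) *\<^sub>R \<nu> + y)) / real k \<partial>\<kappa>)"
    proof (rule integral_cong_AE)
      have "(\<integral>r. saw k ((r *\<^sub>R \<nu> + y) \<bullet> \<nu>) * (d (r *\<^sub>R \<nu> + y) \<bullet> \<nu>) \<partial>lborel)
          = - (\<integral>r. \<Psi> (r *\<^sub>R \<nu> + y) \<partial>lborel) + (\<Sum>i\<in>{-K..K}. \<Psi> ((of_int i / real k) *\<^sub>R \<nu> + y)) / real k"
        if y: "y \<bullet> \<nu> = 0" for y
      proof -
        have "(\<integral>r. saw k ((r *\<^sub>R \<nu> + y) \<bullet> \<nu>) * (d (r *\<^sub>R \<nu> + y) \<bullet> \<nu>) \<partial>lborel)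
            = (\<integral>r. saw k r * (d (r *\<^sub>R \<nu> + y) \<bullet> \<nu>) \<partial>lborel)"
          using y \<open>\<nu> \<bullet> \<nu> = 1\<close> by (simp add: inner_add_left)
        also have "\<dots> = - (\<integral>r. \<Psi> (r *\<^sub>R \<nu> + y) \<partial>lborel) + (\<Sum>i\<in>{-K..K}. \<Psi> ((of_int i / real k) *\<^sub>R \<nu> + y)) / real k"
          by (rule line(2)) (use far[OF \<nu> y] supp dsupp in auto)
        finally show ?thesis .
      qed
      then show "AE y in \<kappa>. (\<integral>r. saw k ((r *\<^sub>R \<nu> + y) \<bullet> \<nu>) * (d (r *\<^sub>R \<nu> + y) \<bullet> \<nu>) \<partial>lborel)
          = - (\<integral>r. \<Psi> (r *\<^sub>R \<nu> + y) \<partial>lborel) + (\<Sum>i\<in>{-K..K}. \<Psi> ((of_int i / real k) *\<^sub>R \<nu> + y)) / real k"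
        using D(4) by auto
    qed measurable
    also have "\<dots> = - (\<integral>y. (\<integral>r. \<Psi> (r *\<^sub>R \<nu> + y) \<partial>lborel) \<partial>\<kappa>)
        + (\<Sum>i\<in>{-K..K}. (\<integral>y. \<Psi> ((of_int i / real k) *\<^sub>R \<nu> + y) \<partial>\<kappa>)) / real k"
      using hyperplane_measure_Fubini(3)[OF \<kappa> intd(2)] hint by simp
    also have "\<dots> = - (\<integral>x. \<Psi> x \<partial>lborel)
        + (\<Sum>i\<in>{-K..K}. LINT x:{x. x \<bullet> \<nu> = of_int i / real k}|surface_measure. \<Psi> x) / real k"
      by (simp only: hyperplane_measure_Fubini(1)[OF \<kappa> intd(2)] hyperplane_measure_surface(2)[OF \<kappa> c(3)])
    finally show ?thesis by simp
  qed
  ultimately show "(\<integral>x. saw k (x \<bullet> \<nu>) *\<^sub>R d x \<partial>lborel) =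
     ((\<Sum>i\<in>{-K..K}. LINT x:{x. x \<bullet> \<nu> = of_int i / real k}|surface_measure. \<Psi> x) / real k
       - (\<integral>x. \<Psi> x \<partial>lborel)) *\<^sub>R \<nu>"
    by (simp add: V_def)
qed

section \<open>The unit cube, its boundary and its divergence theorem\<close>

lemma unit_cube_eq_box: "unit_cube = box (\<chi> i. - (1 / 2)) (\<chi> i. 1 / 2)"
proof -
  have "\<bar>r\<bar> < 1 / 2 \<longleftrightarrow> - (1 / 2) < r \<and> r < 1 / 2" for r :: real by linarith
  then show ?thesis by (simp only: unit_cube_def set_eq_iff mem_box_cart mem_Collect_eq vec_lambda_beta) simp
qed

definition closed_unit_cube :: "(real^'n) set" where
  "closed_unit_cube = {x. \<forall>i. \<bar>x $ i\<bar> \<le> 1 / 2}"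

lemma closed_unit_cube_eq_cbox: "closed_unit_cube = cbox (\<chi> i. - (1 / 2)) (\<chi> i. 1 / 2)"
proof -
  have "\<bar>r\<bar> \<le> 1 / 2 \<longleftrightarrow> - (1 / 2) \<le> r \<and> r \<le> 1 / 2" for r :: real by linarith
  then show ?thesis by (simp only: closed_unit_cube_def set_eq_iff mem_box_cart mem_Collect_eq vec_lambda_beta) simp
qed

lemma open_unit_cube: "open unit_cube"
  unfolding unit_cube_eq_box by (rule open_box)

lemma unit_cube_sets [measurable]: "unit_cube \<in> sets borel"
  by (simp add: open_unit_cube borel_open)

lemma closed_unit_cube_sets [measurable]: "closed_unit_cube \<in> sets borel"
  unfolding closed_unit_cube_eq_cbox by (intro borel_closed closed_cbox)

lemma unit_cube_subset_closed: "unit_cube \<subseteq> closed_unit_cube"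
  by (auto simp: unit_cube_def closed_unit_cube_def less_imp_le)

lemma frontier_unit_cube: "frontier unit_cube = (closed_unit_cube - unit_cube :: (real^'n) set)"
proof -
  have "(0 :: real^'n) \<in> box (\<chi> i. - (1 / 2)) (\<chi> i. 1 / 2)" by (simp add: mem_box_cart)
  then have "box (\<chi> i. - (1 / 2)) (\<chi> i. 1 / 2) \<noteq> ({} :: (real^'n) set)" by blast
  then show ?thesis
    by (simp add: unit_cube_eq_box closed_unit_cube_eq_cbox frontier_box)
qed

lemma mem_frontier_unit_cube:
  "x \<in> frontier unit_cube \<longleftrightarrow> x \<in> closed_unit_cube \<and> (\<exists>i. \<bar>x $ i\<bar> = 1 / 2)"
proof (cases "x \<in> closed_unit_cube")
  case True
  then have "\<bar>x $ i\<bar> \<le> 1 / 2" for i by (simp add: closed_unit_cube_def)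
  then have "\<bar>x $ i\<bar> < 1 / 2 \<longleftrightarrow> \<bar>x $ i\<bar> \<noteq> 1 / 2" for i by (simp only: order.strict_iff_order simp_thms)
  then have "x \<in> unit_cube \<longleftrightarrow> (\<forall>i. \<bar>x $ i\<bar> \<noteq> 1 / 2)" by (simp only: unit_cube_def mem_Collect_eq)
  then show ?thesis using True by (simp add: frontier_unit_cube)
qed (simp add: frontier_unit_cube)

lemma emeasure_unit_cube: "emeasure lborel (unit_cube :: (real^'n) set) = 1"
proof -
  let ?h = "(\<chi> i. 1 / 2) :: real^'n" and ?l = "(\<chi> i. - (1 / 2)) :: real^'n"
  have diff: "(?h - ?l) \<bullet> b = 1" and le: "?l \<bullet> b \<le> ?h \<bullet> b" if b: "b \<in> Basis" for b
  proof -
    obtain i where b: "b = axis i 1" using b by (auto simp: Basis_vec_def)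
    show "(?h - ?l) \<bullet> b = 1" "?l \<bullet> b \<le> ?h \<bullet> b" unfolding b inner_axis by simp_all
  qed
  have "emeasure lborel (unit_cube :: (real^'n) set) = ennreal (\<Prod>b\<in>Basis. (?h - ?l) \<bullet> b)"
    unfolding unit_cube_eq_box by (rule emeasure_lborel_box[OF le])
  also have "(\<Prod>b\<in>Basis. (?h - ?l) \<bullet> b) = 1" by (rule prod.neutral) (use diff in blast)
  finally show ?thesis by simp
qed

lemma norm_closed_unit_cube:
  assumes "x \<in> (closed_unit_cube :: (real^'n) set)"
  shows "norm x \<le> CARD('n)"
proof -
  have "norm x \<le> (\<Sum>i\<in>UNIV. \<bar>x $ i\<bar>)" by (rule norm_le_l1_cart)
  also have "\<dots> \<le> (\<Sum>i\<in>(UNIV::'n set). 1)"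
  proof (rule sum_mono)
    fix i
    have "\<bar>x $ i\<bar> \<le> 1 / 2" using assms by (simp add: closed_unit_cube_def)
    then show "\<bar>x $ i\<bar> \<le> 1" by simp
  qed
  finally show ?thesis by simp
qed

lemma AE_unit_cube_closed: "AE x in lborel. x \<in> unit_cube \<longleftrightarrow> x \<in> (closed_unit_cube :: (real^'n) set)"
proof -
  have "negligible (closed_unit_cube - unit_cube :: (real^'n) set)"
    unfolding unit_cube_eq_box closed_unit_cube_eq_cbox by (rule negligible_frontier_interval)
  then have "closed_unit_cube - unit_cube \<in> null_sets (lborel :: (real^'n) measure)"
    by (simp add: negligible_iff_null_sets null_sets_completion_iff)
  then have "AE x in lborel. x \<notin> closed_unit_cube - (unit_cube :: (real^'n) set)"
    by (rule AE_not_in)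
  then show ?thesis using unit_cube_subset_closed by (auto elim: AE_mp)
qed

lemma set_integrable_surface_hyperplane:
  fixes f :: "real^'n \<Rightarrow> 'b::{banach, second_countable_topology}"
  assumes \<nu>: "norm \<nu> = 1" and [measurable]: "f \<in> borel_measurable borel" "E \<in> sets borel"
    and E: "bounded E" and B: "\<And>x. x \<in> E \<Longrightarrow> norm (f x) \<le> B"
  shows "set_integrable surface_measure (E \<inter> {x. x \<bullet> \<nu> = s}) f"
proof -
  obtain \<kappa> where \<kappa>: "hyperplane_measure \<nu> \<kappa>" using hyperplane_measure_exists[OF \<nu>] .
  obtain R where R: "\<And>x. x \<in> E \<Longrightarrow> norm x \<le> R" using E by (auto simp: bounded_iff)
  have "integrable \<kappa> (\<lambda>y. indicator E (s *\<^sub>R \<nu> + y) *\<^sub>R f (s *\<^sub>R \<nu> + y))"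
  proof (rule hyperplane_measure_integrable[OF \<kappa>, where f = "\<lambda>x. indicator E x *\<^sub>R f x" and B = "max B 0" and R = R])
    show "norm (indicator E x *\<^sub>R f x) \<le> max B 0" for x
      using B[of x] by (auto simp: indicator_def)
    show "indicator E x *\<^sub>R f x = 0" if "R < norm x" for x
      using R[of x] that by (auto simp: indicator_def)
  qed measurable
  then have "set_integrable surface_measure {x. x \<bullet> \<nu> = s} (\<lambda>x. indicator E x *\<^sub>R f x)"
    by (subst hyperplane_measure_surface(1)[OF \<kappa>]) auto
  moreover have "indicat_real {x. x \<bullet> \<nu> = s} x *\<^sub>R indicat_real E x *\<^sub>R f x
      = indicat_real (E \<inter> {x. x \<bullet> \<nu> = s}) x *\<^sub>R f x" for x
    by (auto simp: indicator_def)
  ultimately show ?thesis unfolding set_integrable_def by (simp only:)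
qed

text \<open>The boundary is a finite union of closed faces. They overlap in edges, which does no
  harm to integrability.\<close>

lemma set_integrable_surface_cube_frontier:
  fixes f :: "real^'n \<Rightarrow> 'b::{banach, second_countable_topology}"
  assumes [measurable]: "f \<in> borel_measurable borel"
    and B: "\<And>x. x \<in> closed_unit_cube \<Longrightarrow> norm (f x) \<le> B"
  shows "set_integrable surface_measure (frontier unit_cube) f"
proof -
  let ?F = "\<lambda>(i, s). closed_unit_cube \<inter> {x. x \<bullet> axis i 1 = s} :: (real^'n) set"
  have "frontier unit_cube = (\<Union>p\<in>UNIV \<times> {-1/2, 1/2}. ?F p)"
  proof (rule set_eqI)
    fix x :: "real^'n"
    have "\<bar>x $ i\<bar> = 1 / 2 \<longleftrightarrow> x $ i \<in> {-1/2, 1/2}" for i by (auto simp: abs_if)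
    then show "x \<in> frontier unit_cube \<longleftrightarrow> x \<in> (\<Union>p\<in>UNIV \<times> {-1/2, 1/2}. ?F p)"
      unfolding mem_frontier_unit_cube by (auto simp: inner_axis)
  qed
  moreover have "set_integrable surface_measure (?F p) f" if "p \<in> UNIV \<times> {-1/2, 1/2}" for p
    using set_integrable_surface_hyperplane[of "axis (fst p) 1" f closed_unit_cube B "snd p"] B
    by (simp add: case_prod_unfold norm_axis_1 closed_unit_cube_eq_cbox bounded_cbox)
  ultimately show ?thesis
    by (simp only:) (rule set_integrable_UN, auto simp: case_prod_unfold inner_axis)
qed

text \<open>Along lines in the direction \<open>j\<close> this is the fundamental theorem of
  calculus, and only the two faces orthogonal to that direction contribute. The \<open>j\<close>-th
  component of \<open>cube_normal\<close> is nonzero exactly on these faces, edges included, so the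
  final comparison of integrands is pointwise and never needs edges to be null.\<close>

lemma cube_gauss_green:
  fixes F :: "real^'n \<Rightarrow> real"
  assumes C1: "C1_with_gradient F d"
  shows "(LINT x:unit_cube|lborel. d x $ j) = (LINT x:frontier unit_cube|surface_measure. F x * cube_normal x $ j)"
proof -
  note c = C1_continuous[OF C1]
  note [measurable] = c(3,4)
  let ?e = "axis j 1 :: real^'n"
  let ?C = "closed_unit_cube :: (real^'n) set"
  have e: "norm ?e = 1" by (simp add: norm_axis_1)
  obtain \<kappa> where \<kappa>: "hyperplane_measure ?e \<kappa>" using hyperplane_measure_exists[OF e] .
  note D = hyperplane_measureD[OF \<kappa>]
  note D(1)[measurable_cong]
  interpret sigma_finite_measure \<kappa> by (rule D)
  obtain B where B: "\<And>x. x \<in> ?C \<Longrightarrow> norm (F x) \<le> B"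
  proof -
    have "compact (F ` ?C)"
      using c(1) by (intro compact_continuous_image)
        (auto simp: closed_unit_cube_eq_cbox intro: continuous_on_subset)
    then show thesis using that by (metis compact_imp_bounded bounded_iff image_eqI)
  qed
  have face: "integrable \<kappa> (\<lambda>y. indicat_real ?C (s *\<^sub>R ?e + y) * F (s *\<^sub>R ?e + y))" for s
  proof (rule hyperplane_measure_integrable[OF \<kappa>, where f = "\<lambda>x. indicat_real ?C x * F x" and B = "max B 0" and R = "CARD('n)"])
    show "norm (indicat_real ?C x * F x) \<le> max B 0" for x
      using B[of x] by (auto simp: indicator_def)
    show "indicat_real ?C x * F x = 0" if "CARD('n) < norm x" for x
      using norm_closed_unit_cube[of x] that by (auto simp: indicator_def)
  qed measurable
  have [measurable]: "(\<lambda>x. d x $ j) \<in> borel_measurable borel"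
    using c(2) by (intro borel_measurable_continuous_onI continuous_intros)
  have surf: "integrable surface_measure (\<lambda>x. indicat_real {x. x \<bullet> ?e = s} x *\<^sub>R (indicat_real ?C x * F x))" for s
    using hyperplane_measure_surface(1)[OF \<kappa>, of "\<lambda>x. indicat_real ?C x * F x" s] face[of s]
    unfolding set_integrable_def by (simp del: One_nat_def)
  have int: "integrable lborel (\<lambda>x. indicat_real ?C x * d x $ j)"
    using borel_integrable_compact[of ?C "\<lambda>x. d x $ j"] c(2)
    by (auto simp: closed_unit_cube_eq_cbox intro!: continuous_intros intro: continuous_on_subset)
  \<comment> \<open>In the closed cube the lines have closed intervals as sections, with end points
    on the faces; the two cubes differ by a null set.\<close>
  have "(LINT x:unit_cube|lborel. d x $ j) = (\<integral>x. indicat_real ?C x * d x $ j \<partial>lborel)"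
    unfolding set_lebesgue_integral_def
  proof (rule integral_cong_AE)
    show "AE x in lborel. indicat_real unit_cube x *\<^sub>R d x $ j = indicat_real ?C x * d x $ j"
      using AE_unit_cube_closed by eventually_elim (simp add: indicator_def)
  qed measurable
  also have "\<dots> = (\<integral>y. (\<integral>r. indicat_real ?C (r *\<^sub>R ?e + y) * d (r *\<^sub>R ?e + y) $ j \<partial>lborel) \<partial>\<kappa>)"
    by (rule hyperplane_measure_Fubini(1)[OF \<kappa> int])
  also have "\<dots> = (\<integral>y. indicat_real ?C ((1/2) *\<^sub>R ?e + y) * F ((1/2) *\<^sub>R ?e + y)
      - indicat_real ?C ((-1/2) *\<^sub>R ?e + y) * F ((-1/2) *\<^sub>R ?e + y) \<partial>\<kappa>)"
  proof (rule integral_cong_AE)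
    have "(\<integral>r. indicat_real ?C (r *\<^sub>R ?e + y) * d (r *\<^sub>R ?e + y) $ j \<partial>lborel)
        = indicat_real ?C ((1/2) *\<^sub>R ?e + y) * F ((1/2) *\<^sub>R ?e + y)
          - indicat_real ?C ((-1/2) *\<^sub>R ?e + y) * F ((-1/2) *\<^sub>R ?e + y)" if "y \<bullet> ?e = 0" for y
    proof -
      have "y $ j = 0" using that by (simp add: inner_axis)
      then have comp: "(r *\<^sub>R ?e + y) $ i = (if i = j then r else y $ i)" for r i
        by (simp add: axis_def)
      have "r *\<^sub>R ?e + y \<in> ?C \<longleftrightarrow> \<bar>r\<bar> \<le> 1/2 \<and> y \<in> ?C" for r
      proof -
        have split: "(\<forall>i. P (if i = j then r else f i)) \<longleftrightarrow> P r \<and> (\<forall>i. P (f i))"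
          if "P (f j)" for P :: "real \<Rightarrow> bool" and f using that by auto
        have "\<bar>y $ j\<bar> \<le> 1/2" using \<open>y $ j = 0\<close> by simp
        from split[of "\<lambda>t. \<bar>t\<bar> \<le> 1/2" "\<lambda>i. y $ i", OF this] show ?thesis
          by (simp only: closed_unit_cube_def mem_Collect_eq comp)
      qed
      then have ind: "indicat_real ?C (r *\<^sub>R ?e + y) = indicat_real ?C y * indicat_real {-1/2..1/2} r" for r
        by (auto simp: indicator_def abs_le_iff)
      have FTC: "(\<integral>r. indicat_real {-1/2..1/2} r *\<^sub>R (d (r *\<^sub>R ?e + y) \<bullet> ?e) \<partial>lborel)
          = F ((1/2) *\<^sub>R ?e + y) - F ((-1/2) *\<^sub>R ?e + y)"
      proof (rule integral_FTC_atLeastAtMost)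
        show "((\<lambda>r. F (r *\<^sub>R ?e + y)) has_vector_derivative (d (r *\<^sub>R ?e + y) \<bullet> ?e)) (at r within {-1/2..1/2})" for r
          unfolding has_real_derivative_iff_has_vector_derivative[symmetric]
          by (rule has_field_derivative_at_within[OF C1_line_derivative[OF C1]])
        show "continuous_on {-1/2..1/2} (\<lambda>r. d (r *\<^sub>R ?e + y) \<bullet> ?e)"
          by (intro continuous_intros continuous_on_compose2[OF c(2)]) auto
      qed simp
      have "(\<integral>r. indicat_real ?C (r *\<^sub>R ?e + y) * d (r *\<^sub>R ?e + y) $ j \<partial>lborel)
          = (\<integral>r. indicat_real ?C y * (indicat_real {-1/2..1/2} r *\<^sub>R (d (r *\<^sub>R ?e + y) \<bullet> ?e)) \<partial>lborel)"
        unfolding ind by (simp add: inner_axis mult.assoc)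
      also have "\<dots> = indicat_real ?C y * (F ((1/2) *\<^sub>R ?e + y) - F ((-1/2) *\<^sub>R ?e + y))"
        unfolding integral_mult_right_zero FTC ..
      also have "\<dots> = indicat_real ?C ((1/2) *\<^sub>R ?e + y) * F ((1/2) *\<^sub>R ?e + y)
          - indicat_real ?C ((-1/2) *\<^sub>R ?e + y) * F ((-1/2) *\<^sub>R ?e + y)"
        unfolding ind by (simp add: right_diff_distrib indicator_def)
      finally show ?thesis .
    qed
    then show "AE y in \<kappa>. (\<integral>r. indicat_real ?C (r *\<^sub>R ?e + y) * d (r *\<^sub>R ?e + y) $ j \<partial>lborel)
        = indicat_real ?C ((1/2) *\<^sub>R ?e + y) * F ((1/2) *\<^sub>R ?e + y)
          - indicat_real ?C ((-1/2) *\<^sub>R ?e + y) * F ((-1/2) *\<^sub>R ?e + y)"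
      using D(4) by auto
  qed measurable
  also have "\<dots> = (\<integral>y. indicat_real ?C ((1/2) *\<^sub>R ?e + y) * F ((1/2) *\<^sub>R ?e + y) \<partial>\<kappa>)
      - (\<integral>y. indicat_real ?C ((-1/2) *\<^sub>R ?e + y) * F ((-1/2) *\<^sub>R ?e + y) \<partial>\<kappa>)"
    by (rule Bochner_Integration.integral_diff[OF face face])
  also have "\<dots> = (LINT x:{x. x \<bullet> ?e = 1/2}|surface_measure. indicat_real ?C x * F x)
      - (LINT x:{x. x \<bullet> ?e = -1/2}|surface_measure. indicat_real ?C x * F x)"
    by (subst (1 2) hyperplane_measure_surface(2)[OF \<kappa>]) simp_all
  also have "\<dots> = (\<integral>x. indicat_real {x. x \<bullet> ?e = 1/2} x *\<^sub>R (indicat_real ?C x * F x)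
      - indicat_real {x. x \<bullet> ?e = -1/2} x *\<^sub>R (indicat_real ?C x * F x) \<partial>surface_measure)"
    unfolding set_lebesgue_integral_def
    by (rule Bochner_Integration.integral_diff[symmetric, OF surf surf])
  also have "\<dots> = (LINT x:frontier unit_cube|surface_measure. F x * cube_normal x $ j)"
    unfolding set_lebesgue_integral_def
  proof (rule Bochner_Integration.integral_cong[OF refl])
    fix x :: "real^'n"
    show "indicat_real {x. x \<bullet> ?e = 1/2} x *\<^sub>R (indicat_real ?C x * F x)
      - indicat_real {x. x \<bullet> ?e = -1/2} x *\<^sub>R (indicat_real ?C x * F x)
      = indicat_real (frontier unit_cube) x *\<^sub>R (F x * cube_normal x $ j)"
      by (cases "x $ j = 1/2 \<or> x $ j = - (1/2)")
         (auto simp: indicator_def inner_axis cube_normal_def mem_frontier_unit_cube abs_if split: if_splits)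
  qed
  finally show ?thesis .
qed

section \<open>Uniqueness of the distributional derivative\<close>

lemma C1_const: "C1_with_gradient (\<lambda>x. c) (\<lambda>x. 0)"
  by (simp add: C1_with_gradient_def GDERIV_const)

lemma C1_component: "C1_with_gradient (\<lambda>x. x $ i) (\<lambda>x. axis i 1)"
proof -
  have "((\<lambda>x::real^'a. x $ i) has_derivative (\<lambda>h. h $ i)) (at x)" for x
    by (intro bounded_linear_imp_has_derivative bounded_linear_vec_nth)
  moreover have "(\<lambda>h::real^'a. h $ i) = (\<lambda>h. h \<bullet> axis i 1)" by (simp add: inner_axis)
  ultimately show ?thesis by (simp add: C1_with_gradient_def gderiv_def)
qed

lemma C1_mult:
  assumes "C1_with_gradient f df" "C1_with_gradient g dg"
  shows "C1_with_gradient (\<lambda>x. f x * g x) (\<lambda>x. f x *\<^sub>R dg x + g x *\<^sub>R df x)"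
  using assms C1_continuous(1,2)[OF assms(1)] C1_continuous(1,2)[OF assms(2)]
  by (auto simp: C1_with_gradient_def intro!: GDERIV_mult continuous_intros)

lemma C1_compose:
  assumes C1: "C1_with_gradient f df"
    and g: "\<And>s. (g has_real_derivative g' s) (at s)" "continuous_on UNIV g'"
  shows "C1_with_gradient (\<lambda>x. g (f x)) (\<lambda>x. g' (f x) *\<^sub>R df x)"
  unfolding C1_with_gradient_def
proof (intro conjI allI)
  show "GDERIV (\<lambda>x. g (f x)) x :> g' (f x) *\<^sub>R df x" for x
    using C1 g(1) by (intro GDERIV_DERIV_compose) (auto simp: C1_with_gradient_def)
  show "continuous_on UNIV (\<lambda>x. g' (f x) *\<^sub>R df x)"
    using C1_continuous(1,2)[OF C1] by (intro continuous_intros continuous_on_compose2[OF g(2)]) auto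
qed

lemma C1_prod:
  assumes "finite I" "\<And>i. i \<in> I \<Longrightarrow> \<exists>d. C1_with_gradient (f i) d"
  shows "\<exists>d. C1_with_gradient (\<lambda>x. \<Prod>i\<in>I. f i x) d"
  using assms
proof (induction I)
  case empty
  show ?case by (auto intro: C1_const)
next
  case (insert i I)
  obtain d where d: "C1_with_gradient (f i) d" using insert.prems[of i] by auto
  obtain d' where d': "C1_with_gradient (\<lambda>x. \<Prod>i\<in>I. f i x) d'" using insert.IH insert.prems by auto
  from C1_mult[OF d d'] show ?case using insert by auto
qed

text \<open>The square removes the corner of the truncation at 0; this is the building block for
  compactly supported test functions.\<close>

lemma DERIV_max_0_power2:
  "((\<lambda>s::real. (max 0 s)\<^sup>2) has_real_derivative 2 * max 0 s) (at s)"
proof -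
  consider "s < 0" | "s = 0" | "0 < s" by linarith
  then show ?thesis
  proof cases
    case 1
    have "((\<lambda>s::real. 0) has_real_derivative 2 * max 0 s) (at s)" using 1 by simp
    then show ?thesis
      by (rule has_field_derivative_transform_within_open[where S = "{..<0}"]) (use 1 in auto)
  next
    case 2
    have "((\<lambda>s::real. max 0 s) \<longlongrightarrow> max 0 0) (at 0)"
      by (intro tendsto_intros)
    moreover have "eventually (\<lambda>s::real. max 0 s = ((max 0 s)\<^sup>2 - (max 0 0)\<^sup>2) / (s - 0)) (at 0)"
      by (auto simp: eventually_at_filter max_def power2_eq_square)
    ultimately have "((\<lambda>s::real. ((max 0 s)\<^sup>2 - (max 0 0)\<^sup>2) / (s - 0)) \<longlongrightarrow> max 0 0) (at 0)"
      by (rule Lim_transform_eventually)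
    then show ?thesis using 2 by (simp add: has_field_derivative_iff)
  next
    case 3
    have "((\<lambda>s::real. s\<^sup>2) has_real_derivative 2 * max 0 s) (at s)"
      using 3 by (auto intro!: derivative_eq_intros)
    then show ?thesis
      by (rule has_field_derivative_transform_within_open[where S = "{0<..}"]) (use 3 in auto)
  qed
qed

text \<open>Each factor is truncated before the product is formed, since otherwise two negative
  factors could make the product positive outside the box. The squares make it C1 across the
  faces.\<close>

definition box_bump :: "real^'n \<Rightarrow> real^'n \<Rightarrow> real^'n \<Rightarrow> real" where
  "box_bump a b x = (\<Prod>i\<in>UNIV. (max 0 ((x $ i - a $ i) * (b $ i - x $ i)))\<^sup>2)"

lemma box_bump_nonneg: "0 \<le> box_bump a b x"
  by (simp add: box_bump_def prod_nonneg)

lemma box_bump_eq_0_iff: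
  assumes "\<And>i. a $ i < b $ i"
  shows "box_bump a b x = 0 \<longleftrightarrow> x \<notin> box a b"
proof -
  have "(max 0 ((x $ i - a $ i) * (b $ i - x $ i)))\<^sup>2 = 0 \<longleftrightarrow> \<not> (a $ i < x $ i \<and> x $ i < b $ i)" for i
    using assms[of i] by (auto simp: max_def zero_le_mult_iff not_le mult_le_0_iff)
  then show ?thesis by (simp add: box_bump_def mem_box_cart)
qed

lemma C1_box_bump: "\<exists>d. C1_with_gradient (box_bump a b) d"
proof -
  have "\<exists>d. C1_with_gradient (\<lambda>x. (max 0 ((x $ i - a $ i) * (b $ i - x $ i)))\<^sup>2) d" for i
  proof -
    have d: "((\<lambda>s. (max 0 ((s - a $ i) * (b $ i - s)))\<^sup>2) has_real_derivative
        2 * max 0 ((s - a $ i) * (b $ i - s)) * (a $ i + b $ i - 2 * s)) (at s)" for s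
      by (rule DERIV_chain2[where f = "\<lambda>s. (max 0 s)\<^sup>2", OF DERIV_max_0_power2])
         (auto intro!: derivative_eq_intros)
    have c: "continuous_on UNIV (\<lambda>s. 2 * max 0 ((s - a $ i) * (b $ i - s)) * (a $ i + b $ i - 2 * s))"
      by (intro continuous_intros)
    show ?thesis using C1_compose[OF C1_component d c] by blast
  qed
  then show ?thesis unfolding box_bump_def[abs_def] by (intro C1_prod) auto
qed

text \<open>Has the same zeros as the bump for positive \<open>m\<close>, stays between 0 and 1, and
  tends pointwise to the indicator of the open box.\<close>

definition box_cutoff :: "real^'n \<Rightarrow> real^'n \<Rightarrow> nat \<Rightarrow> real^'n \<Rightarrow> real" where
  "box_cutoff a b m x = 1 - exp (- (real m * box_bump a b x))"

lemma box_cutoff_bounds: "0 \<le> box_cutoff a b m x" "box_cutoff a b m x \<le> 1"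
  by (simp_all add: box_cutoff_def box_bump_nonneg)

lemma box_cutoff_nonzero_iff:
  assumes "\<And>i. a $ i < b $ i" "0 < m"
  shows "box_cutoff a b m x \<noteq> 0 \<longleftrightarrow> x \<in> box a b"
  using box_bump_eq_0_iff[OF assms(1), of x] assms(2) by (auto simp: box_cutoff_def)

lemma C1_box_cutoff: "\<exists>d. C1_with_gradient (box_cutoff a b m) d"
proof -
  obtain d where d: "C1_with_gradient (box_bump a b) d" using C1_box_bump by blast
  have e: "((\<lambda>s. 1 - exp (- (real m * s))) has_real_derivative real m * exp (- (real m * s))) (at s)" for s
    by (auto intro!: derivative_eq_intros)
  have c: "continuous_on UNIV (\<lambda>s. real m * exp (- (real m * s)))"
    by (intro continuous_intros)
  show ?thesis
    unfolding box_cutoff_def[abs_def] using C1_compose[OF d e c] by blast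
qed

lemma tendsto_box_cutoff:
  assumes "\<And>i. a $ i < b $ i"
  shows "(\<lambda>m. box_cutoff a b m x) \<longlonglongrightarrow> indicator (box a b) x"
proof (cases "x \<in> box a b")
  case True
  then have pos: "0 < box_bump a b x"
    using box_bump_eq_0_iff[OF assms, of x] box_bump_nonneg[of a b x] by simp
  have "filterlim (\<lambda>m. real m * box_bump a b x) at_top sequentially"
    using filterlim_tendsto_pos_mult_at_top[OF tendsto_const pos filterlim_real_sequentially]
    by (simp add: mult.commute)
  then have "(\<lambda>m. exp (- (real m * box_bump a b x))) \<longlonglongrightarrow> 0"
    by (intro filterlim_compose[OF exp_at_bot] filterlim_compose[OF filterlim_uminus_at_bot_at_top])
  then have "(\<lambda>m. 1 - exp (- (real m * box_bump a b x))) \<longlonglongrightarrow> 1 - 0"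
    by (intro tendsto_intros)
  then show ?thesis using True by (simp add: box_cutoff_def)
next
  case False
  then show ?thesis using box_bump_eq_0_iff[OF assms, of x] by (simp add: box_cutoff_def)
qed

lemma deriv_measureD:
  assumes "deriv_measure \<Omega> u \<mu> \<sigma>"
  shows "finite_measure \<mu>" "sets \<mu> = sets borel" "\<sigma> \<in> borel_measurable borel"
    "AE x in \<mu>. norm (\<sigma> x) = 1" "integrable \<mu> \<sigma>" "emeasure \<mu> (- \<Omega>) = 0"
proof -
  show 1: "finite_measure \<mu>" "sets \<mu> = sets borel" "\<sigma> \<in> borel_measurable borel"
    "AE x in \<mu>. norm (\<sigma> x) = 1" "emeasure \<mu> (- \<Omega>) = 0"
    using assms by (auto simp: deriv_measure_def)
  have "\<sigma> \<in> borel_measurable \<mu>" using 1(2,3) by (simp cong: measurable_cong_sets)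
  then show "integrable \<mu> \<sigma>"
    using 1(4) by (intro finite_measure.integrable_const_bound[OF 1(1), of _ 1]) auto
qed

text \<open>The defining identity gives both representations the same integrals against the cutoffs
  of the box. Dominated convergence with majorant \<open>norm (\<sigma> x)\<close> replaces the
  cutoff by the indicator.\<close>

lemma deriv_measure_box_eq:
  fixes \<sigma> :: "real^'n \<Rightarrow> real^'n^'d"
  assumes D: "deriv_measure \<Omega> u \<mu> \<sigma>" and D': "deriv_measure \<Omega> u \<mu>' \<sigma>'"
    and ab: "cbox a b \<subseteq> \<Omega>"
  shows "(LINT x:box a b|\<mu>. \<sigma> x) = (LINT x:box a b|\<mu>'. \<sigma>' x)"
proof (cases "box a b = {}")
  case False
  then obtain z where "z \<in> box a b" by blast
  then have "a $ i < z $ i \<and> z $ i < b $ i" for i by (simp add: mem_box_cart)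
  then have lt: "a $ i < b $ i" for i using less_trans by blast
  \<comment> \<open>\<open>Suc m\<close> keeps the parameter positive, so that the cutoff is nonzero
    exactly on the box.\<close>
  have lim: "(\<lambda>m. \<integral>x. box_cutoff a b (Suc m) x *\<^sub>R \<sigma> x \<partial>\<mu>) \<longlonglongrightarrow> (LINT x:box a b|\<mu>. \<sigma> x)"
    if D: "deriv_measure \<Omega> u \<mu> \<sigma>" for \<mu> and \<sigma> :: "real^'n \<Rightarrow> real^'n^'d"
    unfolding set_lebesgue_integral_def
  proof (rule integral_dominated_convergence[where w = "\<lambda>x. norm (\<sigma> x)"])
    note E = deriv_measureD[OF D]
    note E(2)[measurable_cong] E(3)[measurable]
    have [measurable]: "box_cutoff a b (Suc m) \<in> borel_measurable borel" for m
      using C1_box_cutoff[of a b "Suc m"] C1_continuous(3) by blast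
    show "(\<lambda>x. box_cutoff a b (Suc m) x *\<^sub>R \<sigma> x) \<in> borel_measurable \<mu>"
      "(\<lambda>x. indicat_real (box a b) x *\<^sub>R \<sigma> x) \<in> borel_measurable \<mu>" for m by measurable
    show "integrable \<mu> (\<lambda>x. norm (\<sigma> x))" using E(5) by simp
    show "AE x in \<mu>. (\<lambda>m. box_cutoff a b (Suc m) x *\<^sub>R \<sigma> x) \<longlonglongrightarrow> indicat_real (box a b) x *\<^sub>R \<sigma> x"
      using tendsto_box_cutoff[OF lt] by (intro AE_I2 tendsto_scaleR tendsto_const LIMSEQ_Suc)
    show "AE x in \<mu>. norm (box_cutoff a b (Suc m) x *\<^sub>R \<sigma> x) \<le> norm (\<sigma> x)" for m
      using box_cutoff_bounds[of a b "Suc m"] by (intro AE_I2) (simp add: mult_left_le_one_le)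
  qed
  have "(\<integral>x. box_cutoff a b (Suc m) x *\<^sub>R \<sigma> x \<partial>\<mu>) = (\<integral>x. box_cutoff a b (Suc m) x *\<^sub>R \<sigma>' x \<partial>\<mu>')" for m
  proof -
    let ?\<phi> = "box_cutoff a b (Suc m)"
    obtain d where d: "C1_with_gradient ?\<phi> d" using C1_box_cutoff by blast
    have "{x. ?\<phi> x \<noteq> 0} = box a b" using box_cutoff_nonzero_iff[OF lt] by auto
    then have cl: "closure {x. ?\<phi> x \<noteq> 0} \<subseteq> cbox a b"
      using closure_minimal[OF box_subset_cbox closed_cbox, of a b] by (simp only:)
    then have "compactly_supported_in \<Omega> ?\<phi>" unfolding compactly_supported_in_def
      using ab bounded_subset[OF bounded_cbox cl] by (auto simp: compact_eq_bounded_closed)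
    then have "(LINT x:\<Omega>|lebesgue. u x \<otimes>\<^sub>t d x) = - (\<integral>x. ?\<phi> x *\<^sub>R \<sigma> x \<partial>\<mu>)"
      "(LINT x:\<Omega>|lebesgue. u x \<otimes>\<^sub>t d x) = - (\<integral>x. ?\<phi> x *\<^sub>R \<sigma>' x \<partial>\<mu>')"
      using D D' d unfolding deriv_measure_def by blast+
    then show ?thesis by simp
  qed
  then show ?thesis using LIMSEQ_unique[OF lim[OF D]] lim[OF D'] by simp
qed (simp add: set_lebesgue_integral_def)

text \<open>Boxes generate the Borel sets and are stable under intersection, but equality is known
  only for boxes with closure inside the cube, and a Dynkin argument also needs the whole space. It
  is therefore run for the traces on the smaller cubes \<open>Qs s\<close>. Letting \<open>s\<close>
  tend to 1/2 then suffices, because both measures vanish off the open cube.\<close>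

lemma deriv_measure_unique:
  fixes \<sigma> :: "real^'n \<Rightarrow> real^'n^'d"
  assumes D: "deriv_measure unit_cube u \<mu> \<sigma>" and D': "deriv_measure unit_cube u \<mu>' \<sigma>'"
    and E: "E \<in> sets borel"
  shows "(LINT x:E|\<mu>. \<sigma> x) = (LINT x:E|\<mu>'. \<sigma>' x)"
proof -
  define Qs where "Qs s = (box (\<chi> i. - s) (\<chi> i. s) :: (real^'n) set)" for s :: real
  note F = deriv_measureD[OF D] and F' = deriv_measureD[OF D']
  note F(2)[measurable_cong] F'(2)[measurable_cong] F(3)[measurable] F'(3)[measurable]
  have Qs[measurable]: "Qs s \<in> sets borel" for s by (simp add: Qs_def)
  have set_int: "set_integrable \<mu> A \<sigma>" "set_integrable \<mu>' A \<sigma>'" if [measurable]: "A \<in> sets borel" for A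
    using F(5) F'(5) unfolding set_integrable_def by (auto intro!: integrable_mult_indicator)
  let ?G = "range (\<lambda>(a, b). box a b :: (real^'n) set)"
  have borel: "sets borel = sigma_sets UNIV ?G" by (subst borel_eq_box) simp
  have small: "(LINT x:E \<inter> Qs s|\<mu>. \<sigma> x) = (LINT x:E \<inter> Qs s|\<mu>'. \<sigma>' x)" if s: "s < 1 / 2" for s
  proof -
    have sub: "cbox (\<chi> i. - s) (\<chi> i. s) \<subseteq> (unit_cube :: (real^'n) set)"
    proof
      fix x :: "real^'n" assume "x \<in> cbox (\<chi> i. - s) (\<chi> i. s)"
      then have "- s \<le> x $ i" "x $ i \<le> s" for i by (simp_all add: mem_box_cart)
      then have "\<bar>x $ i\<bar> < 1 / 2" for i using s by (simp only: abs_less_iff) (smt (verit))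
      then show "x \<in> unit_cube" by (simp add: unit_cube_def)
    qed
    have "Int_stable ?G" by (auto simp: Int_stable_def box_Int_box)
    moreover have "?G \<subseteq> Pow UNIV" by simp
    moreover have "E \<in> sigma_sets UNIV ?G" using E by (simp add: borel)
    ultimately show ?thesis
    proof (induction rule: sigma_sets_induct_disjoint)
      case (basic A)
      then obtain a b where A: "A = box a b" by auto
      have "cbox (\<Sum>i\<in>Basis. max (a \<bullet> i) ((\<chi> i. - s) \<bullet> i) *\<^sub>R i) (\<Sum>i\<in>Basis. min (b \<bullet> i) ((\<chi> i. s) \<bullet> i) *\<^sub>R i) \<subseteq> unit_cube"
        using sub unfolding Int_interval[symmetric] by blast
      then show ?case unfolding A Qs_def box_Int_box by (rule deriv_measure_box_eq[OF D D'])
    next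
      case empty
      show ?case by (simp add: set_lebesgue_integral_def)
    next
      case (compl A)
      then have [measurable]: "A \<in> sets borel" by (simp add: borel)
      have un: "Qs s = ((UNIV - A) \<inter> Qs s) \<union> (A \<inter> Qs s)" by auto
      have disj: "((UNIV - A) \<inter> Qs s) \<inter> (A \<inter> Qs s) = {}" by auto
      have "(LINT x:Qs s|\<mu>. \<sigma> x) = (LINT x:(UNIV - A) \<inter> Qs s|\<mu>. \<sigma> x) + (LINT x:A \<inter> Qs s|\<mu>. \<sigma> x)"
        by (subst un, rule set_integral_Un[OF disj]) (intro set_int; measurable)+
      moreover have "(LINT x:Qs s|\<mu>'. \<sigma>' x) = (LINT x:(UNIV - A) \<inter> Qs s|\<mu>'. \<sigma>' x) + (LINT x:A \<inter> Qs s|\<mu>'. \<sigma>' x)"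
        by (subst un, rule set_integral_Un[OF disj]) (intro set_int; measurable)+
      moreover have "(LINT x:Qs s|\<mu>. \<sigma> x) = (LINT x:Qs s|\<mu>'. \<sigma>' x)"
        unfolding Qs_def by (rule deriv_measure_box_eq[OF D D' sub])
      ultimately show ?case using compl.IH by simp
    next
      case (union A)
      then have [measurable]: "A i \<in> sets borel" for i by (auto simp: borel)
      have un: "(\<Union>i. A i) \<inter> Qs s = (\<Union>i. A i \<inter> Qs s)" by auto
      have disj: "(A i \<inter> Qs s) \<inter> (A j \<inter> Qs s) = {}" if "i \<noteq> j" for i j
        using union(1) that by (auto simp: disjoint_family_on_def)
      have "(LINT x:(\<Union>i. A i) \<inter> Qs s|\<mu>. \<sigma> x) = (\<Sum>i. LINT x:A i \<inter> Qs s|\<mu>. \<sigma> x)"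
        unfolding un by (rule lebesgue_integral_countable_add[OF _ disj set_int(1)]) measurable
      moreover have "(LINT x:(\<Union>i. A i) \<inter> Qs s|\<mu>'. \<sigma>' x) = (\<Sum>i. LINT x:A i \<inter> Qs s|\<mu>'. \<sigma>' x)"
        unfolding un by (rule lebesgue_integral_countable_add[OF _ disj set_int(2)]) measurable
      ultimately show ?case using union by simp
    qed
  qed
  define t where "t n = 1 / 2 - 1 / real (n + 3)" for n
  have t: "t n < 1 / 2" for n by (simp add: t_def)
  have tlim: "t \<longlonglongrightarrow> 1 / 2"
  proof -
    have "(\<lambda>n. 1 / 2 - 1 / real (n + 3)) \<longlonglongrightarrow> 1 / 2 - 0"
      by (intro tendsto_intros LIMSEQ_ignore_initial_segment[OF lim_1_over_n])
    then show ?thesis by (simp add: t_def[abs_def])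
  qed
  have ind: "(\<lambda>n. indicat_real (E \<inter> Qs (t n)) x) \<longlonglongrightarrow> indicat_real E x" if x: "x \<in> unit_cube" for x
  proof -
    have "eventually (\<lambda>n. \<bar>x $ i\<bar> < t n) sequentially" for i
      using x by (intro order_tendstoD[OF tlim]) (simp add: unit_cube_def)
    then have "eventually (\<lambda>n. \<forall>i. \<bar>x $ i\<bar> < t n) sequentially" by (rule eventually_all_finite)
    then have "eventually (\<lambda>n. indicat_real (E \<inter> Qs (t n)) x = indicat_real E x) sequentially"
    proof eventually_elim
      case (elim n)
      then have "- t n < x $ i \<and> x $ i < t n" for i by (simp add: abs_less_iff minus_less_iff)
      then have "x \<in> Qs (t n)" by (simp add: Qs_def mem_box_cart)
      then show ?case by (simp add: indicator_def)
    qed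
    then show ?thesis by (rule tendsto_eventually)
  qed
  have lim: "(\<lambda>n. LINT x:E \<inter> Qs (t n)|\<mu>. \<sigma> x) \<longlonglongrightarrow> (LINT x:E|\<mu>. \<sigma> x)"
    if D: "deriv_measure unit_cube u \<mu> \<sigma>" for \<mu> and \<sigma> :: "real^'n \<Rightarrow> real^'n^'d"
    unfolding set_lebesgue_integral_def
  proof (rule integral_dominated_convergence[where w = "\<lambda>x. norm (\<sigma> x)"])
    note E = deriv_measureD[OF D] and [measurable] = E
    note E(2)[measurable_cong] E(3)[measurable]
    show "(\<lambda>x. indicat_real E x *\<^sub>R \<sigma> x) \<in> borel_measurable \<mu>" by measurable
    show "(\<lambda>x. indicat_real (E \<inter> Qs (t n)) x *\<^sub>R \<sigma> x) \<in> borel_measurable \<mu>" for n by measurable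
    show "integrable \<mu> (\<lambda>x. norm (\<sigma> x))" using E(5) by simp
    have "- unit_cube \<in> null_sets \<mu>"
      using E(2,6) by (intro null_setsI) auto
    then have "AE x in \<mu>. x \<notin> - unit_cube" by (rule AE_not_in)
    then show "AE x in \<mu>. (\<lambda>n. indicat_real (E \<inter> Qs (t n)) x *\<^sub>R \<sigma> x) \<longlonglongrightarrow> indicat_real E x *\<^sub>R \<sigma> x"
      by eventually_elim (intro tendsto_scaleR tendsto_const ind, simp)
    show "AE x in \<mu>. norm (indicat_real (E \<inter> Qs (t n)) x *\<^sub>R \<sigma> x) \<le> norm (\<sigma> x)" for n
      by (intro AE_I2) (simp add: indicator_def)
  qed
  show ?thesis
    using lim[OF D] lim[OF D'] small[OF t] by (simp add: LIMSEQ_unique)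
qed

section \<open>Almost everywhere uniqueness of the absolutely continuous density\<close>

lemma sigma_finite_lebesgue: "sigma_finite_measure (lebesgue :: 'a::euclidean_space measure)"
proof
  have "\<exists>n. x \<in> ball 0 (real n)" for x :: 'a
    using reals_Archimedean2[of "norm x"] by auto
  then show "\<exists>A :: 'a set set. countable A \<and> A \<subseteq> sets lebesgue \<and> \<Union> A = space lebesgue \<and> (\<forall>a\<in>A. emeasure lebesgue a \<noteq> \<infinity>)"
    using emeasure_bounded_finite[OF bounded_ball, of "0::'a"]
    by (intro exI[of _ "range (\<lambda>n. ball 0 (real n))"]) (auto simp: less_top)
qed

text \<open>The definition of a density speaks of Borel sets, while the vanishing criterion for
  integrals asks for all Lebesgue measurable sets; the two kinds differ by null sets.\<close>

lemma set_integral_lebesgue_eq_imp_AE: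
  fixes f g :: "'a::euclidean_space \<Rightarrow> 'b::{banach, second_countable_topology}"
  assumes f: "set_integrable lebesgue \<Omega> f" and g: "set_integrable lebesgue \<Omega> g"
    and \<Omega>[measurable]: "\<Omega> \<in> sets borel"
    and eq: "\<And>E. E \<in> sets borel \<Longrightarrow> E \<subseteq> \<Omega> \<Longrightarrow> (LINT x:E|lebesgue. f x) = (LINT x:E|lebesgue. g x)"
  shows "AE x in lebesgue. x \<in> \<Omega> \<longrightarrow> f x = g x"
proof -
  interpret sigma_finite_measure "lebesgue :: 'a measure" by (rule sigma_finite_lebesgue)
  have int: "integrable lebesgue (\<lambda>x. indicat_real \<Omega> x *\<^sub>R f x - indicat_real \<Omega> x *\<^sub>R g x)"
    using f g unfolding set_integrable_def by (rule Bochner_Integration.integrable_diff)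
  have "AE x in lebesgue. indicat_real \<Omega> x *\<^sub>R f x - indicat_real \<Omega> x *\<^sub>R g x = 0"
  proof (rule density_zero[OF int])
    fix A :: "'a set" assume A: "A \<in> sets lebesgue"
    then obtain S N N' where SN: "A = S \<union> N" "N \<subseteq> N'" "N' \<in> null_sets lborel" "S \<in> sets borel"
      by (elim sets_completionE) auto
    let ?E = "S \<inter> \<Omega>"
    have N': "AE x in lebesgue. x \<notin> N'" using SN(3) by (intro AE_not_in null_sets_completionI)
    have E: "?E \<in> sets borel" "?E \<subseteq> \<Omega>" using SN(4) by auto
    have sub: "integrable lebesgue (\<lambda>x. indicat_real ?E x *\<^sub>R f x)" "integrable lebesgue (\<lambda>x. indicat_real ?E x *\<^sub>R g x)"
      using set_integrable_subset[OF f _ E(2)] set_integrable_subset[OF g _ E(2)] E(1)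
      by (simp_all add: set_integrable_def)
    have "(LINT x:A|lebesgue. indicat_real \<Omega> x *\<^sub>R f x - indicat_real \<Omega> x *\<^sub>R g x)
        = (\<integral>x. indicat_real ?E x *\<^sub>R f x - indicat_real ?E x *\<^sub>R g x \<partial>lebesgue)"
      unfolding set_lebesgue_integral_def
    proof (rule integral_cong_AE)
      show "AE x in lebesgue. indicat_real A x *\<^sub>R (indicat_real \<Omega> x *\<^sub>R f x - indicat_real \<Omega> x *\<^sub>R g x)
          = indicat_real ?E x *\<^sub>R f x - indicat_real ?E x *\<^sub>R g x"
        using N' by eventually_elim (use SN(1,2) in \<open>auto simp: indicator_def\<close>)
      show "(\<lambda>x. indicat_real A x *\<^sub>R (indicat_real \<Omega> x *\<^sub>R f x - indicat_real \<Omega> x *\<^sub>R g x)) \<in> borel_measurable lebesgue"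
        using int A by (intro borel_measurable_scaleR borel_measurable_indicator) auto
      show "(\<lambda>x. indicat_real ?E x *\<^sub>R f x - indicat_real ?E x *\<^sub>R g x) \<in> borel_measurable lebesgue"
        using sub by (intro borel_measurable_diff) auto
    qed
    also have "\<dots> = 0"
      using eq[OF E] sub by (simp add: set_lebesgue_integral_def)
    finally show "(LINT x:A|lebesgue. indicat_real \<Omega> x *\<^sub>R f x - indicat_real \<Omega> x *\<^sub>R g x) = 0" .
  qed
  then show ?thesis by eventually_elim (auto simp: indicator_def)
qed

text \<open>The two densities may come with different polar pairs and different null sets carrying
  the singular part. Removing both null sets from \<open>E\<close> makes both formulas available
  without changing Lebesgue integrals, and uniqueness of \<open>Du\<close> compares the left-hand
  sides.\<close>

lemma ac_density_unique:
  fixes u :: "real^'n \<Rightarrow> real^'d"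
  assumes g: "ac_density unit_cube u g" and h: "ac_density unit_cube u h"
  shows "AE x in lebesgue. x \<in> unit_cube \<longrightarrow> g x = h x"
proof (rule set_integral_lebesgue_eq_imp_AE)
  obtain \<mu> \<sigma> Z where D: "deriv_measure unit_cube u \<mu> \<sigma>" and Z: "Z \<in> null_sets lborel"
    and G: "\<And>E. E \<in> sets borel \<Longrightarrow> E \<subseteq> unit_cube \<Longrightarrow> (LINT x:E - Z|\<mu>. \<sigma> x) = (LINT x:E|lebesgue. g x)"
    using g unfolding ac_density_def by blast
  obtain \<mu>' \<sigma>' Z' where D': "deriv_measure unit_cube u \<mu>' \<sigma>'" and Z': "Z' \<in> null_sets lborel"
    and H: "\<And>E. E \<in> sets borel \<Longrightarrow> E \<subseteq> unit_cube \<Longrightarrow> (LINT x:E - Z'|\<mu>'. \<sigma>' x) = (LINT x:E|lebesgue. h x)"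
    using h unfolding ac_density_def by blast
  have Zb: "Z \<in> sets borel" "Z' \<in> sets borel" using Z Z' by (auto simp: null_sets_def)
  have null: "(LINT x:E - N|lebesgue. f x) = (LINT x:E|lebesgue. f x)"
    if "N \<in> null_sets lborel" "E \<in> sets borel" "set_integrable lebesgue unit_cube f" "E \<subseteq> unit_cube"
    for N E and f :: "real^'n \<Rightarrow> real^'n^'d"
    unfolding set_lebesgue_integral_def
  proof (rule integral_cong_AE)
    have N: "N \<in> sets borel" using that(1) by (auto simp: null_sets_def)
    have "AE x in lebesgue. x \<notin> N" using that(1) by (intro AE_not_in null_sets_completionI)
    then show "AE x in lebesgue. indicat_real (E - N) x *\<^sub>R f x = indicat_real E x *\<^sub>R f x"
      by eventually_elim (auto simp: indicator_def)
    have sub: "E - N \<in> sets lebesgue" "E \<in> sets lebesgue" "E - N \<subseteq> unit_cube"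
      using that(2,4) N by auto
    show "(\<lambda>x. indicat_real (E - N) x *\<^sub>R f x) \<in> borel_measurable lebesgue"
      by (rule borel_measurable_integrable[OF set_integrable_subset[OF that(3) sub(1,3), unfolded set_integrable_def]])
    show "(\<lambda>x. indicat_real E x *\<^sub>R f x) \<in> borel_measurable lebesgue"
      by (rule borel_measurable_integrable[OF set_integrable_subset[OF that(3) sub(2) that(4), unfolded set_integrable_def]])
  qed
  show gi: "set_integrable lebesgue unit_cube g" "set_integrable lebesgue unit_cube h"
    using g h by (auto simp: ac_density_def)
  fix E :: "(real^'n) set" assume E: "E \<in> sets borel" "E \<subseteq> unit_cube"
  have "(LINT x:E|lebesgue. g x) = (LINT x:E - Z'|lebesgue. g x)" by (rule null[OF Z' E(1) gi(1) E(2), symmetric])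
  also have "\<dots> = (LINT x:E - Z' - Z|\<mu>. \<sigma> x)" using E Zb by (intro G[symmetric]) auto
  also have "\<dots> = (LINT x:E - Z' - Z|\<mu>'. \<sigma>' x)" using E Zb by (intro deriv_measure_unique[OF D D']) auto
  also have "E - Z' - Z = E - Z - Z'" by auto
  also have "(LINT x:E - Z - Z'|\<mu>'. \<sigma>' x) = (LINT x:E - Z|lebesgue. h x)" using E Zb by (intro H) auto
  also have "\<dots> = (LINT x:E|lebesgue. h x)" by (rule null[OF Z E(1) gi(2) E(2)])
  finally show "(LINT x:E|lebesgue. g x) = (LINT x:E|lebesgue. h x)" .
qed (rule unit_cube_sets)

section \<open>Polar decomposition of a bulk and a surface density\<close>

definition add_measure :: "'a measure \<Rightarrow> 'a measure \<Rightarrow> 'a measure" where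
  "add_measure M N = measure_of (space M) (sets M) (\<lambda>A. emeasure M A + emeasure N A)"

lemma sets_add_measure [simp, measurable_cong]: "sets (add_measure M N) = sets M"
  by (simp add: add_measure_def)

lemma space_add_measure [simp]: "space (add_measure M N) = space M"
  by (simp add: add_measure_def)

lemma emeasure_add_measure:
  assumes "sets M = sets N" "A \<in> sets M"
  shows "emeasure (add_measure M N) A = emeasure M A + emeasure N A"
proof (rule emeasure_measure_of[OF add_measure_def])
  show "countably_additive (sets (add_measure M N)) (\<lambda>A. emeasure M A + emeasure N A)"
  proof (rule countably_additiveI)
    fix F :: "nat \<Rightarrow> 'a set"
    assume F: "range F \<subseteq> sets (add_measure M N)" "disjoint_family F"
    then have "(\<Sum>i. emeasure M (F i) + emeasure N (F i)) = (\<Sum>i. emeasure M (F i)) + (\<Sum>i. emeasure N (F i))"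
      by (intro suminf_add[symmetric]) auto
    also have "\<dots> = emeasure M (\<Union>i. F i) + emeasure N (\<Union>i. F i)"
      using F assms(1) by (simp add: suminf_emeasure)
    finally show "(\<Sum>i. emeasure M (F i) + emeasure N (F i)) = emeasure M (\<Union>i. F i) + emeasure N (\<Union>i. F i)" .
  qed
  show "sets M \<subseteq> Pow (space M)" by (rule sets.space_closed)
qed (use assms in \<open>auto simp: positive_def\<close>)

lemma nn_integral_add_measure:
  assumes s: "sets M = sets N" and f: "f \<in> borel_measurable M"
  shows "(\<integral>\<^sup>+x. f x \<partial>add_measure M N) = (\<integral>\<^sup>+x. f x \<partial>M) + (\<integral>\<^sup>+x. f x \<partial>N)"
  using f
proof (induction rule: borel_measurable_induct)
  case (cong f g)
  have sp: "space N = space M" using sets_eq_imp_space_eq[OF s] by simp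
  have "(\<integral>\<^sup>+x. f x \<partial>L) = (\<integral>\<^sup>+x. g x \<partial>L)" if "space L = space M" for L
    by (rule nn_integral_cong) (use cong(3) that in auto)
  from this[of "add_measure M N"] this[of M] this[of N] cong(4) show ?case by (simp add: sp)
next
  case (set A)
  then show ?case using s by (simp add: emeasure_add_measure)
next
  case (mult u c)
  note s[measurable_cong]
  have [measurable]: "u \<in> borel_measurable N" using mult(2) s by (simp cong: measurable_cong_sets)
  have "u \<in> borel_measurable (add_measure M N)" using mult(2) by (simp cong: measurable_cong_sets)
  then show ?case using mult by (simp add: nn_integral_cmult distrib_left)
next
  case (add u v)
  have "u \<in> borel_measurable N" "v \<in> borel_measurable N"
    "u \<in> borel_measurable (add_measure M N)" "v \<in> borel_measurable (add_measure M N)"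
    using add.hyps s by (simp_all cong: measurable_cong_sets)
  then show ?case using add by (simp add: nn_integral_add ac_simps)
next
  case (seq U)
  have m: "U i \<in> borel_measurable N" "U i \<in> borel_measurable (add_measure M N)" for i
    using seq(1) s by (simp_all cong: measurable_cong_sets)
  have inc: "incseq (\<lambda>i. integral\<^sup>N L (U i))" for L
    using seq(3) by (auto simp: incseq_def le_fun_def intro!: nn_integral_mono)
  have SUP: "(\<integral>\<^sup>+x. (SUP i. U i) x \<partial>L) = (SUP i. integral\<^sup>N L (U i))" if "\<And>i. U i \<in> borel_measurable L" for L
    using nn_integral_monotone_convergence_SUP[OF seq(3) that] by (simp add: image_comp)
  show ?case
    unfolding SUP[OF seq(1)] SUP[OF m(1)] SUP[OF m(2)] seq.IH
    by (rule ennreal_SUP_add[OF inc inc])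
qed

lemma integrable_add_measure:
  fixes f :: "'a \<Rightarrow> 'b::{banach, second_countable_topology}"
  assumes s: "sets M = sets N" and f: "integrable M f" "integrable N f"
  shows "integrable (add_measure M N) f"
proof -
  have m: "f \<in> borel_measurable M" using f(1) by auto
  then have "f \<in> borel_measurable (add_measure M N)" by (simp cong: measurable_cong_sets)
  moreover have "(\<integral>\<^sup>+x. ennreal (norm (f x)) \<partial>add_measure M N) < \<infinity>"
    using f m by (subst nn_integral_add_measure[OF s]) (auto simp: integrable_iff_bounded)
  ultimately show ?thesis by (simp add: integrable_iff_bounded)
qed

lemma integral_add_measure:
  fixes f :: "'a \<Rightarrow> 'b::euclidean_space"
  assumes s: "sets M = sets N" and f: "integrable M f" "integrable N f"
  shows "(\<integral>x. f x \<partial>add_measure M N) = (\<integral>x. f x \<partial>M) + (\<integral>x. f x \<partial>N)"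
proof -
  have real: "(\<integral>x. g x \<partial>add_measure M N) = (\<integral>x. g x \<partial>M) + (\<integral>x. g x \<partial>N)"
    if g: "integrable M g" "integrable N g" for g :: "'a \<Rightarrow> real"
  proof -
    have [measurable]: "g \<in> borel_measurable M" using g(1) by auto
    have fin: "(\<integral>\<^sup>+x. ennreal (g x) \<partial>L) < top" "(\<integral>\<^sup>+x. ennreal (- g x) \<partial>L) < top" if "integrable L g" for L
      using that by (auto simp: real_integrable_def less_top)
    show ?thesis
      using fin[OF g(1)] fin[OF g(2)] integrable_add_measure[OF s g] g
      by (simp add: real_lebesgue_integral_def nn_integral_add_measure[OF s] enn2real_plus)
  qed
  show ?thesis
  proof (rule euclidean_eqI)
    fix b :: 'b assume "b \<in> Basis"
    have "(\<integral>x. f x \<partial>L) \<bullet> b = (\<integral>x. f x \<bullet> b \<partial>L)" if "integrable L f" for L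
      using that by simp
    then show "(\<integral>x. f x \<partial>add_measure M N) \<bullet> b = ((\<integral>x. f x \<partial>M) + (\<integral>x. f x \<partial>N)) \<bullet> b"
      using f integrable_add_measure[OF s f] real[of "\<lambda>x. f x \<bullet> b"] by (simp add: inner_add_left)
  qed
qed

lemma polar_decomposition_exists:
  fixes g h :: "real^'n \<Rightarrow> real^'n^'d"
  assumes [measurable]: "\<Omega> \<in> sets borel" "J \<in> sets borel" "g \<in> borel_measurable borel" "h \<in> borel_measurable borel"
    and J: "J \<in> null_sets lborel" "J \<subseteq> \<Omega>"
    and g: "set_integrable lborel \<Omega> g" and h: "set_integrable surface_measure J h"
  obtains \<mu> \<sigma> where "finite_measure \<mu>" "sets \<mu> = sets borel" "emeasure \<mu> (- \<Omega>) = 0"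
    "\<sigma> \<in> borel_measurable borel" "AE x in \<mu>. norm (\<sigma> x) = 1"
    "\<And>\<phi> B. \<phi> \<in> borel_measurable borel \<Longrightarrow> (\<And>x. x \<in> \<Omega> \<Longrightarrow> \<bar>\<phi> x\<bar> \<le> B) \<Longrightarrow>
      (\<integral>x. \<phi> x *\<^sub>R \<sigma> x \<partial>\<mu>) = (LINT x:\<Omega>|lborel. \<phi> x *\<^sub>R g x) + (LINT x:J|surface_measure. \<phi> x *\<^sub>R h x)"
proof -
  define M where "M = density lborel (indicat_real \<Omega>)"
  define N where "N = density (surface_measure :: (real^'n) measure) (indicat_real J)"
  define \<rho> where "\<rho> x = (if x \<in> J then h x else g x)" for x
  have [measurable_cong, simp]: "sets M = sets borel" "sets N = sets borel" by (simp_all add: M_def N_def)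
  have [measurable]: "\<rho> \<in> borel_measurable borel" unfolding \<rho>_def by measurable
  have AEJ: "AE x in lborel. x \<notin> J" using J(1) by (rule AE_not_in)
  have intM: "integrable M f \<longleftrightarrow> set_integrable lborel \<Omega> f" "(\<integral>x. f x \<partial>M) = (LINT x:\<Omega>|lborel. f x)"
    if "f \<in> borel_measurable borel" for f :: "real^'n \<Rightarrow> real^'n^'d"
    using that by (simp_all add: M_def integrable_density integral_density set_integrable_def set_lebesgue_integral_def)
  have intN: "integrable N f \<longleftrightarrow> set_integrable surface_measure J f" "(\<integral>x. f x \<partial>N) = (LINT x:J|surface_measure. f x)"
    if "f \<in> borel_measurable borel" for f :: "real^'n \<Rightarrow> real^'n^'d"
  proof -
    have "f \<in> borel_measurable surface_measure" "indicat_real J \<in> borel_measurable surface_measure"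
      using that by (auto simp: measurable_cong_sets[OF sets_hausdorff_measure refl])
    then show "integrable N f \<longleftrightarrow> set_integrable surface_measure J f" "(\<integral>x. f x \<partial>N) = (LINT x:J|surface_measure. f x)"
      by (simp_all add: N_def integrable_density integral_density set_integrable_def set_lebesgue_integral_def)
  qed
  have \<rho>M: "set_integrable lborel \<Omega> \<rho>"
    unfolding set_integrable_def
  proof (rule integrable_cong_AE_imp[OF g[unfolded set_integrable_def]])
    show "AE x in lborel. indicat_real \<Omega> x *\<^sub>R g x = indicat_real \<Omega> x *\<^sub>R \<rho> x"
      using AEJ by eventually_elim (simp add: \<rho>_def)
  qed measurable
  have "set_integrable surface_measure J \<rho> \<longleftrightarrow> set_integrable surface_measure J h"
    unfolding set_integrable_def by (rule Bochner_Integration.integrable_cong[OF refl]) (auto simp: \<rho>_def indicator_def)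
  with h have \<rho>N: "set_integrable surface_measure J \<rho>" by simp
  define P where "P = add_measure M N"
  have s: "sets M = sets N" by simp
  have sP[measurable_cong, simp]: "sets P = sets borel" by (simp add: P_def)
  have [simp]: "space P = UNIV" using sets_eq_imp_space_eq[OF sP] by simp
  have intP: "integrable P \<rho>"
    unfolding P_def using \<rho>M \<rho>N by (intro integrable_add_measure[OF s]) (simp_all add: intM(1) intN(1))
  define \<mu> where "\<mu> = density P (\<lambda>x. ennreal (norm (\<rho> x)))"
  define \<sigma> where "\<sigma> x = sgn (\<rho> x)" for x
  have \<sigma>[measurable]: "\<sigma> \<in> borel_measurable borel" unfolding \<sigma>_def sgn_div_norm by measurable
  have sets\<mu>: "sets \<mu> = sets borel" by (simp add: \<mu>_def)
  have "emeasure \<mu> (space \<mu>) = (\<integral>\<^sup>+x. ennreal (norm (\<rho> x)) \<partial>P)"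
    unfolding \<mu>_def by (subst emeasure_density) (auto intro!: nn_integral_cong simp: indicator_def)
  also have "\<dots> < \<infinity>" using intP by (simp add: integrable_iff_bounded)
  finally have fin: "finite_measure \<mu>" by (intro finite_measureI) simp
  have "emeasure M (- \<Omega>) = 0"
    unfolding M_def by (subst emeasure_density) (auto simp: indicator_def nn_integral_0_iff_AE)
  moreover have "emeasure N (- \<Omega>) = 0"
  proof -
    have "indicat_real J x * indicator (- \<Omega>) x = 0" for x using J(2) by (auto simp: indicator_def)
    then show ?thesis
      unfolding N_def using J(2) by (subst emeasure_density) (auto simp: indicator_def nn_integral_0_iff_AE measurable_cong_sets[OF sets_hausdorff_measure refl])
  qed
  ultimately have "emeasure P (- \<Omega>) = 0"
    unfolding P_def by (subst emeasure_add_measure) auto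
  then have "- \<Omega> \<in> null_sets P" by (intro null_setsI) auto
  then have "AE x in P. x \<notin> - \<Omega>" by (rule AE_not_in)
  then have null: "emeasure \<mu> (- \<Omega>) = 0"
    unfolding \<mu>_def by (subst emeasure_density) (auto simp: nn_integral_0_iff_AE indicator_def elim!: AE_mp)
  \<comment> \<open>Where \<rho> vanishes \<open>sgn\<close> gives 0 instead of a unit matrix, but
    the density of \<mu> vanishes there as well.\<close>
  have norm\<sigma>: "AE x in \<mu>. norm (\<sigma> x) = 1"
    unfolding \<mu>_def by (subst AE_density) (auto simp: \<sigma>_def norm_sgn)
  have main: "(\<integral>x. \<phi> x *\<^sub>R \<sigma> x \<partial>\<mu>) = (LINT x:\<Omega>|lborel. \<phi> x *\<^sub>R g x) + (LINT x:J|surface_measure. \<phi> x *\<^sub>R h x)"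
    if \<phi>[measurable]: "\<phi> \<in> borel_measurable borel" and B: "\<And>x. x \<in> \<Omega> \<Longrightarrow> \<bar>\<phi> x\<bar> \<le> B" for \<phi> B
  proof -
    have bound: "norm (indicat_real A x *\<^sub>R \<phi> x *\<^sub>R \<rho> x) \<le> norm (B *\<^sub>R (indicat_real A x *\<^sub>R \<rho> x))" if "A \<subseteq> \<Omega>" for A x
    proof (cases "x \<in> A")
      case True
      then have "\<bar>\<phi> x\<bar> \<le> \<bar>B\<bar>" using B[of x] that by auto
      then show ?thesis using True by (simp add: mult_right_mono)
    qed simp
    have m: "(\<lambda>x. \<phi> x *\<^sub>R \<rho> x) \<in> borel_measurable borel" by measurable
    have iM: "integrable M (\<lambda>x. \<phi> x *\<^sub>R \<rho> x)"
      unfolding intM(1)[OF m] set_integrable_def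
    proof (rule Bochner_Integration.integrable_bound[OF integrable_scaleR_right[OF \<rho>M[unfolded set_integrable_def], of B]])
      show "AE x in lborel. norm (indicat_real \<Omega> x *\<^sub>R \<phi> x *\<^sub>R \<rho> x) \<le> norm (B *\<^sub>R indicat_real \<Omega> x *\<^sub>R \<rho> x)"
        by (intro AE_I2 bound order_refl)
    qed measurable
    have iN: "integrable N (\<lambda>x. \<phi> x *\<^sub>R \<rho> x)"
      unfolding intN(1)[OF m] set_integrable_def
    proof (rule Bochner_Integration.integrable_bound[OF integrable_scaleR_right[OF \<rho>N[unfolded set_integrable_def], of B]])
      show "AE x in surface_measure. norm (indicat_real J x *\<^sub>R \<phi> x *\<^sub>R \<rho> x) \<le> norm (B *\<^sub>R indicat_real J x *\<^sub>R \<rho> x)"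
        by (intro AE_I2 bound J(2))
    qed measurable
    have "(\<integral>x. \<phi> x *\<^sub>R \<sigma> x \<partial>\<mu>) = (\<integral>x. norm (\<rho> x) *\<^sub>R (\<phi> x *\<^sub>R \<sigma> x) \<partial>P)"
      unfolding \<mu>_def by (rule integral_density) auto
    also have "\<dots> = (\<integral>x. \<phi> x *\<^sub>R \<rho> x \<partial>P)"
    proof (rule Bochner_Integration.integral_cong[OF refl])
      fix x
      show "norm (\<rho> x) *\<^sub>R \<phi> x *\<^sub>R \<sigma> x = \<phi> x *\<^sub>R \<rho> x"
        by (cases "\<rho> x = 0") (simp_all add: \<sigma>_def sgn_div_norm)
    qed
    also have "\<dots> = (LINT x:\<Omega>|lborel. \<phi> x *\<^sub>R \<rho> x) + (LINT x:J|surface_measure. \<phi> x *\<^sub>R \<rho> x)"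
      unfolding P_def integral_add_measure[OF s iM iN] intM(2)[OF m] intN(2)[OF m] ..
    also have "(LINT x:\<Omega>|lborel. \<phi> x *\<^sub>R \<rho> x) = (LINT x:\<Omega>|lborel. \<phi> x *\<^sub>R g x)"
      unfolding set_lebesgue_integral_def
    proof (rule integral_cong_AE)
      show "AE x in lborel. indicat_real \<Omega> x *\<^sub>R \<phi> x *\<^sub>R \<rho> x = indicat_real \<Omega> x *\<^sub>R \<phi> x *\<^sub>R g x"
        using AEJ by eventually_elim (simp add: \<rho>_def)
    qed measurable
    also have "(LINT x:J|surface_measure. \<phi> x *\<^sub>R \<rho> x) = (LINT x:J|surface_measure. \<phi> x *\<^sub>R h x)"
      unfolding set_lebesgue_integral_def
      by (rule Bochner_Integration.integral_cong[OF refl]) (auto simp: \<rho>_def indicator_def)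
    finally show ?thesis .
  qed
  show thesis by (rule that[OF fin sets\<mu> null \<sigma> norm\<sigma> main])
qed

section \<open>Jump points\<close>

lemma half_ball_sets [measurable]: "half_ball x r \<nu> \<in> sets borel"
proof -
  have "half_ball x r \<nu> = ball x r \<inter> {y. 0 < (y - x) \<bullet> \<nu>}" by (auto simp: half_ball_def)
  also have "open \<dots>" by (intro open_Int open_ball open_Collect_less continuous_intros)
  finally show ?thesis by (rule borel_open)
qed

lemma emeasure_half_ball_finite: "emeasure lborel (half_ball x r \<nu>) < \<infinity>"
  by (rule emeasure_bounded_finite[OF bounded_subset[OF bounded_ball[of x r]]]) (auto simp: half_ball_def)

lemma measure_half_ball_le:
  assumes "0 \<le> r"
  shows "measure lebesgue (half_ball x r \<nu> :: (real^'n) set) \<le> unit_ball_vol (CARD('n)) * r ^ CARD('n)"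
proof -
  have "measure lborel (half_ball x r \<nu>) \<le> measure lborel (ball x r)"
    using emeasure_bounded_finite[OF bounded_ball, of x r]
    by (intro measure_mono_fmeasurable) (auto simp: half_ball_def fmeasurable_def)
  then show ?thesis using content_ball[OF assms, of x] by simp
qed

lemma LINT_half_ball_le:
  fixes f :: "real^'n \<Rightarrow> real"
  assumes "0 \<le> e" "\<And>y. y \<in> half_ball x r \<nu> \<Longrightarrow> f y \<le> e"
  shows "(LINT y:half_ball x r \<nu>|lebesgue. f y) \<le> e * measure lebesgue (half_ball x r \<nu>)"
proof (cases "set_integrable lebesgue (half_ball x r \<nu>) f")
  case True
  have fin: "emeasure lebesgue (half_ball x r \<nu>) < \<infinity>" using emeasure_half_ball_finite[of x r \<nu>] by simp
  have "(LINT y:half_ball x r \<nu>|lebesgue. f y) \<le> (LINT y:half_ball x r \<nu>|lebesgue. e)"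
    using assms(2) fin by (intro set_integral_mono True) (auto simp: set_integrable_def)
  also have "\<dots> = e * measure lebesgue (half_ball x r \<nu>)"
    by (simp add: set_lebesgue_integral_def)
  finally show ?thesis .
next
  case False
  \<comment> \<open>The integral of a non-integrable function is 0 by convention, and the bound
    survives because \<open>e\<close> is nonnegative.\<close>
  then have "(LINT y:half_ball x r \<nu>|lebesgue. f y) = 0"
    by (simp add: set_lebesgue_integral_def set_integrable_def not_integrable_integral_eq)
  then show ?thesis using assms(1) by simp
qed

lemma one_sided_limitI:
  assumes lim: "(u \<longlongrightarrow> a) (at x within {y. 0 < (y - x) \<bullet> \<nu>})"
  shows "one_sided_limit u x \<nu> a"
  unfolding one_sided_limit_def
proof (rule tendstoI)
  let ?A = "\<lambda>r. (LINT y:half_ball x r \<nu>|lebesgue. norm (u y - a)) / measure lebesgue (half_ball x r \<nu>)"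
  fix e :: real assume e: "0 < e"
  have "eventually (\<lambda>y. dist (u y) a < e / 2) (at x within {y. 0 < (y - x) \<bullet> \<nu>})"
    using tendstoD[OF lim, of "e / 2"] e by simp
  then obtain d where d: "0 < d"
    "\<And>y. 0 < (y - x) \<bullet> \<nu> \<Longrightarrow> y \<noteq> x \<Longrightarrow> dist y x < d \<Longrightarrow> dist (u y) a < e / 2"
    unfolding eventually_at by auto
  have "dist (?A r) 0 < e" if r: "0 < r" "r < d" for r
  proof -
    have "norm (u y - a) \<le> e / 2" if "y \<in> half_ball x r \<nu>" for y
      using d(2)[of y] that r by (cases "y = x") (auto simp: half_ball_def dist_norm norm_minus_commute less_imp_le)
    then have "(LINT y:half_ball x r \<nu>|lebesgue. norm (u y - a)) \<le> e / 2 * measure lebesgue (half_ball x r \<nu>)"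
      using e by (intro LINT_half_ball_le) auto
    moreover have "0 \<le> (LINT y:half_ball x r \<nu>|lebesgue. norm (u y - a))"
      unfolding set_lebesgue_integral_def by (intro Bochner_Integration.integral_nonneg) auto
    \<comment> \<open>If the half ball is null, as for \<nu> = 0, the quotient is 0 by
      convention.\<close>
    ultimately have A: "0 \<le> ?A r" "?A r \<le> e / 2"
      using e by (auto simp: divide_le_eq zero_less_measure_iff)
    have "dist (?A r) 0 = ?A r" using A(1) by (simp only: dist_real_def diff_0_right abs_of_nonneg)
    then show ?thesis using e A(2) by linarith
  qed
  then show "eventually (\<lambda>r. dist (?A r) 0 < e) (at_right 0)"
    using d(1) by (auto simp: eventually_at_right_field)
qed

text \<open>Unless the directions are opposite, the two half spaces overlap in a wedge around the
  bisector \<open>\<nu> + \<nu>'\<close>. A ball centred on the bisector fits in, and by scaling it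
  occupies the same fraction of the volume for every \<open>r\<close>.\<close>

lemma half_ball_contains_ball:
  fixes \<nu> \<nu>' :: "real^'n"
  assumes "norm \<nu> = 1" "norm \<nu>' = 1" "\<nu>' \<noteq> - \<nu>"
  shows "\<exists>z \<rho>. 0 < \<rho> \<and> (\<forall>x r. 0 < r \<longrightarrow> ball (x + r *\<^sub>R z) (r * \<rho>) \<subseteq> half_ball x r \<nu> \<inter> half_ball x r \<nu>')"
proof -
  define w where "w = \<nu> + \<nu>'"
  have nn: "\<nu> \<bullet> \<nu> = 1" "\<nu>' \<bullet> \<nu>' = 1" using assms by (simp_all flip: power2_norm_eq_inner)
  have "w \<noteq> 0" using assms(3) unfolding w_def by (metis add.commute eq_neg_iff_add_eq_0)
  then have "0 < w \<bullet> w" by simp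
  also have "w \<bullet> w = 2 * (1 + \<nu> \<bullet> \<nu>')"
    using nn by (simp add: w_def inner_add_left inner_add_right inner_commute)
  finally have pos: "0 < 1 + \<nu> \<bullet> \<nu>'" by simp
  \<comment> \<open>The distance from \<open>z\<close> to both bounding hyperplanes. The factor 1/4
    in \<open>z\<close> and the bound 1/2 on \<rho> keep the small ball inside the ball of radius
    \<open>r\<close>.\<close>
  define \<kappa> where "\<kappa> = (1 + \<nu> \<bullet> \<nu>') / 4"
  define z where "z = (1/4) *\<^sub>R w"
  define \<rho> where "\<rho> = min \<kappa> (1/2)"
  have \<rho>: "0 < \<rho>" "\<rho> \<le> \<kappa>" "\<rho> \<le> 1/2"
    using pos by (simp_all only: \<rho>_def min.cobounded1 min.cobounded2) (simp add: \<kappa>_def)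
  have z: "z \<bullet> \<nu> = \<kappa>" "z \<bullet> \<nu>' = \<kappa>"
    using nn inner_commute[of \<nu>' \<nu>] by (simp_all add: z_def w_def \<kappa>_def inner_add_left)
  have "norm w \<le> 2" using norm_triangle_ineq[of \<nu> \<nu>'] assms by (simp add: w_def)
  then have nz: "norm z \<le> 1/2" by (simp add: z_def)
  have "ball (x + r *\<^sub>R z) (r * \<rho>) \<subseteq> half_ball x r \<nu> \<inter> half_ball x r \<nu>'" if r: "0 < r" for x r
  proof
    fix y assume "y \<in> ball (x + r *\<^sub>R z) (r * \<rho>)"
    then have y: "norm (y - x - r *\<^sub>R z) < r * \<rho>" by (simp add: dist_norm norm_minus_commute algebra_simps)
    have side: "0 < (y - x) \<bullet> e" if e: "norm e = 1" "z \<bullet> e = \<kappa>" for e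
    proof -
      have "\<bar>(y - x - r *\<^sub>R z) \<bullet> e\<bar> < r * \<rho>"
        using Cauchy_Schwarz_ineq2[of "y - x - r *\<^sub>R z" e] y e by simp
      moreover have "(y - x - r *\<^sub>R z) \<bullet> e = (y - x) \<bullet> e - r * \<kappa>"
        using e by (simp add: inner_diff_left)
      moreover have "r * \<rho> \<le> r * \<kappa>" using r \<rho> by simp
      ultimately show ?thesis by linarith
    qed
    have "norm (y - x) \<le> norm (y - x - r *\<^sub>R z) + norm (r *\<^sub>R z)"
      using norm_triangle_ineq[of "y - x - r *\<^sub>R z" "r *\<^sub>R z"] by simp
    also have "\<dots> < r * (1/2) + r * (1/2)"
    proof -
      have "r * \<rho> \<le> r * (1/2)" using \<rho>(3) r by (intro mult_left_mono) auto
      moreover have "norm (r *\<^sub>R z) \<le> r * (1/2)" using nz r mult_left_mono[of "norm z" "1/2" r] by simp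
      ultimately show ?thesis using y by linarith
    qed
    finally have "norm (y - x) < r" by simp
    then have "y \<in> ball x r" by (simp add: dist_norm norm_minus_commute)
    then show "y \<in> half_ball x r \<nu> \<inter> half_ball x r \<nu>'"
      using side[OF assms(1) z(1)] side[OF assms(2) z(2)] by (simp add: half_ball_def)
  qed
  with \<rho>(1) show ?thesis by blast
qed

text \<open>On the ball common to both half balls \<open>u\<close> is close to \<open>l\<close>, so
  \<open>norm (u y - a)\<close> is at least \<open>e\<close> there, and the average stays above a
  fixed positive number. The local bound on \<open>u\<close> makes the integrand integrable;
  otherwise its integral could be 0 merely by convention.\<close>

lemma one_sided_limit_unique:
  fixes u :: "real^'n \<Rightarrow> real^'d"
  assumes u[measurable]: "u \<in> borel_measurable borel" and bound: "\<forall>y\<in>ball x 1. norm (u y) \<le> B"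
    and \<nu>: "norm \<nu> = 1" "norm \<nu>' = 1" "\<nu>' \<noteq> - \<nu>"
    and lim: "(u \<longlongrightarrow> l) (at x within {y. 0 < (y - x) \<bullet> \<nu>})" and a: "one_sided_limit u x \<nu>' a"
  shows "a = l"
proof (rule ccontr)
  assume "a \<noteq> l"
  define e where "e = dist a l / 2"
  have e: "0 < e" using \<open>a \<noteq> l\<close> by (simp add: e_def)
  obtain z \<rho> where \<rho>: "0 < \<rho>"
    and sub: "\<And>x r. 0 < r \<Longrightarrow> ball (x + r *\<^sub>R z) (r * \<rho>) \<subseteq> half_ball x r \<nu> \<inter> half_ball x r \<nu>'"
    using half_ball_contains_ball[OF \<nu>] by blast
  have "eventually (\<lambda>y. dist (u y) l < e) (at x within {y. 0 < (y - x) \<bullet> \<nu>})"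
    using tendstoD[OF lim e] .
  then obtain d where d: "0 < d"
    "\<And>y. 0 < (y - x) \<bullet> \<nu> \<Longrightarrow> y \<noteq> x \<Longrightarrow> dist y x < d \<Longrightarrow> dist (u y) l < e"
    unfolding eventually_at by auto
  let ?A = "\<lambda>r. (LINT y:half_ball x r \<nu>'|lebesgue. norm (u y - a)) / measure lebesgue (half_ball x r \<nu>')"
  let ?k = "CARD('n)"
  have low: "e * \<rho> ^ ?k \<le> ?A r" if r: "0 < r" "r < d" "r < 1" for r
  proof -
    let ?b = "ball (x + r *\<^sub>R z) (r * \<rho>)"
    have bsub: "?b \<subseteq> half_ball x r \<nu>" "?b \<subseteq> half_ball x r \<nu>'" using sub[OF r(1)] by auto
    have far: "e \<le> norm (u y - a)" if "y \<in> ?b" for y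
    proof -
      have y: "y \<in> half_ball x r \<nu>" using bsub(1) that by auto
      then have "dist (u y) l < e"
        using r by (intro d(2)) (auto simp: half_ball_def dist_commute)
      moreover have "dist a l \<le> dist (u y) a + dist (u y) l" by (rule dist_triangle3)
      ultimately show ?thesis by (simp add: e_def dist_norm)
    qed
    have finb: "emeasure lborel (ball c s) < \<infinity>" for c :: "real^'n" and s by (rule emeasure_bounded_finite[OF bounded_ball])
    have int: "set_integrable lborel (half_ball x r \<nu>') (\<lambda>y. norm (u y - a))"
      unfolding set_integrable_def
    proof (rule integrableI_bounded_set[where A = "ball x r" and B = "B + norm a"])
      show "AE y in lborel. y \<in> ball x r \<longrightarrow> norm (indicat_real (half_ball x r \<nu>') y *\<^sub>R norm (u y - a)) \<le> B + norm a"
      proof (intro AE_I2 impI)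
        fix y assume "y \<in> ball x r"
        then have "norm (u y) \<le> B" using r bound by auto
        then have "norm (u y - a) \<le> B + norm a" using norm_triangle_ineq4[of "u y" a] by simp
        then show "norm (indicat_real (half_ball x r \<nu>') y *\<^sub>R norm (u y - a)) \<le> B + norm a"
          by (auto simp: indicator_def intro: order_trans[OF norm_ge_zero])
      qed
    qed (use finb[of x r] in \<open>auto simp: half_ball_def\<close>)
    have "e * measure lborel ?b = (LINT y:?b|lborel. e)"
      by (simp add: set_lebesgue_integral_def)
    also have "\<dots> \<le> (LINT y:?b|lborel. norm (u y - a))"
      using finb far by (intro set_integral_mono set_integrable_subset[OF int _ bsub(2)]) (auto simp: set_integrable_def)
    also have "\<dots> \<le> (LINT y:half_ball x r \<nu>'|lborel. norm (u y - a))"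
      unfolding set_lebesgue_integral_def
    proof (rule Bochner_Integration.integral_mono)
      show "integrable lborel (\<lambda>y. indicat_real ?b y *\<^sub>R norm (u y - a))"
        using set_integrable_subset[OF int _ bsub(2)] by (simp add: set_integrable_def)
      show "integrable lborel (\<lambda>y. indicat_real (half_ball x r \<nu>') y *\<^sub>R norm (u y - a))"
        using int by (simp add: set_integrable_def)
    qed (use bsub(2) in \<open>auto simp: indicator_def\<close>)
    also have "\<dots> = (LINT y:half_ball x r \<nu>'|lebesgue. norm (u y - a))"
      unfolding set_lebesgue_integral_def by (rule integral_completion[symmetric]) measurable
    finally have I: "e * measure lborel ?b \<le> (LINT y:half_ball x r \<nu>'|lebesgue. norm (u y - a))" .
    have mb: "measure lborel ?b = unit_ball_vol ?k * r ^ ?k * \<rho> ^ ?k"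
      using content_ball[of "r * \<rho>" "x + r *\<^sub>R z"] r \<rho> by (simp add: power_mult_distrib)
    have "0 < measure lborel ?b" unfolding mb using r \<rho> by simp
    also have "\<dots> \<le> measure lborel (half_ball x r \<nu>')"
      using bsub(2) emeasure_half_ball_finite[of x r \<nu>'] by (intro measure_mono_fmeasurable) (auto simp: fmeasurable_def)
    finally have pos: "0 < measure lebesgue (half_ball x r \<nu>')" by simp
    have "e * \<rho> ^ ?k * measure lebesgue (half_ball x r \<nu>') \<le> e * \<rho> ^ ?k * (unit_ball_vol ?k * r ^ ?k)"
      using e \<rho> r by (intro mult_left_mono measure_half_ball_le) auto
    also have "\<dots> \<le> (LINT y:half_ball x r \<nu>'|lebesgue. norm (u y - a))"
      using I unfolding mb by (simp add: mult_ac)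
    finally show ?thesis using pos by (simp add: pos_le_divide_eq)
  qed
  have "eventually (\<lambda>r. e * \<rho> ^ ?k \<le> ?A r) (at_right 0)"
    unfolding eventually_at_right_field using d(1) low by (intro exI[of _ "min d 1"]) auto
  moreover have "(?A \<longlongrightarrow> 0) (at_right 0)" using a by (simp add: one_sided_limit_def)
  ultimately have "e * \<rho> ^ ?k \<le> 0"
    by (intro tendsto_lowerbound[of ?A 0 "at_right 0"]) auto
  moreover have "0 < e * \<rho> ^ ?k" using e \<rho> by simp
  ultimately show False by simp
qed

lemma unit_vector_neq_minus:
  fixes \<nu> :: "'a::real_normed_vector"
  assumes "norm \<nu> = 1"
  shows "\<nu> \<noteq> - \<nu>"
proof
  assume "\<nu> = - \<nu>"
  then have "2 *\<^sub>R \<nu> = 0" by (metis scaleR_2 add.right_inverse)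
  then show False using assms by simp
qed

lemma not_jump_if_continuous:
  fixes u :: "real^'n \<Rightarrow> real^'d"
  assumes "u \<in> borel_measurable borel" "\<forall>y\<in>ball x 1. norm (u y) \<le> B" "isCont u x"
  shows "\<not> is_jump_triple u x a b \<nu>"
proof
  assume j: "is_jump_triple u x a b \<nu>"
  then have \<nu>: "norm \<nu> = 1" "norm (- \<nu>) = 1" by (simp_all add: is_jump_triple_def)
  then have ne: "\<nu> \<noteq> - \<nu>" "- \<nu> \<noteq> - (- \<nu>)" by (auto dest!: unit_vector_neq_minus)
  have lim: "(u \<longlongrightarrow> u x) (at x within S)" for S
    using assms(3) by (auto simp: isCont_def intro: tendsto_within_subset)
  have "a = u x" "b = u x"
    using one_sided_limit_unique[OF assms(1,2) \<nu>(1) \<nu>(1) ne(1) lim, of a]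
      one_sided_limit_unique[OF assms(1,2) \<nu>(2) \<nu>(2) ne(2) lim, of b] j
    by (auto simp: is_jump_triple_def)
  then show False using j by (simp add: is_jump_triple_def)
qed

text \<open>If the normal of a triple were neither \<nu> nor its negative, its positive half space
  would overlap both sides, and its trace there would equal both \<open>p\<close> and
  \<open>q\<close>.\<close>

lemma jump_triple_iff:
  fixes u :: "real^'n \<Rightarrow> real^'d"
  assumes u: "u \<in> borel_measurable borel" "\<forall>y\<in>ball x 1. norm (u y) \<le> B"
    and \<nu>: "norm \<nu> = 1" and p: "(u \<longlongrightarrow> p) (at x within {y. 0 < (y - x) \<bullet> \<nu>})"
    and q: "(u \<longlongrightarrow> q) (at x within {y. 0 < (y - x) \<bullet> (- \<nu>)})" and "p \<noteq> q"
  shows "is_jump_triple u x a b \<nu>' \<longleftrightarrow> (a = p \<and> b = q \<and> \<nu>' = \<nu>) \<or> (a = q \<and> b = p \<and> \<nu>' = - \<nu>)"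
proof
  assume j: "is_jump_triple u x a b \<nu>'"
  then have \<nu>': "norm \<nu>' = 1" "norm (- \<nu>') = 1" by (simp_all add: is_jump_triple_def)
  have \<nu>m: "norm (- \<nu>) = 1" using \<nu> by simp
  have lims: "one_sided_limit u x \<nu>' a" "one_sided_limit u x (- \<nu>') b" using j by (auto simp: is_jump_triple_def)
  have ap: "\<nu>' \<noteq> - \<nu> \<Longrightarrow> a = p" using one_sided_limit_unique[OF u \<nu> \<nu>'(1) _ p lims(1)] by simp
  have aq: "\<nu>' \<noteq> \<nu> \<Longrightarrow> a = q" using one_sided_limit_unique[OF u \<nu>m \<nu>'(1) _ q lims(1)] by simp
  have bp: "\<nu>' \<noteq> \<nu> \<Longrightarrow> b = p" using one_sided_limit_unique[OF u \<nu> \<nu>'(2) _ p lims(2)] by simp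
  have bq: "\<nu>' \<noteq> - \<nu> \<Longrightarrow> b = q"
    using one_sided_limit_unique[OF u \<nu>m \<nu>'(2) _ q lims(2)] by (metis minus_minus)
  show "(a = p \<and> b = q \<and> \<nu>' = \<nu>) \<or> (a = q \<and> b = p \<and> \<nu>' = - \<nu>)"
    using ap aq bp bq \<open>p \<noteq> q\<close> unit_vector_neq_minus[OF \<nu>] by (cases "\<nu>' = \<nu>"; cases "\<nu>' = - \<nu>") simp_all
next
  assume "(a = p \<and> b = q \<and> \<nu>' = \<nu>) \<or> (a = q \<and> b = p \<and> \<nu>' = - \<nu>)"
  then show "is_jump_triple u x a b \<nu>'"
    using one_sided_limitI[OF p] one_sided_limitI[OF q] \<open>p \<noteq> q\<close> \<nu> by (auto simp: is_jump_triple_def)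
qed

lemma is_jump_triple_jump_triple:
  assumes "is_jump_triple u x a b \<nu>"
  obtains a' b' \<nu>' where "jump_triple u x = (a', b', \<nu>')" "is_jump_triple u x a' b' \<nu>'"
    "jump u x = a' - b'" "jump_normal u x = \<nu>'"
proof -
  have "case jump_triple u x of (a, b, \<nu>) \<Rightarrow> is_jump_triple u x a b \<nu>"
    unfolding jump_triple_def by (rule someI[of _ "(a, b, \<nu>)"]) (simp add: assms)
  then show thesis using that by (cases "jump_triple u x") (auto simp: jump_def jump_normal_def)
qed

lemma jump_eq:
  fixes u :: "real^'n \<Rightarrow> real^'d"
  assumes "u \<in> borel_measurable borel" "\<forall>y\<in>ball x 1. norm (u y) \<le> B"
    "norm \<nu> = 1" "(u \<longlongrightarrow> p) (at x within {y. 0 < (y - x) \<bullet> \<nu>})"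
    "(u \<longlongrightarrow> q) (at x within {y. 0 < (y - x) \<bullet> (- \<nu>)})" "p \<noteq> q"
  shows "\<exists>a b \<nu>. is_jump_triple u x a b \<nu>"
    "(jump u x = p - q \<and> jump_normal u x = \<nu>) \<or> (jump u x = - (p - q) \<and> jump_normal u x = - \<nu>)"
proof -
  note iff = jump_triple_iff[OF assms]
  have "is_jump_triple u x p q \<nu>" by (simp add: iff)
  then show "\<exists>a b \<nu>. is_jump_triple u x a b \<nu>" by blast
  from \<open>is_jump_triple u x p q \<nu>\<close> obtain a b \<nu>' where
    "is_jump_triple u x a b \<nu>'" "jump u x = a - b" "jump_normal u x = \<nu>'"
    by (rule is_jump_triple_jump_triple)
  then show "(jump u x = p - q \<and> jump_normal u x = \<nu>) \<or> (jump u x = - (p - q) \<and> jump_normal u x = - \<nu>)"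
    by (auto simp: iff)
qed

section \<open>The staircase functions\<close>

lemma tensor_nth [simp]: "(a \<otimes>\<^sub>t b) $ i $ j = a $ i * b $ j"
  by (simp add: tensor_def)

lemma linear_tensor_right: "linear (\<lambda>v. a \<otimes>\<^sub>t v)"
  by (auto intro!: linearI simp: vec_eq_iff algebra_simps)

lemma bounded_linear_tensor_right: "bounded_linear (\<lambda>v. a \<otimes>\<^sub>t v)"
  using linear_tensor_right by (simp add: linear_conv_bounded_linear)

lemmas tensor_right_simps =
  linear_add[OF linear_tensor_right] linear_diff[OF linear_tensor_right] linear_scale[OF linear_tensor_right]
  linear_neg[OF linear_tensor_right]

lemma tensor_scale_left: "(c *\<^sub>R a) \<otimes>\<^sub>t b = c *\<^sub>R (a \<otimes>\<^sub>t b)"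
  by (simp add: vec_eq_iff)

lemma tensor_diff_left: "(a - a') \<otimes>\<^sub>t b = a \<otimes>\<^sub>t b - a' \<otimes>\<^sub>t b"
  by (simp add: vec_eq_iff algebra_simps)

lemma tensor_minus_minus: "(- a) \<otimes>\<^sub>t (- b) = a \<otimes>\<^sub>t b"
  by (simp add: vec_eq_iff)

lemma norm_tensor: "norm (a \<otimes>\<^sub>t b) = norm a * norm b"
proof -
  have "(norm (a \<otimes>\<^sub>t b))\<^sup>2 = (\<Sum>i\<in>UNIV. \<Sum>j\<in>UNIV. (a $ i * b $ j)\<^sup>2)"
    unfolding power2_norm_eq_inner by (simp add: inner_vec_def power2_eq_square)
  also have "\<dots> = (\<Sum>i\<in>UNIV. (a $ i)\<^sup>2) * (\<Sum>j\<in>UNIV. (b $ j)\<^sup>2)"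
    by (simp add: power_mult_distrib sum_product)
  also have "\<dots> = (norm a * norm b)\<^sup>2"
    unfolding power_mult_distrib power2_norm_eq_inner by (simp add: inner_vec_def power2_eq_square)
  finally show ?thesis by (rule power2_eq_imp_eq) auto
qed

lemma borel_measurable_tensor [measurable]:
  fixes a :: "'a \<Rightarrow> real^'d" and b :: "'a \<Rightarrow> real^'n"
  assumes "a \<in> borel_measurable M" "b \<in> borel_measurable M"
  shows "(\<lambda>x. a x \<otimes>\<^sub>t b x) \<in> borel_measurable M"
proof -
  have "continuous_on UNIV (\<lambda>p. fst p \<otimes>\<^sub>t snd p :: real^'n^'d)"
    unfolding tensor_def by (intro continuous_intros)
  from borel_measurable_continuous_on[OF this borel_measurable_Pair[OF assms]] show ?thesis by simp
qed

lemma bounded_linear_entry: "bounded_linear (\<lambda>A :: real^'n^'d. A $ i $ j)"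
  by (intro bounded_linear_compose[OF bounded_linear_vec_nth bounded_linear_vec_nth])

lemma set_integral_entry:
  fixes f :: "'a \<Rightarrow> real^'n^'d"
  assumes "set_integrable M S f"
  shows "(LINT x:S|M. f x) $ i $ j = (LINT x:S|M. f x $ i $ j)"
  using integral_bounded_linear[OF bounded_linear_entry, of M "\<lambda>x. indicat_real S x *\<^sub>R f x" i j] assms
  by (simp add: set_lebesgue_integral_def set_integrable_def)

lemma set_integral_lebesgue_lborel:
  fixes f :: "'a::euclidean_space \<Rightarrow> 'b::{banach, second_countable_topology}"
  assumes [measurable]: "S \<in> sets borel" "f \<in> borel_measurable borel"
  shows "(LINT x:S|lebesgue. f x) = (LINT x:S|lborel. f x)"
    "set_integrable lebesgue S f \<longleftrightarrow> set_integrable lborel S f"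
proof -
  have m: "(\<lambda>x. indicat_real S x *\<^sub>R f x) \<in> borel_measurable lborel" by measurable
  show "(LINT x:S|lebesgue. f x) = (LINT x:S|lborel. f x)"
    "set_integrable lebesgue S f \<longleftrightarrow> set_integrable lborel S f"
    unfolding set_lebesgue_integral_def set_integrable_def
    by (rule integral_completion[OF m]) (rule integrable_completion[OF m])
qed

lemma set_integrable_cube_bounded:
  fixes f :: "real^'n \<Rightarrow> 'b::{banach, second_countable_topology}"
  assumes [measurable]: "f \<in> borel_measurable borel" and B: "\<And>x. x \<in> unit_cube \<Longrightarrow> norm (f x) \<le> B"
  shows "set_integrable lborel unit_cube f"
  unfolding set_integrable_def
  by (rule integrableI_bounded_set_indicator[where B = B]) (use B in \<open>auto simp: emeasure_unit_cube\<close>)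

lemma continuous_bounded_on_closed_cube:
  fixes f :: "real^'n \<Rightarrow> 'b::real_normed_vector"
  assumes "continuous_on UNIV f"
  obtains B where "\<And>x. x \<in> closed_unit_cube \<Longrightarrow> norm (f x) \<le> B"
proof -
  have "compact (f ` closed_unit_cube)"
    unfolding closed_unit_cube_eq_cbox
    by (rule compact_continuous_image[OF continuous_on_subset[OF assms subset_UNIV] compact_cbox])
  then obtain B where "\<forall>y \<in> f ` closed_unit_cube. norm y \<le> B" using compact_imp_bounded bounded_iff by metis
  then show thesis using that by blast
qed

lemma set_integrable_cube_continuous:
  fixes f :: "real^'n \<Rightarrow> 'b::{banach, second_countable_topology}"
  assumes "continuous_on UNIV f"
  shows "set_integrable lborel unit_cube f"
proof -
  obtain B where "\<And>x. x \<in> closed_unit_cube \<Longrightarrow> norm (f x) \<le> B"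
    using continuous_bounded_on_closed_cube[OF assms] by blast
  then show ?thesis
    using assms unit_cube_subset_closed by (intro set_integrable_cube_bounded[of f B] borel_measurable_continuous_onI) auto
qed

lemma C1_row: "C1_with_gradient (\<lambda>x. (A *v x) $ i) (\<lambda>x. A $ i)"
proof -
  have "(A *v x) $ i = x \<bullet> A $ i" for x
    by (simp add: matrix_vector_mult_def inner_vec_def mult.commute)
  moreover have "((\<lambda>x. x \<bullet> A $ i) has_derivative (\<lambda>h. h \<bullet> A $ i)) (at x)" for x
    by (intro bounded_linear_imp_has_derivative bounded_linear_inner_left)
  ultimately show ?thesis by (simp add: C1_with_gradient_def gderiv_def)
qed

lemma borel_measurable_cube_normal [measurable]: "cube_normal \<in> borel_measurable (borel :: (real^'n) measure)"
proof -
  have "(\<lambda>x :: real^'n. (if \<bar>x $ j\<bar> = 1 / 2 then sgn (x $ j) else 0)) \<in> borel_measurable borel" for j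
  proof -
    have [measurable]: "(\<lambda>x :: real^'n. x $ j) \<in> borel_measurable borel"
      by (intro borel_measurable_continuous_onI continuous_intros)
    \<comment> \<open>On the faces the sign of a coordinate is twice the coordinate, which trades
      \<open>sgn\<close> for a linear function.\<close>
    have "(\<lambda>x :: real^'n. (if \<bar>x $ j\<bar> = 1 / 2 then 2 * x $ j else 0)) \<in> borel_measurable borel" by measurable
    moreover have "(if \<bar>r\<bar> = 1 / 2 then 2 * r else 0) = (if \<bar>r\<bar> = 1 / 2 then sgn r else 0)" for r :: real
      by (auto simp: sgn_if abs_if split: if_splits)
    ultimately show ?thesis by simp
  qed
  then have "(\<lambda>x :: real^'n. \<Sum>j\<in>UNIV. (if \<bar>x $ j\<bar> = 1 / 2 then sgn (x $ j) else 0) *\<^sub>R axis j (1::real)) \<in> borel_measurable borel"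
    by (intro borel_measurable_sum borel_measurable_scaleR) auto
  moreover have "(\<Sum>j\<in>UNIV. (if \<bar>x $ j\<bar> = 1 / 2 then sgn (x $ j) else 0) *\<^sub>R axis j (1::real)) = cube_normal x" for x :: "real^'n"
    by (simp add: vec_eq_iff cube_normal_def axis_def if_distrib[of "\<lambda>c. _ * c"] cong: if_cong)
  ultimately show ?thesis by (simp only:)
qed

lemma norm_cube_normal: "norm (cube_normal (x :: real^'n)) \<le> CARD('n)"
proof -
  have "norm (cube_normal x) \<le> (\<Sum>i\<in>UNIV. \<bar>cube_normal x $ i\<bar>)" by (rule norm_le_l1_cart)
  also have "\<dots> \<le> (\<Sum>i\<in>(UNIV::'n set). 1)"
    by (rule sum_mono) (simp add: cube_normal_def abs_sgn_eq)
  finally show ?thesis by simp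
qed

lemma continuous_on_matrix_vector: "continuous_on S (\<lambda>x. A *v x)" for A :: "real^'n^'d"
  by (intro linear_continuous_on matrix_vector_mul_bounded_linear)

lemma set_integrable_frontier_affine:
  fixes A :: "real^'n^'d"
  assumes "continuous_on UNIV \<phi>"
  shows "set_integrable surface_measure (frontier unit_cube) (\<lambda>x. \<phi> x *\<^sub>R ((A *v x) \<otimes>\<^sub>t cube_normal x))"
proof -
  have [measurable]: "\<phi> \<in> borel_measurable borel" "(\<lambda>x. A *v x) \<in> borel_measurable borel"
    by (intro borel_measurable_continuous_onI assms continuous_on_matrix_vector)+
  obtain B where B: "\<And>x. x \<in> closed_unit_cube \<Longrightarrow> norm (\<phi> x *\<^sub>R (A *v x)) \<le> B"
    using continuous_bounded_on_closed_cube[of "\<lambda>x. \<phi> x *\<^sub>R (A *v x)"] assms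
    by (metis continuous_on_matrix_vector continuous_on_scaleR)
  show ?thesis
  proof (rule set_integrable_surface_cube_frontier)
    fix x :: "real^'n" assume x: "x \<in> closed_unit_cube"
    have "norm (\<phi> x *\<^sub>R ((A *v x) \<otimes>\<^sub>t cube_normal x)) = norm (\<phi> x *\<^sub>R (A *v x)) * norm (cube_normal x)"
      by (simp add: norm_tensor)
    also have "\<dots> \<le> B * CARD('n)"
      by (rule mult_mono[OF B[OF x] norm_cube_normal order_trans[OF norm_ge_zero B[OF x]] norm_ge_zero])
    finally show "norm (\<phi> x *\<^sub>R ((A *v x) \<otimes>\<^sub>t cube_normal x)) \<le> B * CARD('n)" .
  qed measurable
qed

text \<open>The divergence theorem applied to the products of \<phi> with the components of
  \<open>A *v x\<close>. It provides the boundary term of the competitor, and with \<phi> = 1 it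
  evaluates the total derivative prescribed by the trace.\<close>

lemma affine_gauss_green:
  fixes A :: "real^'n^'d"
  assumes C1: "C1_with_gradient \<phi> d\<phi>"
  shows "(LINT x:unit_cube|lborel. (A *v x) \<otimes>\<^sub>t d\<phi> x) =
     - (LINT x:unit_cube|lborel. \<phi> x *\<^sub>R A)
     + (LINT x:frontier unit_cube|surface_measure. \<phi> x *\<^sub>R ((A *v x) \<otimes>\<^sub>t cube_normal x))"
proof -
  note c = C1_continuous[OF C1]
  have int1: "set_integrable lborel unit_cube (\<lambda>x. (A *v x) \<otimes>\<^sub>t d\<phi> x)"
    by (rule set_integrable_cube_continuous, unfold tensor_def)
       (intro continuous_intros c continuous_on_matrix_vector)
  have int2: "set_integrable lborel unit_cube (\<lambda>x. \<phi> x *\<^sub>R A)"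
    by (rule set_integrable_cube_continuous) (intro continuous_intros c)
  note int3 = set_integrable_frontier_affine[OF c(1), of A]
  show ?thesis
    unfolding vec_eq_iff
  proof (intro allI)
    fix i j
    have "C1_with_gradient (\<lambda>x. (A *v x) $ i * \<phi> x) (\<lambda>x. (A *v x) $ i *\<^sub>R d\<phi> x + \<phi> x *\<^sub>R A $ i)"
      by (rule C1_mult[OF C1_row C1])
    from cube_gauss_green[OF this, of j]
    have "(LINT x:unit_cube|lborel. (A *v x) $ i * d\<phi> x $ j + \<phi> x * A $ i $ j)
        = (LINT x:frontier unit_cube|surface_measure. (A *v x) $ i * \<phi> x * cube_normal x $ j)"
      by simp
    moreover have "(LINT x:unit_cube|lborel. (A *v x) $ i * d\<phi> x $ j + \<phi> x * A $ i $ j)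
        = (LINT x:unit_cube|lborel. (A *v x) $ i * d\<phi> x $ j) + (LINT x:unit_cube|lborel. \<phi> x * A $ i $ j)"
      by (intro set_integral_add set_integrable_cube_continuous continuous_intros c continuous_on_matrix_vector)
    ultimately show "(LINT x:unit_cube|lborel. (A *v x) \<otimes>\<^sub>t d\<phi> x) $ i $ j =
      (- (LINT x:unit_cube|lborel. \<phi> x *\<^sub>R A)
       + (LINT x:frontier unit_cube|surface_measure. \<phi> x *\<^sub>R ((A *v x) \<otimes>\<^sub>t cube_normal x))) $ i $ j"
      by (simp add: set_integral_entry[OF int1] set_integral_entry[OF int2] set_integral_entry[OF int3]
          mult_ac del: One_nat_def)
  qed
qed

section \<open>One-sided limits of the sawtooth\<close>

lemma saw_eq:
  assumes "0 < k" "of_int j \<le> real k * r" "real k * r < of_int j + 1"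
  shows "saw k r = r - of_int j / real k"
proof -
  have "\<lfloor>real k * r\<rfloor> = j" using assms(2,3) by (intro floor_unique) auto
  then show ?thesis using assms(1) by (simp add: saw_def frac_def field_simps)
qed

lemma isCont_saw:
  assumes k: "0 < k" and r: "real k * r \<notin> \<int>"
  shows "isCont (saw k) r"
proof -
  define j where "j = \<lfloor>real k * r\<rfloor>"
  let ?S = "{of_int j / real k<..<(of_int j + 1) / real k}"
  have "of_int j \<noteq> real k * r" using r by (metis Ints_of_int)
  then have "of_int j < real k * r" "real k * r < of_int j + 1" unfolding j_def by linarith+
  then have "r \<in> ?S" using k by (simp add: field_simps)
  then have "eventually (\<lambda>r. r \<in> ?S) (nhds r)" by (intro eventually_nhds_in_open) auto
  then have "eventually (\<lambda>r. saw k r = r - of_int j / real k) (nhds r)"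
    by eventually_elim (rule saw_eq, use k in \<open>auto simp: field_simps\<close>)
  moreover have "isCont (\<lambda>r. r - of_int j / real k) r" by (intro continuous_intros)
  ultimately show ?thesis by (simp add: isCont_cong)
qed

lemma tendsto_saw_right:
  assumes k: "0 < k"
  shows "(saw k \<longlongrightarrow> 0) (at_right (of_int i / real k))"
proof -
  have "eventually (\<lambda>r. r \<in> {of_int i / real k<..<(of_int i + 1) / real k}) (at_right (of_int i / real k))"
    using k by (intro eventually_at_right_real) (simp add: divide_strict_right_mono)
  then have "eventually (\<lambda>r. r - of_int i / real k = saw k r) (at_right (of_int i / real k))"
    by eventually_elim (rule saw_eq[symmetric], use k in \<open>auto simp: field_simps\<close>)
  moreover have "((\<lambda>r. r - of_int i / real k) \<longlongrightarrow> of_int i / real k - of_int i / real k) (at_right (of_int i / real k))"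
    by (intro tendsto_intros)
  ultimately show ?thesis by (simp add: Lim_transform_eventually)
qed

lemma tendsto_saw_left:
  assumes k: "0 < k"
  shows "(saw k \<longlongrightarrow> 1 / real k) (at_left (of_int i / real k))"
proof -
  let ?j = "i - 1"
  have "eventually (\<lambda>r. r \<in> {of_int ?j / real k<..<of_int i / real k}) (at_left (of_int i / real k))"
    using k by (intro eventually_at_left_real) (simp add: divide_strict_right_mono)
  then have "eventually (\<lambda>r. r - of_int ?j / real k = saw k r) (at_left (of_int i / real k))"
    by eventually_elim (rule saw_eq[symmetric], use k in \<open>auto simp: field_simps\<close>)
  moreover have "((\<lambda>r. r - of_int ?j / real k) \<longlongrightarrow> of_int i / real k - of_int ?j / real k) (at_left (of_int i / real k))"
    by (intro tendsto_intros)
  ultimately have "(saw k \<longlongrightarrow> of_int i / real k - of_int ?j / real k) (at_left (of_int i / real k))"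
    by (rule Lim_transform_eventually[rotated])
  moreover have "of_int i / real k - of_int ?j / real k = 1 / real k" using k by (simp add: field_simps)
  ultimately show ?thesis by simp
qed

text \<open>Turns left and right limits of a function of \<open>x \<bullet> \<nu>\<close> into
  limits from the two half spaces that define jump points.\<close>

lemma filterlim_inner_at_right:
  assumes "x \<bullet> \<nu> = (s::real)"
  shows "filterlim (\<lambda>y. y \<bullet> \<nu>) (at_right s) (at x within {y. 0 < (y - x) \<bullet> \<nu>})"
    "filterlim (\<lambda>y. y \<bullet> \<nu>) (at_left s) (at x within {y. 0 < (y - x) \<bullet> (- \<nu>)})"
proof -
  have lim: "((\<lambda>y. y \<bullet> \<nu>) \<longlongrightarrow> s) (at x within S)" for S
    using assms by (auto intro!: tendsto_eq_intros)
  show "filterlim (\<lambda>y. y \<bullet> \<nu>) (at_right s) (at x within {y. 0 < (y - x) \<bullet> \<nu>})"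
    "filterlim (\<lambda>y. y \<bullet> \<nu>) (at_left s) (at x within {y. 0 < (y - x) \<bullet> (- \<nu>)})"
    unfolding filterlim_at using lim assms
    by (auto simp: eventually_at_filter inner_diff_left intro!: always_eventually)
qed

lemma set_integral_bounded_linear:
  assumes T: "bounded_linear T" and f: "set_integrable M S f"
  shows "(LINT x:S|M. T (f x)) = T (LINT x:S|M. f x)" "set_integrable M S (\<lambda>x. T (f x))"
proof -
  interpret bounded_linear T by fact
  show "(LINT x:S|M. T (f x)) = T (LINT x:S|M. f x)" "set_integrable M S (\<lambda>x. T (f x))"
    using integral_bounded_linear[OF T f[unfolded set_integrable_def]]
      integrable_bounded_linear[OF T f[unfolded set_integrable_def]]
    by (simp_all add: set_lebesgue_integral_def set_integrable_def scaleR)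
qed

section \<open>The competitor and its Gauss-Green formula\<close>

text \<open>Positivity of \<eta> inside the cube makes every point of the hyperplane pieces a
  genuine jump point, and its vanishing outside gives the boundary values. The amplitude
  \<open>s\<close> and the frequency \<open>k\<close> stay free: \<open>s\<close> can only be chosen
  once the mean of the sawtooth part is known.\<close>

locale staircase =
  fixes A :: "real^'n^'d" and \<xi> :: "real^'d" and \<nu> :: "real^'n"
    and \<eta> :: "real^'n \<Rightarrow> real" and d\<eta> :: "real^'n \<Rightarrow> real^'n" and s :: real and k :: nat
  assumes \<nu>: "norm \<nu> = 1" and \<xi>: "\<xi> \<noteq> 0" and s: "0 < s" and k: "0 < k"
    and C1\<eta>: "C1_with_gradient \<eta> d\<eta>" and \<eta>_nonneg: "\<And>x. 0 \<le> \<eta> x" and \<eta>_le: "\<And>x. \<eta> x \<le> 1"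
    and \<eta>_eq_0: "\<And>x. \<eta> x = 0 \<longleftrightarrow> x \<notin> unit_cube"
begin

definition u :: "real^'n \<Rightarrow> real^'d" where
  "u x = A *v x - (s * \<eta> x * saw k (x \<bullet> \<nu>)) *\<^sub>R \<xi>"

text \<open>The absolutely continuous part of the gradient of
  \<open>\<eta> x * saw k (x \<bullet> \<nu>)\<close>, by the product rule with slope 1 for the
  sawtooth.\<close>

definition v :: "real^'n \<Rightarrow> real^'n" where
  "v x = saw k (x \<bullet> \<nu>) *\<^sub>R d\<eta> x + \<eta> x *\<^sub>R \<nu>"

definition g :: "real^'n \<Rightarrow> real^'n^'d" where
  "g x = A - s *\<^sub>R (\<xi> \<otimes>\<^sub>t v x)"

text \<open>The sawtooth drops by \<open>1/k\<close> across each hyperplane and enters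
  \<open>u\<close> with a minus sign, so \<open>u\<close> jumps by a positive multiple of
  \<xi>.\<close>

definition h :: "real^'n \<Rightarrow> real^'n^'d" where
  "h x = (s * \<eta> x / real k) *\<^sub>R (\<xi> \<otimes>\<^sub>t \<nu>)"

definition P :: "int \<Rightarrow> (real^'n) set" where
  "P i = {x. x \<bullet> \<nu> = of_int i / real k}"

text \<open>On the cube \<open>\<bar>x \<bullet> \<nu>\<bar> \<le> norm x \<le> CARD('n)\<close>, so
  only indices up to \<open>k * CARD('n)\<close> give hyperplanes that meet it; adding 1 makes the
  bound strict.\<close>

definition K :: int where
  "K = int (k * CARD('n) + 1)"

definition J :: "(real^'n) set" where
  "J = unit_cube \<inter> (\<Union>i\<in>{-K..K}. P i)"

text \<open>The mean of \<open>v\<close> turns out to be \<open>S *\<^sub>R \<nu>\<close>, so the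
  mean gradient of \<open>u\<close> is \<open>A\<close> minus \<open>s * S\<close> times \<xi>
  \<otimes> \<nu>. Since \<open>S\<close> does not involve \<open>s\<close>, that equation can be
  solved for \<open>s\<close>.\<close>

definition S :: real where
  "S = (\<Sum>i\<in>{-K..K}. LINT x:P i|surface_measure. \<eta> x) / real k"

lemmas c\<eta> = C1_continuous[OF C1\<eta>]
declare c\<eta>(3,4)[measurable]

lemma K_gt: "real k * real CARD('n) < real_of_int K"
  by (simp add: K_def)

lemma norm_unit_cube: "(x :: real^'n) \<in> unit_cube \<Longrightarrow> norm x \<le> CARD('n)"
  by (rule norm_closed_unit_cube[OF subsetD[OF unit_cube_subset_closed]])

lemma \<eta>_supp: "CARD('n) < norm (x :: real^'n) \<Longrightarrow> \<eta> x = 0"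
  using norm_unit_cube[of x] by (auto simp: \<eta>_eq_0)

text \<open>Off the cube \<eta> attains its minimum 0, so its gradient vanishes there, also on the
  boundary of the cube.\<close>

lemma d\<eta>_eq_0:
  assumes "x \<notin> unit_cube"
  shows "d\<eta> x = 0"
proof -
  have "(\<eta> has_derivative (\<lambda>y. y \<bullet> d\<eta> x)) (at x)"
    using C1\<eta> by (simp add: C1_with_gradient_def gderiv_def)
  moreover have "\<forall>y\<in>UNIV. \<eta> x \<le> \<eta> y" using assms \<eta>_nonneg by (simp add: \<eta>_eq_0[THEN iffD2])
  ultimately have "(\<lambda>y. y \<bullet> d\<eta> x) = (\<lambda>v. 0)"
    by (intro differential_zero_maxmin[of x UNIV]) auto
  then show ?thesis by (metis inner_eq_zero_iff)
qed

lemma P_sets [measurable]: "P i \<in> sets borel"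
  unfolding P_def by measurable

lemma J_sets [measurable]: "J \<in> sets borel"
  unfolding J_def by measurable

lemma J_subset: "J \<subseteq> unit_cube"
  by (auto simp: J_def)

lemma mem_J_iff:
  assumes x: "x \<in> unit_cube"
  shows "x \<in> J \<longleftrightarrow> real k * (x \<bullet> \<nu>) \<in> \<int>"
proof
  assume "x \<in> J"
  then obtain i where "x \<bullet> \<nu> = of_int i / real k" by (auto simp: J_def P_def)
  then have "real k * (x \<bullet> \<nu>) = of_int i" using k by simp
  then show "real k * (x \<bullet> \<nu>) \<in> \<int>" by simp
next
  assume "real k * (x \<bullet> \<nu>) \<in> \<int>"
  then obtain i where i: "real k * (x \<bullet> \<nu>) = of_int i" by (auto elim: Ints_cases)
  have "\<bar>x \<bullet> \<nu>\<bar> \<le> CARD('n)"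
    using Cauchy_Schwarz_ineq2[of x \<nu>] norm_unit_cube[OF x] \<nu> by simp
  then have "\<bar>real k * (x \<bullet> \<nu>)\<bar> \<le> real k * CARD('n)" by (simp add: abs_mult mult_left_mono)
  then have "\<bar>real_of_int i\<bar> < real_of_int K" using K_gt unfolding i by linarith
  then have "\<bar>i\<bar> < K" by (simp flip: of_int_abs)
  then have "i \<in> {-K..K}" by auto
  moreover have "x \<in> P i" using i k by (simp add: P_def field_simps)
  ultimately show "x \<in> J" using x by (auto simp: J_def)
qed

lemma null_J: "J \<in> null_sets lborel"
proof -
  have "negligible (P i)" for i
  proof -
    have "\<nu> \<noteq> 0" using \<nu> by auto
    then show ?thesis unfolding P_def inner_commute[of _ \<nu>] by (intro negligible_hyperplane) simp
  qed
  then have "negligible (\<Union>i\<in>{-K..K}. P i)" by (intro negligible_Union) auto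
  then have "negligible J" by (rule negligible_subset) (auto simp: J_def)
  then show ?thesis using J_sets by (simp add: negligible_iff_null_sets null_sets_completion_iff)
qed

text \<open>Since \<open>f\<close> vanishes off the cube, entire hyperplanes may replace their
  pieces in the cube, and these hyperplanes are disjoint.\<close>

lemma surface_integral_J:
  fixes f :: "real^'n \<Rightarrow> 'b::{banach, second_countable_topology}"
  assumes [measurable]: "f \<in> borel_measurable borel" and f0: "\<And>x. x \<notin> unit_cube \<Longrightarrow> f x = 0"
    and B: "\<And>x. x \<in> unit_cube \<Longrightarrow> norm (f x) \<le> B"
  shows "set_integrable surface_measure J f"
    "(LINT x:J|surface_measure. f x) = (\<Sum>i\<in>{-K..K}. LINT x:P i|surface_measure. f x)"
proof -
  have "bounded (unit_cube :: (real^'n) set)" using norm_unit_cube by (auto simp: bounded_iff)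
  then have "set_integrable surface_measure (unit_cube \<inter> P i) f" for i
    unfolding P_def using B by (intro set_integrable_surface_hyperplane[OF \<nu>]) auto
  moreover have "indicat_real (unit_cube \<inter> P i) x *\<^sub>R f x = indicat_real (P i) x *\<^sub>R f x" for i x
    using f0[of x] by (auto simp: indicator_def)
  ultimately have int: "integrable surface_measure (\<lambda>x. indicat_real (P i) x *\<^sub>R f x)" for i
    unfolding set_integrable_def by (simp only:)
  have "disjoint_family_on P {-K..K}" using k by (auto simp: disjoint_family_on_def P_def)
  then have "indicat_real (\<Union>i\<in>{-K..K}. P i) x = (\<Sum>i\<in>{-K..K}. indicat_real (P i) x)" for x
    by (intro indicator_UN_disjoint) auto
  moreover have "indicat_real J x *\<^sub>R f x = indicat_real (\<Union>i\<in>{-K..K}. P i) x *\<^sub>R f x" for x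
    using f0[of x] by (auto simp: indicator_def J_def)
  ultimately have eq: "indicat_real J x *\<^sub>R f x = (\<Sum>i\<in>{-K..K}. indicat_real (P i) x *\<^sub>R f x)" for x
    by (simp only: scaleR_left.sum)
  show "set_integrable surface_measure J f"
    unfolding set_integrable_def eq by (intro Bochner_Integration.integrable_sum int)
  show "(LINT x:J|surface_measure. f x) = (\<Sum>i\<in>{-K..K}. LINT x:P i|surface_measure. f x)"
    unfolding set_lebesgue_integral_def eq by (intro Bochner_Integration.integral_sum int)
qed

lemma saw_le_1: "\<bar>saw k r\<bar> \<le> 1"
proof -
  have "1 / real k \<le> 1" using k by simp
  then show ?thesis using saw_nonneg[of k r] saw_le[of k r] by linarith
qed

lemma set_integrable_saw:
  fixes f :: "real^'n \<Rightarrow> 'b::{banach, second_countable_topology}"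
  assumes "continuous_on UNIV f"
  shows "set_integrable lborel unit_cube (\<lambda>x. saw k (x \<bullet> \<nu>) *\<^sub>R f x)"
proof -
  have [measurable]: "f \<in> borel_measurable borel" by (rule borel_measurable_continuous_onI[OF assms])
  obtain B where B: "\<And>x. x \<in> closed_unit_cube \<Longrightarrow> norm (f x) \<le> B"
    using continuous_bounded_on_closed_cube[OF assms] by blast
  show ?thesis
  proof (rule set_integrable_cube_bounded)
    fix x :: "real^'n" assume "x \<in> unit_cube"
    then have "norm (f x) \<le> B" using B unit_cube_subset_closed by blast
    then show "norm (saw k (x \<bullet> \<nu>) *\<^sub>R f x) \<le> B"
      using mult_mono[OF saw_le_1 _ zero_le_one norm_ge_zero, of "f x" B "x \<bullet> \<nu>"] by simp
  qed measurable
qed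

lemma LINT_unit_cube:
  assumes "\<And>x. x \<notin> unit_cube \<Longrightarrow> f x = 0"
  shows "(LINT x:unit_cube|lborel. f x) = (\<integral>x. f x \<partial>lborel)"
proof -
  have "indicat_real unit_cube x *\<^sub>R f x = f x" for x using assms[of x] by (auto simp: indicator_def)
  then show ?thesis by (simp add: set_lebesgue_integral_def)
qed

lemma set_integrable_v:
  assumes "continuous_on UNIV \<phi>"
  shows "set_integrable lborel unit_cube (\<lambda>x. \<phi> x *\<^sub>R v x)"
proof -
  have "set_integrable lborel unit_cube (\<lambda>x. saw k (x \<bullet> \<nu>) *\<^sub>R (\<phi> x *\<^sub>R d\<eta> x) + (\<phi> x * \<eta> x) *\<^sub>R \<nu>)"
    by (intro set_integral_add(1) set_integrable_saw set_integrable_cube_continuous continuous_intros c\<eta> assms)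
  then show ?thesis by (simp add: v_def algebra_simps)
qed

text \<open>\<open>saw_gauss_green\<close> is applied to \<phi> times \<eta>, whose support is
  bounded whatever \<phi> does. Hence no boundary term appears even for \<phi> that do not vanish on
  the boundary, as the trace requires.\<close>

lemma saw_part_gauss_green:
  assumes C1: "C1_with_gradient \<phi> d\<phi>"
  shows "(LINT x:unit_cube|lborel. (\<eta> x * saw k (x \<bullet> \<nu>)) *\<^sub>R d\<phi> x) =
     ((LINT x:J|surface_measure. \<phi> x * \<eta> x) / real k) *\<^sub>R \<nu> - (LINT x:unit_cube|lborel. \<phi> x *\<^sub>R v x)"
proof -
  note c = C1_continuous[OF C1]
  note [measurable] = c(3,4)
  let ?d = "\<lambda>x. \<phi> x *\<^sub>R d\<eta> x + \<eta> x *\<^sub>R d\<phi> x"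
  have "(\<integral>x. saw k (x \<bullet> \<nu>) *\<^sub>R ?d x \<partial>lborel) =
     ((\<Sum>i\<in>{-K..K}. LINT x:P i|surface_measure. \<phi> x * \<eta> x) / real k - (\<integral>x. \<phi> x * \<eta> x \<partial>lborel)) *\<^sub>R \<nu>"
    unfolding P_def
    by (rule saw_gauss_green(1)[OF \<nu> C1_mult[OF C1 C1\<eta>] _ k K_gt]) (simp add: \<eta>_supp)
  moreover have "(\<integral>x. saw k (x \<bullet> \<nu>) *\<^sub>R ?d x \<partial>lborel) = (LINT x:unit_cube|lborel. saw k (x \<bullet> \<nu>) *\<^sub>R ?d x)"
    by (rule LINT_unit_cube[symmetric]) (simp add: d\<eta>_eq_0 \<eta>_eq_0[THEN iffD2])
  moreover have "(\<integral>x. \<phi> x * \<eta> x \<partial>lborel) = (LINT x:unit_cube|lborel. \<phi> x * \<eta> x)"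
    by (rule LINT_unit_cube[symmetric]) (simp add: \<eta>_eq_0[THEN iffD2])
  moreover have "(LINT x:unit_cube|lborel. saw k (x \<bullet> \<nu>) *\<^sub>R ?d x)
      = (LINT x:unit_cube|lborel. saw k (x \<bullet> \<nu>) *\<^sub>R (\<phi> x *\<^sub>R d\<eta> x)) + (LINT x:unit_cube|lborel. saw k (x \<bullet> \<nu>) *\<^sub>R (\<eta> x *\<^sub>R d\<phi> x))"
    unfolding scaleR_add_right
    by (intro set_integral_add(2) set_integrable_saw continuous_intros c\<eta> c)
  moreover have "(LINT x:unit_cube|lborel. \<phi> x *\<^sub>R v x)
      = (LINT x:unit_cube|lborel. saw k (x \<bullet> \<nu>) *\<^sub>R (\<phi> x *\<^sub>R d\<eta> x)) + (LINT x:unit_cube|lborel. (\<phi> x * \<eta> x) *\<^sub>R \<nu>)"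
  proof -
    have "\<phi> x *\<^sub>R v x = saw k (x \<bullet> \<nu>) *\<^sub>R (\<phi> x *\<^sub>R d\<eta> x) + (\<phi> x * \<eta> x) *\<^sub>R \<nu>" for x
      by (simp add: v_def algebra_simps)
    then show ?thesis
      by (simp only:) (intro set_integral_add(2) set_integrable_saw set_integrable_cube_continuous continuous_intros c\<eta> c)
  qed
  moreover have "(LINT x:unit_cube|lborel. (\<phi> x * \<eta> x) *\<^sub>R \<nu>) = (LINT x:unit_cube|lborel. \<phi> x * \<eta> x) *\<^sub>R \<nu>"
    by (rule set_integral_bounded_linear(1)[OF bounded_linear_scaleR_left])
       (intro set_integrable_cube_continuous continuous_intros c\<eta> c)
  moreover have "(LINT x:J|surface_measure. \<phi> x * \<eta> x) = (\<Sum>i\<in>{-K..K}. LINT x:P i|surface_measure. \<phi> x * \<eta> x)"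
  proof -
    have "continuous_on UNIV (\<lambda>x. \<phi> x * \<eta> x)" by (intro continuous_intros c\<eta> c)
    then obtain B where "\<And>x. x \<in> closed_unit_cube \<Longrightarrow> norm (\<phi> x * \<eta> x) \<le> B"
      by (rule continuous_bounded_on_closed_cube) blast
    then show ?thesis
      using unit_cube_subset_closed by (intro surface_integral_J(2)[where B = B]) (auto simp: \<eta>_eq_0[THEN iffD2])
  qed
  moreover have "(LINT x:unit_cube|lborel. saw k (x \<bullet> \<nu>) *\<^sub>R (\<eta> x *\<^sub>R d\<phi> x)) = (LINT x:unit_cube|lborel. (\<eta> x * saw k (x \<bullet> \<nu>)) *\<^sub>R d\<phi> x)"
    by (simp add: mult.commute)
  ultimately show ?thesis by (simp add: algebra_simps)
qed

lemma set_integrable_g: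
  assumes "continuous_on UNIV \<phi>"
  shows "set_integrable lborel unit_cube (\<lambda>x. \<phi> x *\<^sub>R g x)"
    "(LINT x:unit_cube|lborel. \<phi> x *\<^sub>R g x) = (LINT x:unit_cube|lborel. \<phi> x *\<^sub>R A)
       - s *\<^sub>R (\<xi> \<otimes>\<^sub>t (LINT x:unit_cube|lborel. \<phi> x *\<^sub>R v x))"
proof -
  have bl: "bounded_linear (\<lambda>w. s *\<^sub>R (\<xi> \<otimes>\<^sub>t w))"
    by (intro bounded_linear_compose[OF bounded_linear_scaleR_right bounded_linear_tensor_right])
  note T = set_integral_bounded_linear[OF bl set_integrable_v[OF assms]]
  have eq: "\<phi> x *\<^sub>R g x = \<phi> x *\<^sub>R A - s *\<^sub>R (\<xi> \<otimes>\<^sub>t (\<phi> x *\<^sub>R v x))" for x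
    by (simp add: g_def tensor_right_simps algebra_simps)
  have A: "set_integrable lborel unit_cube (\<lambda>x. \<phi> x *\<^sub>R A)"
    by (intro set_integrable_cube_continuous continuous_intros assms)
  show "set_integrable lborel unit_cube (\<lambda>x. \<phi> x *\<^sub>R g x)"
    unfolding eq by (intro set_integral_diff(1) A T(2))
  show "(LINT x:unit_cube|lborel. \<phi> x *\<^sub>R g x) = (LINT x:unit_cube|lborel. \<phi> x *\<^sub>R A)
       - s *\<^sub>R (\<xi> \<otimes>\<^sub>t (LINT x:unit_cube|lborel. \<phi> x *\<^sub>R v x))"
    unfolding eq set_integral_diff(2)[OF A T(2)] T(1) ..
qed

lemma set_integrable_h:
  "set_integrable surface_measure J h"
  unfolding h_def[abs_def]
proof (rule surface_integral_J(1))
  fix x :: "real^'n"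
  have "norm ((s * \<eta> x / real k) *\<^sub>R (\<xi> \<otimes>\<^sub>t \<nu>)) = (s / real k * norm \<xi>) * \<eta> x"
    using s \<eta>_nonneg[of x] \<nu> by (simp add: norm_tensor abs_mult)
  also have "\<dots> \<le> (s / real k * norm \<xi>) * 1"
    using s \<eta>_le[of x] by (intro mult_left_mono) auto
  finally show "norm ((s * \<eta> x / real k) *\<^sub>R (\<xi> \<otimes>\<^sub>t \<nu>)) \<le> s / real k * norm \<xi>" by simp
qed (auto simp: \<eta>_eq_0[THEN iffD2])

lemma borel_u [measurable]: "u \<in> borel_measurable borel"
proof -
  have [measurable]: "(\<lambda>x. A *v x) \<in> borel_measurable borel"
    by (intro borel_measurable_continuous_onI continuous_on_matrix_vector)
  show ?thesis unfolding u_def[abs_def] by measurable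
qed

lemma borel_v [measurable]: "v \<in> borel_measurable borel"
  unfolding v_def[abs_def] by measurable

lemma borel_g [measurable]: "g \<in> borel_measurable borel"
  unfolding g_def[abs_def] by measurable

lemma borel_h [measurable]: "h \<in> borel_measurable borel"
  unfolding h_def[abs_def] by measurable

text \<open>One identity serves twice: for \<phi> supported inside the cube the boundary term drops
  out and the distributional derivative remains, and for general \<phi> it is the trace
  formula.\<close>

lemma gauss_green_u:
  assumes C1: "C1_with_gradient \<phi> d\<phi>"
  shows "(LINT x:unit_cube|lebesgue. u x \<otimes>\<^sub>t d\<phi> x) =
     - ((LINT x:unit_cube|lborel. \<phi> x *\<^sub>R g x) + (LINT x:J|surface_measure. \<phi> x *\<^sub>R h x))
     + (LINT x:frontier unit_cube|surface_measure. \<phi> x *\<^sub>R ((A *v x) \<otimes>\<^sub>t cube_normal x))"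
proof -
  note c = C1_continuous[OF C1]
  note [measurable] = c(3,4)
  have bl: "bounded_linear (\<lambda>w. s *\<^sub>R (\<xi> \<otimes>\<^sub>t w))"
    by (intro bounded_linear_compose[OF bounded_linear_scaleR_right bounded_linear_tensor_right])
  have eq: "u x \<otimes>\<^sub>t d\<phi> x = (A *v x) \<otimes>\<^sub>t d\<phi> x - s *\<^sub>R (\<xi> \<otimes>\<^sub>t ((\<eta> x * saw k (x \<bullet> \<nu>)) *\<^sub>R d\<phi> x))" for x
    by (simp add: u_def tensor_diff_left tensor_scale_left tensor_right_simps mult_ac)
  have int1: "set_integrable lborel unit_cube (\<lambda>x. (A *v x) \<otimes>\<^sub>t d\<phi> x)"
    by (rule set_integrable_cube_continuous, unfold tensor_def)
       (intro continuous_intros c continuous_on_matrix_vector)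
  have int2: "set_integrable lborel unit_cube (\<lambda>x. (\<eta> x * saw k (x \<bullet> \<nu>)) *\<^sub>R d\<phi> x)"
  proof -
    have "set_integrable lborel unit_cube (\<lambda>x. saw k (x \<bullet> \<nu>) *\<^sub>R (\<eta> x *\<^sub>R d\<phi> x))"
      by (intro set_integrable_saw continuous_intros c c\<eta>)
    then show ?thesis by (simp add: mult.commute)
  qed
  note T = set_integral_bounded_linear[OF bl int2]
  have "(LINT x:unit_cube|lebesgue. u x \<otimes>\<^sub>t d\<phi> x) = (LINT x:unit_cube|lborel. u x \<otimes>\<^sub>t d\<phi> x)"
    by (rule set_integral_lebesgue_lborel(1)) measurable
  also have "\<dots> = (LINT x:unit_cube|lborel. (A *v x) \<otimes>\<^sub>t d\<phi> x)
      - s *\<^sub>R (\<xi> \<otimes>\<^sub>t (LINT x:unit_cube|lborel. (\<eta> x * saw k (x \<bullet> \<nu>)) *\<^sub>R d\<phi> x))"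
    unfolding eq set_integral_diff(2)[OF int1 T(2)] T(1) ..
  finally have L: "(LINT x:unit_cube|lebesgue. u x \<otimes>\<^sub>t d\<phi> x) = (LINT x:unit_cube|lborel. (A *v x) \<otimes>\<^sub>t d\<phi> x)
      - s *\<^sub>R (\<xi> \<otimes>\<^sub>t (LINT x:unit_cube|lborel. (\<eta> x * saw k (x \<bullet> \<nu>)) *\<^sub>R d\<phi> x))" .
  have "(LINT x:J|surface_measure. \<phi> x *\<^sub>R h x) = (LINT x:J|surface_measure. (\<phi> x * \<eta> x) *\<^sub>R ((s / real k) *\<^sub>R (\<xi> \<otimes>\<^sub>t \<nu>)))"
    by (simp add: h_def mult_ac)
  also have "\<dots> = (LINT x:J|surface_measure. \<phi> x * \<eta> x) *\<^sub>R ((s / real k) *\<^sub>R (\<xi> \<otimes>\<^sub>t \<nu>))"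
  proof (rule set_integral_bounded_linear(1)[OF bounded_linear_scaleR_left])
    have "continuous_on UNIV (\<lambda>x. \<phi> x * \<eta> x)" by (intro continuous_intros c\<eta> c)
    then obtain B where "\<And>x. x \<in> closed_unit_cube \<Longrightarrow> norm (\<phi> x * \<eta> x) \<le> B"
      by (rule continuous_bounded_on_closed_cube) blast
    then show "set_integrable surface_measure J (\<lambda>x. \<phi> x * \<eta> x)"
      using unit_cube_subset_closed by (intro surface_integral_J(1)[where B = B]) (auto simp: \<eta>_eq_0[THEN iffD2])
  qed
  finally have R: "(LINT x:J|surface_measure. \<phi> x *\<^sub>R h x)
      = (LINT x:J|surface_measure. \<phi> x * \<eta> x) *\<^sub>R ((s / real k) *\<^sub>R (\<xi> \<otimes>\<^sub>t \<nu>))" .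
  show ?thesis
    unfolding L R set_integrable_g(2)[OF c(1)] saw_part_gauss_green[OF C1] affine_gauss_green[OF C1]
    by (simp add: tensor_right_simps algebra_simps del: One_nat_def)
qed

lemma integral_v: "(LINT x:unit_cube|lborel. v x) = S *\<^sub>R \<nu>"
proof -
  have "(LINT x:J|surface_measure. 1 * \<eta> x) = (\<Sum>i\<in>{-K..K}. LINT x:P i|surface_measure. \<eta> x)"
    using \<eta>_nonneg \<eta>_le by (subst surface_integral_J(2)[where B = 1]) (auto simp: \<eta>_eq_0[THEN iffD2])
  then show ?thesis
    using saw_part_gauss_green[OF C1_const[of 1]] by (simp add: S_def set_lebesgue_integral_def del: One_nat_def)
qed

lemma surface_integral_\<eta>: "(LINT x:J|surface_measure. \<eta> x) = real k * S"
  "set_integrable surface_measure J \<eta>"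
  using surface_integral_J[of \<eta> 1] \<eta>_nonneg \<eta>_le k by (auto simp: \<eta>_eq_0[THEN iffD2] S_def simp del: One_nat_def)

end

section \<open>Jumps, SBV membership, trace and energy of the competitor\<close>

context staircase
begin

lemma u_locally_bounded: "\<exists>B. \<forall>y\<in>ball x 1. norm (u y) \<le> B"
proof -
  have "bounded ((\<lambda>y. A *v y) ` cball x 1)"
    by (intro compact_imp_bounded compact_continuous_image continuous_on_matrix_vector compact_cball)
  then obtain B where "\<forall>z \<in> (\<lambda>y. A *v y) ` cball x 1. norm z \<le> B" unfolding bounded_iff by blast
  then have B: "norm (A *v y) \<le> B" if "y \<in> cball x 1" for y using that by blast
  have "norm (u y) \<le> B + s * norm \<xi>" if y: "y \<in> ball x 1" for y
  proof -
    have "\<bar>s * \<eta> y * saw k (y \<bullet> \<nu>)\<bar> = s * (\<eta> y * \<bar>saw k (y \<bullet> \<nu>)\<bar>)"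
      using s \<eta>_nonneg[of y] by (simp add: abs_mult)
    also have "\<dots> \<le> s * (1 * 1)"
      using s \<eta>_nonneg[of y] \<eta>_le[of y] saw_le_1[of "y \<bullet> \<nu>"] by (intro mult_left_mono mult_mono) auto
    finally have "\<bar>s * \<eta> y * saw k (y \<bullet> \<nu>)\<bar> \<le> s" by simp
    then have "norm ((s * \<eta> y * saw k (y \<bullet> \<nu>)) *\<^sub>R \<xi>) \<le> s * norm \<xi>"
      unfolding norm_scaleR by (rule mult_right_mono) simp
    moreover have "norm (A *v y) \<le> B" using y by (intro B) auto
    ultimately show ?thesis
      unfolding u_def using norm_triangle_ineq4[of "A *v y" "(s * \<eta> y * saw k (y \<bullet> \<nu>)) *\<^sub>R \<xi>"] by linarith
  qed
  then show ?thesis by blast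
qed

lemma tendsto_u:
  assumes "((\<lambda>y. saw k (y \<bullet> \<nu>)) \<longlongrightarrow> c) (at x within T)"
  shows "(u \<longlongrightarrow> A *v x - (s * \<eta> x * c) *\<^sub>R \<xi>) (at x within T)"
proof -
  have "((\<lambda>y. A *v y) \<longlongrightarrow> A *v x) (at x within T)"
    by (rule tendsto_within_subset[OF _ subset_UNIV])
       (use continuous_on_matrix_vector[of UNIV A] in \<open>simp add: continuous_on_def\<close>)
  moreover have "(\<eta> \<longlongrightarrow> \<eta> x) (at x within T)"
    by (rule tendsto_within_subset[OF _ subset_UNIV])
       (use c\<eta>(1) in \<open>simp add: continuous_on_def\<close>)
  ultimately show ?thesis unfolding u_def[abs_def] by (intro tendsto_intros assms)
qed

lemma \<eta>_pos: "x \<in> unit_cube \<Longrightarrow> 0 < \<eta> x"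
  using \<eta>_nonneg[of x] \<eta>_eq_0[of x] by (simp add: order.strict_iff_order)

lemma jump_on_J:
  assumes x: "x \<in> J"
  shows "\<exists>a b \<nu>. is_jump_triple u x a b \<nu>"
    "(jump u x = (s * \<eta> x / real k) *\<^sub>R \<xi> \<and> jump_normal u x = \<nu>) \<or>
     (jump u x = - ((s * \<eta> x / real k) *\<^sub>R \<xi>) \<and> jump_normal u x = - \<nu>)"
proof -
  obtain B where B: "\<forall>y\<in>ball x 1. norm (u y) \<le> B" using u_locally_bounded by blast
  obtain i where i: "x \<bullet> \<nu> = of_int i / real k" using x by (auto simp: J_def P_def)
  \<comment> \<open>On the side of \<nu> the sawtooth restarts at 0; on the other side it has
    reached its supremum \<open>1/k\<close>.\<close>
  have p: "(u \<longlongrightarrow> A *v x - (s * \<eta> x * 0) *\<^sub>R \<xi>) (at x within {y. 0 < (y - x) \<bullet> \<nu>})"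
    by (intro tendsto_u filterlim_compose[OF tendsto_saw_right[OF k] filterlim_inner_at_right(1)[OF i]])
  have q: "(u \<longlongrightarrow> A *v x - (s * \<eta> x * (1 / real k)) *\<^sub>R \<xi>) (at x within {y. 0 < (y - x) \<bullet> (- \<nu>)})"
    by (intro tendsto_u filterlim_compose[OF tendsto_saw_left[OF k] filterlim_inner_at_right(2)[OF i]])
  have "0 < \<eta> x" using \<eta>_pos[of x] x J_subset by blast
  then have "s * \<eta> x * (1 / real k) \<noteq> 0" using s k by simp
  then have "(s * \<eta> x * (1 / real k)) *\<^sub>R \<xi> \<noteq> 0" using \<xi> by (simp only: scaleR_eq_0_iff) blast
  then have ne: "A *v x - (s * \<eta> x * 0) *\<^sub>R \<xi> \<noteq> A *v x - (s * \<eta> x * (1 / real k)) *\<^sub>R \<xi>"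
    by (metis (no_types) mult_zero_right scaleR_zero_left diff_left_imp_eq)
  show "\<exists>a b \<nu>. is_jump_triple u x a b \<nu>" by (rule jump_eq(1)[OF borel_u B \<nu> p q ne])
  show "(jump u x = (s * \<eta> x / real k) *\<^sub>R \<xi> \<and> jump_normal u x = \<nu>) \<or>
     (jump u x = - ((s * \<eta> x / real k) *\<^sub>R \<xi>) \<and> jump_normal u x = - \<nu>)"
    using jump_eq(2)[OF borel_u B \<nu> p q ne] by simp
qed

lemma isCont_u:
  assumes "real k * (x \<bullet> \<nu>) \<notin> \<int>"
  shows "isCont u x"
proof -
  have "isCont (\<lambda>y. y \<bullet> \<nu>) x" by (intro continuous_intros)
  from isCont_o2[OF this isCont_saw[OF k assms]] have "isCont (\<lambda>y. saw k (y \<bullet> \<nu>)) x" .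
  then have "((\<lambda>y. saw k (y \<bullet> \<nu>)) \<longlongrightarrow> saw k (x \<bullet> \<nu>)) (at x)" by (simp add: isCont_def)
  from tendsto_u[OF this] show ?thesis by (simp add: isCont_def u_def)
qed

lemma jump_set_u: "jump_set unit_cube u = J"
proof (intro set_eqI iffI)
  fix x assume "x \<in> jump_set unit_cube u"
  then obtain a b n where x: "x \<in> unit_cube" and j: "is_jump_triple u x a b n" by (auto simp: jump_set_def)
  obtain B where "\<forall>y\<in>ball x 1. norm (u y) \<le> B" using u_locally_bounded by blast
  then have "\<not> isCont u x" using not_jump_if_continuous[OF borel_u] j by blast
  then show "x \<in> J" using isCont_u mem_J_iff[OF x] by blast
next
  fix x assume "x \<in> J"
  then show "x \<in> jump_set unit_cube u" using jump_on_J(1)[of x] J_subset by (auto simp: jump_set_def)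
qed

lemma jump_tensor_normal: "x \<in> J \<Longrightarrow> jump u x \<otimes>\<^sub>t jump_normal u x = h x"
  using jump_on_J(2)[of x] by (auto simp: h_def tensor_scale_left tensor_minus_minus)

text \<open>Test functions are bounded Borel functions instead of C1 functions, so that indicators
  turn the identity into one between measures of sets.\<close>

definition represents_Du :: "(real^'n) measure \<Rightarrow> (real^'n \<Rightarrow> real^'n^'d) \<Rightarrow> bool" where
  "represents_Du \<mu> \<sigma> \<longleftrightarrow>
    (\<forall>\<phi> B. \<phi> \<in> borel_measurable borel \<longrightarrow> (\<forall>x. x \<in> unit_cube \<longrightarrow> \<bar>\<phi> x\<bar> \<le> B) \<longrightarrow>
      (\<integral>x. \<phi> x *\<^sub>R \<sigma> x \<partial>\<mu>) = (LINT x:unit_cube|lborel. \<phi> x *\<^sub>R g x) + (LINT x:J|surface_measure. \<phi> x *\<^sub>R h x))"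

lemma deriv_measure_exists: "\<exists>\<mu> \<sigma>. deriv_measure unit_cube u \<mu> \<sigma> \<and> represents_Du \<mu> \<sigma>"
proof -
  have gi: "set_integrable lborel unit_cube g"
    using set_integrable_g(1)[of "\<lambda>_. 1"] by simp
  show ?thesis
  proof (rule polar_decomposition_exists[OF unit_cube_sets J_sets borel_g borel_h null_J J_subset gi set_integrable_h])
    fix \<mu> \<sigma>
    assume \<mu>: "finite_measure \<mu>" "sets \<mu> = sets borel" "emeasure \<mu> (- unit_cube) = 0"
      "\<sigma> \<in> borel_measurable borel" "AE x in \<mu>. norm (\<sigma> x) = 1"
      and main: "\<And>\<phi> B. \<phi> \<in> borel_measurable borel \<Longrightarrow> (\<And>x. x \<in> unit_cube \<Longrightarrow> \<bar>\<phi> x\<bar> \<le> B) \<Longrightarrow>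
        (\<integral>x. \<phi> x *\<^sub>R \<sigma> x \<partial>\<mu>) = (LINT x:unit_cube|lborel. \<phi> x *\<^sub>R g x) + (LINT x:J|surface_measure. \<phi> x *\<^sub>R h x)"
    have "deriv_measure unit_cube u \<mu> \<sigma>"
      unfolding deriv_measure_def
    proof (intro conjI allI impI)
      fix \<phi> :: "real^'n \<Rightarrow> real" and d\<phi> assume a: "C1_with_gradient \<phi> d\<phi> \<and> compactly_supported_in unit_cube \<phi>"
      note C1 = conjunct1[OF a]
      obtain B where B: "\<And>x. x \<in> closed_unit_cube \<Longrightarrow> norm (\<phi> x) \<le> B"
        using continuous_bounded_on_closed_cube[OF C1_continuous(1)[OF C1]] by blast
      have "(\<integral>x. \<phi> x *\<^sub>R \<sigma> x \<partial>\<mu>) = (LINT x:unit_cube|lborel. \<phi> x *\<^sub>R g x) + (LINT x:J|surface_measure. \<phi> x *\<^sub>R h x)"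
        using B unit_cube_subset_closed by (intro main[of \<phi> B] C1_continuous(3)[OF C1]) auto
      moreover have "\<phi> x = 0" if "x \<in> frontier unit_cube" for x
      proof (rule ccontr)
        assume "\<phi> x \<noteq> 0"
        then have "x \<in> {x. \<phi> x \<noteq> 0}" by simp
        then have "x \<in> closure {x. \<phi> x \<noteq> 0}" by (rule subsetD[OF closure_subset])
        moreover have "closure {x. \<phi> x \<noteq> 0} \<subseteq> unit_cube" using a by (simp add: compactly_supported_in_def)
        ultimately have "x \<in> unit_cube" by blast
        then show False using that by (simp add: frontier_unit_cube)
      qed
      then have "indicat_real (frontier unit_cube) x *\<^sub>R (\<phi> x *\<^sub>R ((A *v x) \<otimes>\<^sub>t cube_normal x)) = 0" for x
        by (auto simp: indicator_def)
      then have "(LINT x:frontier unit_cube|surface_measure. \<phi> x *\<^sub>R ((A *v x) \<otimes>\<^sub>t cube_normal x)) = 0"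
        unfolding set_lebesgue_integral_def by (simp only: Bochner_Integration.integral_zero)
      ultimately show "(LINT x:unit_cube|lebesgue. u x \<otimes>\<^sub>t d\<phi> x) = - (\<integral>x. \<phi> x *\<^sub>R \<sigma> x \<partial>\<mu>)"
        using gauss_green_u[OF C1] by (simp del: One_nat_def)
    qed (fact \<mu>)+
    moreover have "represents_Du \<mu> \<sigma>"
      unfolding represents_Du_def by (intro allI impI) (rule main, auto)
    ultimately show ?thesis by blast
  qed
qed

lemma LINT_indicator_mult:
  fixes f :: "real^'n \<Rightarrow> real^'n^'d"
  assumes "E \<subseteq> T"
  shows "(LINT x:T|M. indicat_real E x *\<^sub>R f x) = (LINT x:E|M. f x)"
  unfolding set_lebesgue_integral_def
  by (rule Bochner_Integration.integral_cong[OF refl]) (use assms in \<open>auto simp: indicator_def\<close>)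

lemma ac_density_u: "ac_density unit_cube u g"
proof -
  obtain \<mu> \<sigma> where D: "deriv_measure unit_cube u \<mu> \<sigma>" and rep: "represents_Du \<mu> \<sigma>"
    using deriv_measure_exists by blast
  note main = rep[unfolded represents_Du_def, rule_format]
  have "set_integrable lborel unit_cube g"
    using set_integrable_g(1)[of "\<lambda>_. 1"] by simp
  then have "set_integrable lebesgue unit_cube g"
    by (simp add: set_integral_lebesgue_lborel(2))
  \<comment> \<open>\<open>J\<close> is the null set that carries the singular part: testing with
    the indicator of \<open>E - J\<close> removes the surface term.\<close>
  moreover have "(LINT x:(E - J)|\<mu>. \<sigma> x) = (LINT x:E|lebesgue. g x)" if E[measurable]: "E \<in> sets borel" "E \<subseteq> unit_cube" for E
  proof -
    have "(LINT x:(E - J)|\<mu>. \<sigma> x) = (LINT x:unit_cube|lborel. indicat_real (E - J) x *\<^sub>R g x)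
        + (LINT x:J|surface_measure. indicat_real (E - J) x *\<^sub>R h x)"
      unfolding set_lebesgue_integral_def[of \<mu>] by (rule main[where B = 1]) (auto simp: indicator_def)
    also have "(LINT x:unit_cube|lborel. indicat_real (E - J) x *\<^sub>R g x) = (LINT x:E - J|lborel. g x)"
      by (rule LINT_indicator_mult) (use E in auto)
    also have "\<dots> = (LINT x:E|lborel. g x)"
      unfolding set_lebesgue_integral_def
    proof (rule integral_cong_AE)
      have "AE x in lborel. x \<notin> J" using null_J by (rule AE_not_in)
      then show "AE x in lborel. indicat_real (E - J) x *\<^sub>R g x = indicat_real E x *\<^sub>R g x"
        by eventually_elim (simp add: indicator_def)
    qed measurable
    also have "\<dots> = (LINT x:E|lebesgue. g x)" by (rule set_integral_lebesgue_lborel(1)[symmetric]) measurable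
    also have "(LINT x:J|surface_measure. indicat_real (E - J) x *\<^sub>R h x) = 0"
    proof -
      have "indicat_real J x *\<^sub>R (indicat_real (E - J) x *\<^sub>R h x) = 0" for x by (simp add: indicator_def)
      then show ?thesis unfolding set_lebesgue_integral_def by (simp only: Bochner_Integration.integral_zero)
    qed
    finally show ?thesis by simp
  qed
  ultimately show ?thesis unfolding ac_density_def using D null_J by blast
qed

lemma grad_u: "AE x in lebesgue. x \<in> unit_cube \<longrightarrow> grad unit_cube u x = g x"
  unfolding grad_def by (rule ac_density_unique[OF someI[of "ac_density unit_cube u", OF ac_density_u] ac_density_u])

lemma set_integral_grad_u:
  assumes [measurable]: "E \<in> sets borel" and E: "E \<subseteq> unit_cube"
  shows "(LINT x:E|lebesgue. grad unit_cube u x) = (LINT x:E|lborel. g x)"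
proof -
  have "ac_density unit_cube u (grad unit_cube u)"
    unfolding grad_def by (rule someI[of "ac_density unit_cube u", OF ac_density_u])
  then have "set_integrable lebesgue unit_cube (grad unit_cube u)" by (simp add: ac_density_def)
  moreover have "E \<in> sets lebesgue" by simp
  ultimately have "set_integrable lebesgue E (grad unit_cube u)" using E by (rule set_integrable_subset)
  then have m: "(\<lambda>x. indicat_real E x *\<^sub>R grad unit_cube u x) \<in> borel_measurable lebesgue"
    unfolding set_integrable_def by (rule borel_measurable_integrable)
  have "(LINT x:E|lebesgue. grad unit_cube u x) = (LINT x:E|lebesgue. g x)"
    unfolding set_lebesgue_integral_def
  proof (rule integral_cong_AE[OF m])
    have "(\<lambda>x. indicat_real E x *\<^sub>R g x) \<in> borel_measurable lborel" by measurable
    then show "(\<lambda>x. indicat_real E x *\<^sub>R g x) \<in> borel_measurable lebesgue" by (rule measurable_completion)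
    show "AE x in lebesgue. indicat_real E x *\<^sub>R grad unit_cube u x = indicat_real E x *\<^sub>R g x"
      using grad_u by eventually_elim (use E in \<open>auto simp: indicator_def\<close>)
  qed
  also have "\<dots> = (LINT x:E|lborel. g x)" by (rule set_integral_lebesgue_lborel(1)) measurable
  finally show ?thesis .
qed

lemma u_SBV: "u \<in> SBV unit_cube"
proof -
  obtain \<mu> \<sigma> where D: "deriv_measure unit_cube u \<mu> \<sigma>" and rep: "represents_Du \<mu> \<sigma>"
    using deriv_measure_exists by blast
  note main = rep[unfolded represents_Du_def, rule_format]
  have "set_integrable lborel unit_cube u"
  proof -
    have "set_integrable lborel unit_cube (\<lambda>x. A *v x - saw k (x \<bullet> \<nu>) *\<^sub>R ((s * \<eta> x) *\<^sub>R \<xi>))"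
      by (intro set_integral_diff(1) set_integrable_saw set_integrable_cube_continuous continuous_on_matrix_vector continuous_intros c\<eta>)
    then show ?thesis by (simp add: u_def[abs_def] mult_ac)
  qed
  then have "set_integrable lebesgue unit_cube u" by (simp add: set_integral_lebesgue_lborel(2))
  then have BV: "u \<in> BV unit_cube" using D by (auto simp: BV_def)
  have cong: "indicat_real J x *\<^sub>R (jump u x \<otimes>\<^sub>t jump_normal u x) = indicat_real J x *\<^sub>R h x" for x
    using jump_tensor_normal[of x] by (auto simp: indicator_def)
  have int: "set_integrable surface_measure (jump_set unit_cube u) (\<lambda>x. jump u x \<otimes>\<^sub>t jump_normal u x)"
    using set_integrable_h unfolding jump_set_u set_integrable_def cong .
  have "(LINT x:E|\<mu>. \<sigma> x) = (LINT x:E|lebesgue. grad unit_cube u x) +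
        (LINT x:(E \<inter> jump_set unit_cube u)|surface_measure. jump u x \<otimes>\<^sub>t jump_normal u x)"
    if [measurable]: "E \<in> sets borel" and E: "E \<subseteq> unit_cube" for E
  proof -
    have "(LINT x:E|\<mu>. \<sigma> x) = (LINT x:unit_cube|lborel. indicat_real E x *\<^sub>R g x)
        + (LINT x:J|surface_measure. indicat_real E x *\<^sub>R h x)"
      unfolding set_lebesgue_integral_def[of \<mu>] by (rule main[where B = 1]) (auto simp: indicator_def)
    also have "(LINT x:unit_cube|lborel. indicat_real E x *\<^sub>R g x) = (LINT x:E|lborel. g x)"
      by (rule LINT_indicator_mult[OF E])
    also have "\<dots> = (LINT x:E|lebesgue. grad unit_cube u x)"
      by (rule set_integral_grad_u[symmetric, OF _ E]) measurable
    also have "(LINT x:J|surface_measure. indicat_real E x *\<^sub>R h x)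
        = (LINT x:(E \<inter> J)|surface_measure. jump u x \<otimes>\<^sub>t jump_normal u x)"
      unfolding set_lebesgue_integral_def
    proof (rule Bochner_Integration.integral_cong[OF refl])
      fix x
      show "indicat_real J x *\<^sub>R indicat_real E x *\<^sub>R h x = indicat_real (E \<inter> J) x *\<^sub>R (jump u x \<otimes>\<^sub>t jump_normal u x)"
        using jump_tensor_normal[of x] by (auto simp: indicator_def)
    qed
    finally show ?thesis unfolding jump_set_u .
  qed
  then show ?thesis unfolding SBV_def using BV int D by blast
qed

lemma u_trace: "is_trace unit_cube cube_normal u (\<lambda>x. A *v x)"
proof -
  obtain \<mu> \<sigma> where D: "deriv_measure unit_cube u \<mu> \<sigma>" and rep: "represents_Du \<mu> \<sigma>"
    using deriv_measure_exists by blast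
  note main = rep[unfolded represents_Du_def, rule_format]
  obtain B where B: "\<And>x. x \<in> closed_unit_cube \<Longrightarrow> norm (A *v x) \<le> B"
    using continuous_bounded_on_closed_cube[OF continuous_on_matrix_vector[of UNIV A]] by blast
  have int: "set_integrable surface_measure (frontier unit_cube) (\<lambda>x. A *v x)"
    by (rule set_integrable_surface_cube_frontier[OF borel_measurable_continuous_onI[OF continuous_on_matrix_vector] B])
  have "(LINT x:unit_cube|lebesgue. u x \<otimes>\<^sub>t d\<phi> x) = - (\<integral>x. \<phi> x *\<^sub>R \<sigma> x \<partial>\<mu>)
      + (LINT x:frontier unit_cube|surface_measure. \<phi> x *\<^sub>R ((A *v x) \<otimes>\<^sub>t cube_normal x))"
    if C1: "C1_with_gradient \<phi> d\<phi>" for \<phi> d\<phi>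
  proof -
    obtain B where B: "\<And>x. x \<in> closed_unit_cube \<Longrightarrow> norm (\<phi> x) \<le> B"
      using continuous_bounded_on_closed_cube[OF C1_continuous(1)[OF C1]] by blast
    have "(\<integral>x. \<phi> x *\<^sub>R \<sigma> x \<partial>\<mu>) = (LINT x:unit_cube|lborel. \<phi> x *\<^sub>R g x) + (LINT x:J|surface_measure. \<phi> x *\<^sub>R h x)"
      using B unit_cube_subset_closed by (intro main[of \<phi> B] C1_continuous(3)[OF C1]) auto
    then show ?thesis using gauss_green_u[OF C1] by (simp only:)
  qed
  then show ?thesis unfolding is_trace_def using int D by blast
qed

lemma integral_grad_u: "(LINT x:unit_cube|lebesgue. grad unit_cube u x) = A - (s * S) *\<^sub>R (\<xi> \<otimes>\<^sub>t \<nu>)"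
proof -
  have "(LINT x:unit_cube|lborel. (1::real) *\<^sub>R A) = A"
    by (simp add: set_lebesgue_integral_def measure_def emeasure_unit_cube)
  then have "(LINT x:unit_cube|lborel. g x) = A - s *\<^sub>R (\<xi> \<otimes>\<^sub>t (S *\<^sub>R \<nu>))"
    using set_integrable_g(2)[of "\<lambda>_. 1"] by (simp add: integral_v)
  then show ?thesis
    by (subst set_integral_grad_u) (auto simp: tensor_right_simps)
qed

text \<open>On the jump set the energy density is linear in \<eta>, by homogeneity; the symmetry of
  \<psi> absorbs the unknown sign in the choice of jump and normal. The surface energy is therefore
  computed exactly and not merely estimated.\<close>

lemma energy_u:
  assumes W: "continuous_on UNIV W"
    and \<psi>_nonneg: "0 \<le> \<psi> \<xi> \<nu>"
    and hom: "\<And>t. 0 < t \<Longrightarrow> \<psi> (t *\<^sub>R \<xi>) \<nu> = t * \<psi> \<xi> \<nu>"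
    and sym: "\<And>z. \<psi> (- z) (- \<nu>) = \<psi> z \<nu>"
  shows "energy W \<psi> unit_cube u = (\<integral>\<^sup>+x\<in>unit_cube. ennreal (W (g x)) \<partial>lborel) + ennreal (s * S * \<psi> \<xi> \<nu>)"
proof -
  have [measurable]: "W \<in> borel_measurable borel" by (rule borel_measurable_continuous_onI[OF W])
  have "(\<integral>\<^sup>+x\<in>unit_cube. ennreal (W (grad unit_cube u x)) \<partial>lebesgue) = (\<integral>\<^sup>+x\<in>unit_cube. ennreal (W (g x)) \<partial>lebesgue)"
    by (rule nn_integral_cong_AE) (use grad_u in eventually_elim, auto simp: indicator_def)
  also have "\<dots> = (\<integral>\<^sup>+x\<in>unit_cube. ennreal (W (g x)) \<partial>lborel)"
    by (rule nn_integral_completion)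
  finally have bulk: "(\<integral>\<^sup>+x\<in>unit_cube. ennreal (W (grad unit_cube u x)) \<partial>lebesgue)
      = (\<integral>\<^sup>+x\<in>unit_cube. ennreal (W (g x)) \<partial>lborel)" .
  let ?c = "s / real k * \<psi> \<xi> \<nu>"
  have \<psi>J: "\<psi> (jump u x) (jump_normal u x) = ?c * \<eta> x" if "x \<in> J" for x
  proof -
    have "0 < \<eta> x" using \<eta>_pos[of x] that J_subset by blast
    then have "0 < s * \<eta> x / real k" using s k by simp
    then have "\<psi> ((s * \<eta> x / real k) *\<^sub>R \<xi>) \<nu> = ?c * \<eta> x" by (subst hom) (auto simp: mult_ac)
    then show ?thesis using jump_on_J(2)[OF that] sym by auto
  qed
  have "(\<integral>\<^sup>+x\<in>jump_set unit_cube u. ennreal (\<psi> (jump u x) (jump_normal u x)) \<partial>surface_measure)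
      = (\<integral>\<^sup>+x. ennreal (?c * (indicat_real J x * \<eta> x)) \<partial>surface_measure)"
    unfolding jump_set_u by (rule nn_integral_cong) (auto simp: indicator_def \<psi>J)
  also have "\<dots> = ennreal (\<integral>x. ?c * (indicat_real J x * \<eta> x) \<partial>surface_measure)"
  proof (rule nn_integral_eq_integral)
    show "integrable surface_measure (\<lambda>x. ?c * (indicat_real J x * \<eta> x))"
      using surface_integral_\<eta>(2) by (simp add: set_integrable_def del: One_nat_def)
    have "0 \<le> ?c * (indicat_real J x * \<eta> x)" for x
      using s \<psi>_nonneg \<eta>_nonneg[of x] by simp
    then show "AE x in surface_measure. 0 \<le> ?c * (indicat_real J x * \<eta> x)" by (rule AE_I2)
  qed
  also have "(\<integral>x. ?c * (indicat_real J x * \<eta> x) \<partial>surface_measure) = ?c * (real k * S)"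
    using surface_integral_\<eta>(1) by (simp add: set_lebesgue_integral_def del: One_nat_def)
  also have "?c * (real k * S) = s * S * \<psi> \<xi> \<nu>" using k by simp
  finally show ?thesis unfolding energy_def bulk by (simp only:)
qed

lemma H_le:
  assumes "continuous_on UNIV W" "0 \<le> \<psi> \<xi> \<nu>"
    "\<And>t. 0 < t \<Longrightarrow> \<psi> (t *\<^sub>R \<xi>) \<nu> = t * \<psi> \<xi> \<nu>" "\<And>z. \<psi> (- z) (- \<nu>) = \<psi> z \<nu>"
  shows "H W \<psi> A (A - (s * S) *\<^sub>R (\<xi> \<otimes>\<^sub>t \<nu>))
    \<le> (\<integral>\<^sup>+x\<in>unit_cube. ennreal (W (g x)) \<partial>lborel) + ennreal (s * S * \<psi> \<xi> \<nu>)"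
proof -
  have "H W \<psi> A (A - (s * S) *\<^sub>R (\<xi> \<otimes>\<^sub>t \<nu>)) \<le> energy W \<psi> unit_cube u"
    unfolding H_def using u_SBV u_trace integral_grad_u by (intro Inf_lower) blast
  then show ?thesis using energy_u[OF assms] by (simp only:)
qed

end

section \<open>Bounds for the relaxed energy\<close>

text \<open>\<open>ennreal\<close> truncates negative values to 0, so the right-hand side sees only
  the positive part of \<open>f\<close>. This suits the linear form on jumps, which may be
  negative.\<close>

lemma ennreal_integral_le_nn_integral:
  fixes f :: "'a \<Rightarrow> real"
  assumes f: "integrable M f"
  shows "ennreal (\<integral>x. f x \<partial>M) \<le> (\<integral>\<^sup>+x. ennreal (f x) \<partial>M)"
proof -
  have f': "integrable M (\<lambda>x. max 0 (f x))" using f by (intro integrable_max) auto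
  have "(\<integral>x. f x \<partial>M) \<le> (\<integral>x. max 0 (f x) \<partial>M)"
    by (rule Bochner_Integration.integral_mono[OF f f']) simp
  then have "ennreal (\<integral>x. f x \<partial>M) \<le> ennreal (\<integral>x. max 0 (f x) \<partial>M)" by (rule ennreal_leI)
  also have "\<dots> = (\<integral>\<^sup>+x. ennreal (max 0 (f x)) \<partial>M)"
    by (rule nn_integral_eq_integral[symmetric, OF f']) simp
  also have "\<dots> = (\<integral>\<^sup>+x. ennreal (f x) \<partial>M)"
    by (intro nn_integral_cong) (simp add: max_def ennreal_neg)
  finally show ?thesis .
qed

text \<open>With \<phi> = 1 the trace formula expresses \<open>Du(Q)\<close> by a boundary integral,
  which the affine map evaluates to \<open>A\<close>. The polar pairs behind the trace and behind
  the SBV identity may differ, and \<open>deriv_measure_unique\<close> reconciles them.\<close>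

lemma trace_total_derivative:
  fixes A :: "real^'n^'d"
  assumes SBV: "u \<in> SBV unit_cube" and tr: "is_trace unit_cube cube_normal u (\<lambda>x. A *v x)"
  shows "A = (LINT x:unit_cube|lebesgue. grad unit_cube u x)
    + (LINT x:jump_set unit_cube u|surface_measure. jump u x \<otimes>\<^sub>t jump_normal u x)"
proof -
  have one: "C1_with_gradient (\<lambda>x :: real^'n. 1) (\<lambda>x. 0)" by (rule C1_const)
  have z: "a \<otimes>\<^sub>t (0 :: real^'n) = 0" for a :: "real^'d" by (simp add: vec_eq_iff)
  have "(LINT x:unit_cube|lborel. (1::real) *\<^sub>R A) = A"
    by (simp add: set_lebesgue_integral_def measure_def emeasure_unit_cube)
  then have bdry: "(LINT x:frontier unit_cube|surface_measure. (1::real) *\<^sub>R ((A *v x) \<otimes>\<^sub>t cube_normal x)) = A"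
    using affine_gauss_green[OF one, of A] by (simp add: z set_lebesgue_integral_def del: One_nat_def)
  obtain \<mu> \<sigma> where D: "deriv_measure unit_cube u \<mu> \<sigma>"
    and T: "\<forall>\<phi> d\<phi>. C1_with_gradient \<phi> d\<phi> \<longrightarrow>
           (LINT x:unit_cube|lebesgue. u x \<otimes>\<^sub>t d\<phi> x) = - (LINT x|\<mu>. \<phi> x *\<^sub>R \<sigma> x) +
             (LINT x:frontier unit_cube|surface_measure. \<phi> x *\<^sub>R ((A *v x) \<otimes>\<^sub>t cube_normal x))"
    using tr unfolding is_trace_def by blast
  have "(LINT x:unit_cube|lebesgue. u x \<otimes>\<^sub>t (0 :: real^'n)) = 0"
    by (simp add: z set_lebesgue_integral_def)
  then have tot: "(\<integral>x. \<sigma> x \<partial>\<mu>) = A"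
    using T[rule_format, OF one] unfolding bdry by simp
  note E = deriv_measureD[OF D]
  note E(2)[measurable_cong] E(3)[measurable]
  have "- unit_cube \<in> null_sets \<mu>" using E(2,6) by (intro null_setsI) auto
  then have "AE x in \<mu>. x \<notin> - unit_cube" by (rule AE_not_in)
  then have "(LINT x:unit_cube|\<mu>. \<sigma> x) = (\<integral>x. \<sigma> x \<partial>\<mu>)"
    unfolding set_lebesgue_integral_def by (intro integral_cong_AE) (auto simp: indicator_def elim!: AE_mp)
  then have Q: "(LINT x:unit_cube|\<mu>. \<sigma> x) = A" using tot by simp
  obtain \<mu>' \<sigma>' where D': "deriv_measure unit_cube u \<mu>' \<sigma>'"
    and S: "\<forall>E \<in> sets borel. E \<subseteq> unit_cube \<longrightarrow>
           (LINT x:E|\<mu>'. \<sigma>' x) = (LINT x:E|lebesgue. grad unit_cube u x) +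
             (LINT x:(E \<inter> jump_set unit_cube u)|surface_measure. jump u x \<otimes>\<^sub>t jump_normal u x)"
    using SBV unfolding SBV_def by blast
  have "unit_cube \<inter> jump_set unit_cube u = jump_set unit_cube u" by (auto simp: jump_set_def)
  then show ?thesis
    using S[rule_format, OF unit_cube_sets order_refl] deriv_measure_unique[OF D D' unit_cube_sets] Q
    by (simp only:)
qed

lemma H_lower_bound:
  fixes W :: "real^'n^'d \<Rightarrow> real" and \<psi> :: "real^'d \<Rightarrow> real^'n \<Rightarrow> real"
  assumes W: "\<And>B. w \<le> W B" and \<psi>: "\<And>z n. norm n = 1 \<Longrightarrow> M \<bullet> (z \<otimes>\<^sub>t n) \<le> \<psi> z n"
  shows "ennreal w + ennreal (M \<bullet> (A - B)) \<le> H W \<psi> A B"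
  unfolding H_def
proof (rule Inf_greatest)
  fix e assume "e \<in> {energy W \<psi> unit_cube u | u. u \<in> SBV unit_cube \<and>
            is_trace unit_cube cube_normal u (\<lambda>x. A *v x) \<and>
            (LINT x:unit_cube|lebesgue. grad unit_cube u x) = B}"
  then obtain u where e: "e = energy W \<psi> unit_cube u" and SBV: "u \<in> SBV unit_cube"
    and tr: "is_trace unit_cube cube_normal u (\<lambda>x. A *v x)"
    and B: "(LINT x:unit_cube|lebesgue. grad unit_cube u x) = B" by blast
  let ?J = "jump_set unit_cube u" and ?j = "\<lambda>x. jump u x \<otimes>\<^sub>t jump_normal u x"
  have bulk: "ennreal w \<le> (\<integral>\<^sup>+x \<in> unit_cube. ennreal (W (grad unit_cube u x)) \<partial>lebesgue)"
  proof -
    have "ennreal w = (\<integral>\<^sup>+x \<in> (unit_cube :: (real^'n) set). ennreal w \<partial>lebesgue)"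
      by (simp add: nn_integral_cmult_indicator emeasure_unit_cube)
    also have "\<dots> \<le> (\<integral>\<^sup>+x \<in> unit_cube. ennreal (W (grad unit_cube u x)) \<partial>lebesgue)"
      using W by (intro nn_integral_mono mult_right_mono ennreal_leI) auto
    finally show ?thesis .
  qed
  have int: "integrable surface_measure (\<lambda>x. indicat_real ?J x *\<^sub>R ?j x)"
    using SBV by (simp add: SBV_def set_integrable_def del: One_nat_def)
  have "A - B = (\<integral>x. indicat_real ?J x *\<^sub>R ?j x \<partial>surface_measure)"
    using trace_total_derivative[OF SBV tr] B by (simp add: set_lebesgue_integral_def del: One_nat_def)
  then have "ennreal (M \<bullet> (A - B)) = ennreal (\<integral>x. M \<bullet> (indicat_real ?J x *\<^sub>R ?j x) \<partial>surface_measure)"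
    by (simp only: integral_inner_right[where c = M, OF int])
  also have "\<dots> \<le> (\<integral>\<^sup>+x. ennreal (M \<bullet> (indicat_real ?J x *\<^sub>R ?j x)) \<partial>surface_measure)"
    by (intro ennreal_integral_le_nn_integral integrable_inner_right int)
  \<comment> \<open>Monotonicity of the nonnegative integral asks for no measurability, so the
    chosen jump and normal may be inserted into \<psi> as they are.\<close>
  also have "\<dots> \<le> (\<integral>\<^sup>+x \<in> ?J. ennreal (\<psi> (jump u x) (jump_normal u x)) \<partial>surface_measure)"
  proof (rule nn_integral_mono)
    fix x
    show "ennreal (M \<bullet> (indicat_real ?J x *\<^sub>R ?j x)) \<le> ennreal (\<psi> (jump u x) (jump_normal u x)) * indicator ?J x"
    proof (cases "x \<in> ?J")
      case True
      then obtain a b n where "is_jump_triple u x a b n" by (auto simp: jump_set_def)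
      then have "norm (jump_normal u x) = 1"
        by (rule is_jump_triple_jump_triple) (simp add: is_jump_triple_def)
      then show ?thesis using True \<psi> by (simp add: ennreal_leI)
    qed simp
  qed
  finally show "ennreal w + ennreal (M \<bullet> (A - B)) \<le> e"
    unfolding e energy_def using bulk by (intro add_mono)
qed

lemma coercive_attains_min:
  fixes W :: "'a::euclidean_space \<Rightarrow> real"
  assumes W: "continuous_on UNIV W" and c: "0 < c" and coercive: "\<And>A. c * norm A \<le> W A"
  shows "\<exists>B. \<forall>A. W B \<le> W A"
proof -
  \<comment> \<open>Outside this ball coercivity already gives values above \<open>W 0\<close>, so a
    minimum over the ball is global.\<close>
  let ?R = "W 0 / c"
  have "0 \<le> W 0" using coercive[of 0] by simp
  then have R: "0 \<le> ?R" using c by simp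
  then have "cball (0::'a) ?R \<noteq> {}" by (metis cball_eq_empty not_le)
  then obtain B where B: "B \<in> cball 0 ?R" "\<forall>A \<in> cball 0 ?R. W B \<le> W A"
    using continuous_attains_inf[OF compact_cball _ continuous_on_subset[OF W subset_UNIV]] by metis
  have "W B \<le> W A" for A
  proof (cases "A \<in> cball 0 ?R")
    case False
    then have "W 0 < c * norm A" using c by (simp add: not_le pos_divide_less_eq mult.commute)
    moreover have "W B \<le> W 0" using B(2) R by simp
    ultimately show ?thesis using coercive[of A] by linarith
  qed (use B in blast)
  then show ?thesis by blast
qed

text \<open>A linear form on matrices which lies below \<open>\<psi>\<close> on rank-one matrices and touches it: any form
  which is positive somewhere, divided by the maximum of its ratio to \<open>\<psi>\<close> over unit vectors.\<close>

lemma calibration_exists: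
  fixes \<psi> :: "real^'d \<Rightarrow> real^'n \<Rightarrow> real"
  assumes cont: "continuous_on (UNIV \<times> sphere 0 1) (\<lambda>(z, \<nu>). \<psi> z \<nu>)"
    and c: "0 < c" and low: "\<And>z \<nu>. norm \<nu> = 1 \<Longrightarrow> c * norm z \<le> \<psi> z \<nu>"
    and hom: "\<And>z \<nu> t. norm \<nu> = 1 \<Longrightarrow> 0 < t \<Longrightarrow> \<psi> (t *\<^sub>R z) \<nu> = t * \<psi> z \<nu>"
  obtains M \<xi> \<nu> where "norm \<xi> = 1" "norm \<nu> = 1" "M \<bullet> (\<xi> \<otimes>\<^sub>t \<nu>) = \<psi> \<xi> \<nu>"
    "\<And>z n. norm n = 1 \<Longrightarrow> M \<bullet> (z \<otimes>\<^sub>t n) \<le> \<psi> z n"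
proof -
  define a0 :: "real^'d" where "a0 = axis undefined 1"
  define b0 :: "real^'n" where "b0 = axis undefined 1"
  have n0: "norm a0 = 1" "norm b0 = 1" by (simp_all add: a0_def b0_def norm_axis_1)
  \<comment> \<open>A unit rank-one matrix pairs to 1 with itself, so the maximal ratio
    \<open>l\<close> is positive and division by it preserves the inequality.\<close>
  define M0 where "M0 = a0 \<otimes>\<^sub>t b0"
  have M00: "M0 \<bullet> (a0 \<otimes>\<^sub>t b0) = 1"
    using norm_tensor[of a0 b0] n0 by (simp add: M0_def flip: power2_norm_eq_inner)
  let ?S = "sphere (0::real^'d) 1 \<times> sphere (0::real^'n) 1"
  let ?F = "\<lambda>p. (M0 \<bullet> (fst p \<otimes>\<^sub>t snd p)) / \<psi> (fst p) (snd p)"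
  have pos: "0 < \<psi> z n" if "norm z = 1" "norm n = 1" for z n
    using low[OF that(2), of z] that c by simp
  have c1: "continuous_on ?S (\<lambda>p. \<psi> (fst p) (snd p))"
    using continuous_on_subset[OF cont, of ?S] by (auto simp: case_prod_unfold)
  have c2: "continuous_on ?S (\<lambda>p. M0 \<bullet> (fst p \<otimes>\<^sub>t snd p))"
    unfolding tensor_def by (intro continuous_intros)
  have "continuous_on ?S ?F"
    using pos by (intro continuous_on_divide c1 c2) (force simp: less_le)
  moreover have "compact ?S" by (intro compact_Times compact_sphere)
  moreover have "(a0, b0) \<in> ?S" using n0 by simp
  ultimately obtain p where p: "p \<in> ?S" "\<forall>q \<in> ?S. ?F q \<le> ?F p"
    using continuous_attains_sup[of ?S ?F] by blast
  obtain \<xi> \<nu> where p\<xi>: "p = (\<xi>, \<nu>)" by (cases p)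
  have n: "norm \<xi> = 1" "norm \<nu> = 1" using p(1) p\<xi> by auto
  define l where "l = ?F p"
  have "?F (a0, b0) \<le> l" using p(2) n0 unfolding l_def by (intro bspec[OF p(2)]) simp
  moreover have "0 < ?F (a0, b0)" using M00 pos[OF n0] by simp
  ultimately have l: "0 < l" by linarith
  have le: "M0 \<bullet> (z \<otimes>\<^sub>t m) \<le> l * \<psi> z m" if "norm z = 1" "norm m = 1" for z m
  proof -
    have "?F (z, m) \<le> l" unfolding l_def using that by (intro bspec[OF p(2)]) simp
    then show ?thesis using pos[OF that] by (simp add: pos_divide_le_eq)
  qed
  have M: "((1 / l) *\<^sub>R M0) \<bullet> (z \<otimes>\<^sub>t m) \<le> \<psi> z m" if m: "norm m = 1" for z m
  \<comment> \<open>Homogeneity concerns positive factors only, so the zero vector cannot be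
    normalised and is settled by the lower bound for \<psi>.\<close>
  proof (cases "z = 0")
    case True
    have "(0 :: real^'d) \<otimes>\<^sub>t m = 0" by (simp add: vec_eq_iff)
    then show ?thesis using low[OF m, of 0] True by simp
  next
    case False
    define z' where "z' = (1 / norm z) *\<^sub>R z"
    have z': "norm z' = 1" "z = norm z *\<^sub>R z'" using False by (simp_all add: z'_def)
    have "M0 \<bullet> (z \<otimes>\<^sub>t m) = norm z * (M0 \<bullet> (z' \<otimes>\<^sub>t m))"
      by (subst z'(2)) (simp add: tensor_scale_left)
    also have "\<dots> \<le> norm z * (l * \<psi> z' m)" by (intro mult_left_mono le z'(1) m) simp
    also have "\<dots> = l * \<psi> z m" using hom[OF m, of "norm z" z'] False z'(2) by simp
    finally show ?thesis using l by (simp add: field_simps)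
  qed
  have eq: "((1 / l) *\<^sub>R M0) \<bullet> (\<xi> \<otimes>\<^sub>t \<nu>) = \<psi> \<xi> \<nu>"
    using l pos[OF n] by (simp add: l_def p\<xi> field_simps)
  show thesis by (rule that[OF n eq M])
qed

text \<open>Squaring an affine identity gives an identity of quadratic polynomials in
  \<open>t\<close>. Its coefficients force the square of \<open>B \<bullet> C\<close> to be
  \<open>(norm B)\<^sup>2 + 1\<close>, which contradicts the Cauchy-Schwarz inequality.\<close>

lemma H0_not_affine:
  fixes B C :: "real^'n^'d"
  assumes C: "norm C = 1"
  shows "\<not> (\<exists>p q. \<forall>t>0. H0 (B + t *\<^sub>R C) B = p * t + q)"
proof
  assume "\<exists>p q. \<forall>t>0. H0 (B + t *\<^sub>R C) B = p * t + q"
  then obtain p q where pq: "\<And>t. 0 < t \<Longrightarrow> H0 (B + t *\<^sub>R C) B = p * t + q" by blast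
  define r where "r = q - norm B"
  define \<beta> where "\<beta> = B \<bullet> C"
  define \<gamma> where "\<gamma> = (norm B)\<^sup>2 + 1"
  have eq: "(p * t + r)\<^sup>2 = t\<^sup>2 + 2 * \<beta> * t + \<gamma>" if t: "0 < t" for t
  proof -
    have CC: "C \<bullet> C = 1" using C by (simp flip: power2_norm_eq_inner)
    have "sqrt ((norm (B + t *\<^sub>R C))\<^sup>2 + 1) = p * t + r" using pq[OF t] by (simp add: H0_def r_def)
    then have "(p * t + r)\<^sup>2 = (norm (B + t *\<^sub>R C))\<^sup>2 + 1"
      by (metis add_nonneg_nonneg real_sqrt_pow2 zero_le_one zero_le_power2)
    also have "\<dots> = t\<^sup>2 + 2 * \<beta> * t + \<gamma>"
      using CC inner_commute[of C B] unfolding \<beta>_def \<gamma>_def power2_norm_eq_inner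
      by (simp add: inner_add_left inner_add_right power2_eq_square algebra_simps)
    finally show ?thesis .
  qed
  \<comment> \<open>Three positive values of \<open>t\<close> determine a quadratic
    polynomial.\<close>
  have "p\<^sup>2 = 1" "p * r = \<beta>" "r\<^sup>2 = \<gamma>"
    using eq[of 1] eq[of 2] eq[of 3] by (simp_all add: power2_eq_square algebra_simps)
  then have "\<beta>\<^sup>2 = \<gamma>" by (metis mult_1 power_mult_distrib)
  moreover have "\<beta>\<^sup>2 \<le> (norm B)\<^sup>2"
    using Cauchy_Schwarz_ineq[of B C] C by (simp add: \<beta>_def flip: power2_norm_eq_inner)
  ultimately show False by (simp add: \<gamma>_def)
qed

section \<open>Energy estimates and passage to the limit\<close>

context staircase
begin

lemma set_integrable_const_cube: "set_integrable lborel (unit_cube :: (real^'n) set) (\<lambda>x. c :: real)"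
  by (intro set_integrable_cube_continuous continuous_intros)

lemma LINT_const_cube: "(LINT x:(unit_cube :: (real^'n) set)|lborel. c :: real) = c"
  by (simp add: set_lebesgue_integral_def measure_def emeasure_unit_cube)

text \<open>\<open>S\<close> is the integral of \<open>v x \<bullet> \<nu>\<close>. Its cutoff part
  is the integral of \<eta>, and the remainder carries the sawtooth, which is at most
  \<open>1/k\<close>.\<close>

lemma abs_S_minus_le:
  "\<bar>S - (LINT x:unit_cube|lborel. \<eta> x)\<bar> \<le> (LINT x:unit_cube|lborel. norm (d\<eta> x)) / real k"
proof -
  have i1: "set_integrable lborel unit_cube (\<lambda>x. saw k (x \<bullet> \<nu>) *\<^sub>R (d\<eta> x \<bullet> \<nu>))"
    by (intro set_integrable_saw continuous_intros c\<eta>)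
  have i2: "set_integrable lborel unit_cube \<eta>"
    by (rule set_integrable_cube_continuous[OF c\<eta>(1)])
  have i3: "set_integrable lborel unit_cube (\<lambda>x. (1 / real k) * norm (d\<eta> x))"
    by (intro set_integrable_cube_continuous continuous_intros c\<eta>)
  have iv: "set_integrable lborel unit_cube v" using set_integrable_v[of "\<lambda>_. 1"] by simp
  have nn: "\<nu> \<bullet> \<nu> = 1" using \<nu> by (simp flip: power2_norm_eq_inner)
  have "S = (LINT x:unit_cube|lborel. v x) \<bullet> \<nu>" by (simp add: integral_v nn)
  also have "\<dots> = (LINT x:unit_cube|lborel. v x \<bullet> \<nu>)"
    by (rule set_integral_bounded_linear(1)[OF bounded_linear_inner_left iv, symmetric])
  also have "\<dots> = (LINT x:unit_cube|lborel. saw k (x \<bullet> \<nu>) *\<^sub>R (d\<eta> x \<bullet> \<nu>) + \<eta> x)"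
    by (simp add: v_def inner_add_left nn)
  also have "\<dots> = (LINT x:unit_cube|lborel. saw k (x \<bullet> \<nu>) *\<^sub>R (d\<eta> x \<bullet> \<nu>)) + (LINT x:unit_cube|lborel. \<eta> x)"
    by (rule set_integral_add(2)[OF i1 i2])
  finally have "\<bar>S - (LINT x:unit_cube|lborel. \<eta> x)\<bar> = \<bar>LINT x:unit_cube|lborel. saw k (x \<bullet> \<nu>) *\<^sub>R (d\<eta> x \<bullet> \<nu>)\<bar>"
    by simp
  also have "\<dots> \<le> (LINT x:unit_cube|lborel. (1 / real k) * norm (d\<eta> x))"
  proof -
    have b: "\<bar>saw k (x \<bullet> \<nu>) *\<^sub>R (d\<eta> x \<bullet> \<nu>)\<bar> \<le> (1 / real k) * norm (d\<eta> x)" for x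
      using Cauchy_Schwarz_ineq2[of "d\<eta> x" \<nu>] \<nu> saw_le[of k "x \<bullet> \<nu>"] saw_nonneg[of k "x \<bullet> \<nu>"]
      by (simp only: real_scaleR_def abs_mult) (intro mult_mono, auto)
    show ?thesis
      unfolding set_lebesgue_integral_def
      by (rule order_trans[OF integral_abs_bound Bochner_Integration.integral_mono])
         (use i1 i3 b in \<open>auto simp: set_integrable_def indicator_def\<close>)
  qed
  also have "\<dots> = (LINT x:unit_cube|lborel. norm (d\<eta> x)) / real k"
    by (subst set_integral_mult_right) simp
  finally show ?thesis .
qed

text \<open>The gradient deviates from its mean by \<open>s\<close> times the tensor of \<xi> with
  \<open>S *\<^sub>R \<nu> - v x\<close>. Comparing both \<open>S\<close> and
  \<open>\<eta> x\<close> with 1 leaves the defect of the cutoff and the sawtooth remainder; each is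
  counted twice, once pointwise and once through \<open>\<bar>S - 1\<bar>\<close>.\<close>

lemma bulk_energy_le:
  assumes L: "L-lipschitz_on UNIV W" and W_nonneg: "\<And>B. 0 \<le> W B" and \<xi>1: "norm \<xi> = 1"
  shows "(\<integral>\<^sup>+x\<in>unit_cube. ennreal (W (g x)) \<partial>lborel)
    \<le> ennreal (W (A - (s * S) *\<^sub>R (\<xi> \<otimes>\<^sub>t \<nu>)) + L * (s *
       (2 * (1 - (LINT x:unit_cube|lborel. \<eta> x)) + 2 * ((LINT x:unit_cube|lborel. norm (d\<eta> x)) / real k))))"
proof -
  let ?B = "A - (s * S) *\<^sub>R (\<xi> \<otimes>\<^sub>t \<nu>)"
  let ?I = "LINT x:unit_cube|lborel. \<eta> x" and ?D = "LINT x:unit_cube|lborel. norm (d\<eta> x)"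
  have L0: "0 \<le> L" using L by (simp add: lipschitz_on_def)
  define F where "F x = (W ?B + L * (s * \<bar>S - 1\<bar>)) + (L * s) * (1 - \<eta> x) + (L * s / real k) * norm (d\<eta> x)" for x
  have Fi: "set_integrable lborel unit_cube (\<lambda>x. W ?B + L * (s * \<bar>S - 1\<bar>))"
    "set_integrable lborel unit_cube (\<lambda>x. (L * s) * (1 - \<eta> x))"
    "set_integrable lborel unit_cube (\<lambda>x. (L * s / real k) * norm (d\<eta> x))"
    by (intro set_integrable_cube_continuous continuous_intros c\<eta>)+
  have i\<eta>: "set_integrable lborel unit_cube \<eta>" by (rule set_integrable_cube_continuous[OF c\<eta>(1)])
  have Fint: "set_integrable lborel unit_cube F"
    unfolding F_def[abs_def] by (intro set_integral_add(1) Fi)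
  have F2: "(LINT x:unit_cube|lborel. 1 - \<eta> x) = 1 - ?I"
    by (subst set_integral_diff(2)[OF set_integrable_const_cube i\<eta>]) (simp add: LINT_const_cube)
  have "(LINT x:unit_cube|lborel. F x) = W ?B + L * (s * \<bar>S - 1\<bar>) + (L * s) * (1 - ?I) + (L * s / real k) * ?D"
    unfolding F_def
    by (subst set_integral_add(2)[OF set_integral_add(1)[OF Fi(1,2)] Fi(3)], subst set_integral_add(2)[OF Fi(1,2)])
       (simp only: F2 LINT_const_cube set_integral_mult_right)
  also have "\<dots> = W ?B + L * (s * (\<bar>S - 1\<bar> + (1 - ?I) + ?D / real k))" by (simp add: algebra_simps)
  also have "\<dots> \<le> W ?B + L * (s * (2 * (1 - ?I) + 2 * (?D / real k)))"
  proof -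
    have "?I \<le> (LINT x:(unit_cube :: (real^'n) set)|lborel. 1)"
      by (rule set_integral_mono[OF i\<eta> set_integrable_const_cube \<eta>_le])
    then have "?I \<le> 1" by (simp add: LINT_const_cube)
    then have "\<bar>S - 1\<bar> \<le> (1 - ?I) + ?D / real k" using abs_S_minus_le by linarith
    then show ?thesis using L0 s by (intro add_left_mono mult_left_mono) auto
  qed
  finally have Fle: "(LINT x:unit_cube|lborel. F x) \<le> W ?B + L * (s * (2 * (1 - ?I) + 2 * (?D / real k)))" .
  have F0: "0 \<le> F x" for x
    unfolding F_def using W_nonneg[of ?B] L0 s \<eta>_le[of x] by (intro add_nonneg_nonneg mult_nonneg_nonneg) auto
  have WF: "W (g x) \<le> F x" for x
  proof -
    have "g x - ?B = s *\<^sub>R (\<xi> \<otimes>\<^sub>t (S *\<^sub>R \<nu> - v x))"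
      by (simp add: g_def tensor_right_simps algebra_simps)
    then have "norm (g x - ?B) = s * norm (S *\<^sub>R \<nu> - v x)" using s \<xi>1 by (simp add: norm_tensor)
    also have "S *\<^sub>R \<nu> - v x = (S - \<eta> x) *\<^sub>R \<nu> - saw k (x \<bullet> \<nu>) *\<^sub>R d\<eta> x" by (simp add: v_def algebra_simps)
    also have "s * norm \<dots> \<le> s * (\<bar>S - \<eta> x\<bar> + norm (d\<eta> x) / real k)"
    proof (intro mult_left_mono)
      have "norm ((S - \<eta> x) *\<^sub>R \<nu> - saw k (x \<bullet> \<nu>) *\<^sub>R d\<eta> x) \<le> \<bar>S - \<eta> x\<bar> + \<bar>saw k (x \<bullet> \<nu>)\<bar> * norm (d\<eta> x)"
        using norm_triangle_ineq4[of "(S - \<eta> x) *\<^sub>R \<nu>" "saw k (x \<bullet> \<nu>) *\<^sub>R d\<eta> x"] \<nu> by simp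
      also have "\<bar>saw k (x \<bullet> \<nu>)\<bar> * norm (d\<eta> x) \<le> 1 / real k * norm (d\<eta> x)"
        using saw_le[of k "x \<bullet> \<nu>"] saw_nonneg[of k "x \<bullet> \<nu>"] by (intro mult_right_mono) auto
      finally show "norm ((S - \<eta> x) *\<^sub>R \<nu> - saw k (x \<bullet> \<nu>) *\<^sub>R d\<eta> x) \<le> \<bar>S - \<eta> x\<bar> + norm (d\<eta> x) / real k" by simp
    qed (use s in simp)
    also have "\<dots> \<le> s * (\<bar>S - 1\<bar> + (1 - \<eta> x) + norm (d\<eta> x) / real k)"
      using s \<eta>_le[of x] by (intro mult_left_mono) auto
    finally have d: "norm (g x - ?B) \<le> s * (\<bar>S - 1\<bar> + (1 - \<eta> x) + norm (d\<eta> x) / real k)" .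
    have "W (g x) \<le> W ?B + L * norm (g x - ?B)"
      using lipschitz_onD[OF L UNIV_I UNIV_I, of "g x" ?B] by (simp add: dist_real_def dist_norm)
    also have "\<dots> \<le> W ?B + L * (s * (\<bar>S - 1\<bar> + (1 - \<eta> x) + norm (d\<eta> x) / real k))"
      using d L0 by (intro add_left_mono mult_left_mono)
    also have "\<dots> = F x" by (simp add: F_def algebra_simps)
    finally show ?thesis .
  qed
  have "(\<integral>\<^sup>+x\<in>unit_cube. ennreal (W (g x)) \<partial>lborel) \<le> (\<integral>\<^sup>+x. ennreal (indicat_real unit_cube x *\<^sub>R F x) \<partial>lborel)"
    by (rule nn_integral_mono) (auto simp: indicator_def intro: ennreal_leI WF)
  also have "\<dots> = ennreal (LINT x:unit_cube|lborel. F x)"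
    unfolding set_lebesgue_integral_def
    by (rule nn_integral_eq_integral) (use Fint F0 in \<open>auto simp: set_integrable_def\<close>)
  also have "\<dots> \<le> ennreal (W ?B + L * (s * (2 * (1 - ?I) + 2 * (?D / real k))))" by (rule ennreal_leI[OF Fle])
  finally show ?thesis .
qed

end



lemma set_integral_box_cutoff_tendsto:
  "(\<lambda>m. LINT x:unit_cube|lborel. box_cutoff (\<chi> i. - (1/2)) (\<chi> i. 1/2) m (x :: real^'n)) \<longlonglongrightarrow> 1"
proof -
  let ?\<eta> = "\<lambda>m. box_cutoff (\<chi> i. - (1/2)) (\<chi> i. 1/2) m :: real^'n \<Rightarrow> real"
  have [measurable]: "?\<eta> m \<in> borel_measurable borel" for m
    using C1_box_cutoff C1_continuous(3) by blast
  have "(\<lambda>m. LINT x:unit_cube|lborel. ?\<eta> m x) \<longlonglongrightarrow> (\<integral>x. indicat_real (unit_cube :: (real^'n) set) x \<partial>lborel)"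
    unfolding set_lebesgue_integral_def
  proof (rule integral_dominated_convergence[where w = "indicat_real unit_cube"])
    show "integrable lborel (indicat_real (unit_cube :: (real^'n) set))"
      by (simp add: emeasure_unit_cube)
    show "AE x in lborel. (\<lambda>m. indicat_real unit_cube x *\<^sub>R ?\<eta> m x) \<longlonglongrightarrow> indicat_real unit_cube x"
    proof (intro AE_I2)
      fix x :: "real^'n"
      have "(\<lambda>m. ?\<eta> m x) \<longlonglongrightarrow> indicator unit_cube x"
        unfolding unit_cube_eq_box by (rule tendsto_box_cutoff) simp
      then have "(\<lambda>m. indicat_real unit_cube x *\<^sub>R ?\<eta> m x) \<longlonglongrightarrow> indicat_real unit_cube x *\<^sub>R indicator unit_cube x"
        by (intro tendsto_intros)
      moreover have "indicat_real unit_cube x *\<^sub>R indicator unit_cube x = indicat_real unit_cube x"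
        by (simp add: indicator_def)
      ultimately show "(\<lambda>m. indicat_real unit_cube x *\<^sub>R ?\<eta> m x) \<longlonglongrightarrow> indicat_real unit_cube x"
        by (simp only:)
    qed
    show "AE x in lborel. norm (indicat_real unit_cube x *\<^sub>R ?\<eta> m x) \<le> indicat_real unit_cube x" for m
      by (intro AE_I2) (simp add: indicator_def box_cutoff_bounds)
  qed measurable
  then show ?thesis by (simp add: measure_def emeasure_unit_cube)
qed

lemma H_upper_bound:
  fixes W :: "real^'n^'d \<Rightarrow> real" and \<psi> :: "real^'d \<Rightarrow> real^'n \<Rightarrow> real"
  assumes L: "L-lipschitz_on UNIV W" and W_nonneg: "\<And>B. 0 \<le> W B"
    and \<xi>: "norm \<xi> = 1" and \<nu>: "norm \<nu> = 1" and t: "0 < t"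
    and \<psi>: "0 \<le> \<psi> \<xi> \<nu>" "\<And>t. 0 < t \<Longrightarrow> \<psi> (t *\<^sub>R \<xi>) \<nu> = t * \<psi> \<xi> \<nu>" "\<And>z. \<psi> (- z) (- \<nu>) = \<psi> z \<nu>"
  shows "H W \<psi> (B + t *\<^sub>R (\<xi> \<otimes>\<^sub>t \<nu>)) B \<le> ennreal (W B) + ennreal (t * \<psi> \<xi> \<nu>)"
proof (rule ennreal_le_epsilon)
  fix e :: real assume e: "0 < e"
  have L0: "0 \<le> L" using L by (simp add: lipschitz_on_def)
  \<comment> \<open>The bound 1/4 yields \<open>S \<ge> 1/2\<close>, hence
    \<open>s \<le> 2 * t\<close>, and the total error is then at most
    \<open>8 * L * t * \<epsilon>\<close>. Adding 1 to the denominator covers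
    \<open>L = 0\<close>.\<close>
  define \<epsilon> where "\<epsilon> = min (1/4) (e / (8 * L * t + 1))"
  have den: "0 < 8 * L * t + 1" using L0 t by (intro add_nonneg_pos mult_nonneg_nonneg) auto
  have \<epsilon>: "0 < \<epsilon>" "\<epsilon> \<le> 1/4"
    using e den by (simp_all only: \<epsilon>_def min.cobounded1) simp
  have "8 * L * t * \<epsilon> \<le> (8 * L * t + 1) * \<epsilon>" using \<epsilon> by (simp add: algebra_simps)
  also have "\<dots> \<le> (8 * L * t + 1) * (e / (8 * L * t + 1))"
    using den unfolding \<epsilon>_def by (intro mult_left_mono) auto
  also have "\<dots> = e" using den by simp
  finally have \<epsilon>e: "8 * L * t * \<epsilon> \<le> e" .
  let ?\<eta> = "\<lambda>m. box_cutoff (\<chi> i. - (1/2)) (\<chi> i. 1/2) m :: real^'n \<Rightarrow> real"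
  \<comment> \<open>The cutoff is fixed before the frequency: its gradient may be large, and
    \<open>k\<close> is chosen afterwards to beat \<open>?D\<close>.\<close>
  have "eventually (\<lambda>m. 1 - \<epsilon> < (LINT x:unit_cube|lborel. ?\<eta> m x)) sequentially"
    using \<epsilon> by (intro order_tendstoD(1)[OF set_integral_box_cutoff_tendsto]) simp
  then obtain m where m: "0 < m" "1 - \<epsilon> < (LINT x:unit_cube|lborel. ?\<eta> m x)"
    by (metis (mono_tags, lifting) eventually_sequentially le_add1 zero_less_Suc add_Suc_right)
  obtain d\<eta> where C1: "C1_with_gradient (?\<eta> m) d\<eta>" using C1_box_cutoff by blast
  let ?I = "LINT x:unit_cube|lborel. ?\<eta> m x" and ?D = "LINT x:unit_cube|lborel. norm (d\<eta> x)"
  obtain k :: nat where k: "?D / \<epsilon> < real k" "0 < k"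
  proof -
    obtain k :: nat where "?D / \<epsilon> < real k" using reals_Archimedean2 by blast
    then show thesis by (intro that[of "Suc k"]) auto
  qed
  then have D: "?D / real k < \<epsilon>" using \<epsilon> by (simp add: field_simps)
  have st: "staircase \<xi> \<nu> (?\<eta> m) d\<eta> s k" if "0 < s" for s
  proof
    show "?\<eta> m x = 0 \<longleftrightarrow> x \<notin> unit_cube" for x
    proof -
      have "?\<eta> m x \<noteq> 0 \<longleftrightarrow> x \<in> unit_cube"
        unfolding unit_cube_eq_box by (rule box_cutoff_nonzero_iff) (use m(1) in auto)
      then show ?thesis by blast
    qed
  qed (use \<nu> \<xi> that k(2) C1 in \<open>auto simp: box_cutoff_bounds\<close>)
  \<comment> \<open>\<open>S\<close> does not depend on the amplitude, so its estimate can be taken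
    from the instance with amplitude 1, before \<open>s\<close> is defined from it.\<close>
  define S where "S = staircase.S \<nu> (?\<eta> m) k"
  have "\<bar>S - ?I\<bar> \<le> ?D / real k"
    unfolding S_def by (rule staircase.abs_S_minus_le[OF st[OF zero_less_one]])
  then have S: "1/2 \<le> S" using m(2) D \<epsilon> by linarith
  define s where "s = t / S"
  have s: "0 < s" "s * S = t" "s \<le> 2 * t" using S t by (auto simp: s_def field_simps)
  define A where "A = B + t *\<^sub>R (\<xi> \<otimes>\<^sub>t \<nu>)"
  have AB: "A - (s * S) *\<^sub>R (\<xi> \<otimes>\<^sub>t \<nu>) = B" by (simp add: A_def s)
  interpret st: staircase A \<xi> \<nu> "?\<eta> m" d\<eta> s k by (rule st[OF s(1)])
  have W: "continuous_on UNIV W" using L by (rule lipschitz_on_continuous_on)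
  have "H W \<psi> A (A - (s * S) *\<^sub>R (\<xi> \<otimes>\<^sub>t \<nu>))
      \<le> (\<integral>\<^sup>+x\<in>unit_cube. ennreal (W (st.g x)) \<partial>lborel) + ennreal (s * S * \<psi> \<xi> \<nu>)"
    unfolding S_def by (rule st.H_le[where \<psi> = \<psi>, OF W]) (fact \<psi>)+
  then have "H W \<psi> A B \<le> (\<integral>\<^sup>+x\<in>unit_cube. ennreal (W (st.g x)) \<partial>lborel) + ennreal (t * \<psi> \<xi> \<nu>)"
    unfolding AB unfolding s(2) .
  also have "\<dots> \<le> ennreal (W B + L * (s * (2 * (1 - ?I) + 2 * (?D / real k)))) + ennreal (t * \<psi> \<xi> \<nu>)"
    using st.bulk_energy_le[OF L W_nonneg \<xi>] unfolding S_def[symmetric] AB by (rule add_right_mono)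
  also have "\<dots> \<le> ennreal (W B + e) + ennreal (t * \<psi> \<xi> \<nu>)"
  proof (intro add_right_mono ennreal_leI add_left_mono)
    have "s * (2 * (1 - ?I) + 2 * (?D / real k)) \<le> s * (4 * \<epsilon>)"
      using m(2) D s by (intro mult_left_mono) auto
    also have "\<dots> \<le> (2 * t) * (4 * \<epsilon>)" using s(3) \<epsilon> by (intro mult_right_mono) auto
    finally have "L * (s * (2 * (1 - ?I) + 2 * (?D / real k))) \<le> L * ((2 * t) * (4 * \<epsilon>))"
      using L0 by (rule mult_left_mono)
    then show "L * (s * (2 * (1 - ?I) + 2 * (?D / real k))) \<le> e" using \<epsilon>e by (simp add: mult_ac)
  qed
  also have "\<dots> = ennreal (W B) + ennreal (t * \<psi> \<xi> \<nu>) + ennreal e"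
    using W_nonneg e by (simp add: ac_simps)
  finally show "H W \<psi> (B + t *\<^sub>R (\<xi> \<otimes>\<^sub>t \<nu>)) B \<le> ennreal (W B) + ennreal (t * \<psi> \<xi> \<nu>) + ennreal e"
    by (simp only: A_def)
qed

theorem proposition6p3:
  fixes W :: "real^'n^'d \<Rightarrow> real"
    and \<psi> :: "real^'d \<Rightarrow> real^'n \<Rightarrow> real"
    and c_W C_W c_\<psi> C_\<psi> :: real
  assumes W_nonneg: "\<And>A. 0 \<le> W A"
    and W_cont: "continuous_on UNIV W"
    and \<psi>_nonneg: "\<And>z \<nu>. norm \<nu> = 1 \<Longrightarrow> 0 \<le> \<psi> z \<nu>"
    and \<psi>_cont: "continuous_on (UNIV \<times> sphere 0 1) (\<lambda>(z, \<nu>). \<psi> z \<nu>)"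
    and constants_pos: "0 < c_W" "0 < C_W" "0 < c_\<psi>" "0 < C_\<psi>"
    and W1: "\<And>A. c_W * norm A \<le> W A \<and> W A \<le> C_W * (1 + norm A)"
    and W2: "\<exists>L. L-lipschitz_on UNIV W"
    and W3: "\<exists>c \<alpha>. 0 < c \<and> 0 < \<alpha> \<and> \<alpha> < 1 \<and>
               (\<forall>A t. 0 < t \<and> 1 \<le> t * norm A \<longrightarrow>
                  \<bar>recession W A - W (t *\<^sub>R A) / t\<bar> \<le> c * norm A powr (1 - \<alpha>) / t powr \<alpha>)"
    and \<psi>1: "\<And>z \<nu>. norm \<nu> = 1 \<Longrightarrow> c_\<psi> * norm z \<le> \<psi> z \<nu> \<and> \<psi> z \<nu> \<le> C_\<psi> * norm z"
    and \<psi>2_hom: "\<And>z \<nu> t. norm \<nu> = 1 \<Longrightarrow> 0 < t \<Longrightarrow> \<psi> (t *\<^sub>R z) \<nu> = t * \<psi> z \<nu>"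
    and \<psi>2_sym: "\<And>z \<nu>. norm \<nu> = 1 \<Longrightarrow> \<psi> (- z) (- \<nu>) = \<psi> z \<nu>"
    and \<psi>3: "\<And>z\<^sub>1 z\<^sub>2 \<nu>. norm \<nu> = 1 \<Longrightarrow> \<psi> (z\<^sub>1 + z\<^sub>2) \<nu> \<le> \<psi> z\<^sub>1 \<nu> + \<psi> z\<^sub>2 \<nu>"
  shows "(\<exists>B\<^sub>0 \<xi> \<nu>. norm \<xi> = 1 \<and> norm \<nu> = 1 \<and>
            (\<forall>t>0. H W \<psi> (B\<^sub>0 + t *\<^sub>R (\<xi> \<otimes>\<^sub>t \<nu>)) B\<^sub>0 = ennreal (W B\<^sub>0 + \<psi> (t *\<^sub>R \<xi>) \<nu>)) \<and>
            \<not> (\<exists>p q. \<forall>t>0. H0 (B\<^sub>0 + t *\<^sub>R (\<xi> \<otimes>\<^sub>t \<nu>)) B\<^sub>0 = p * t + q)) \<and>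
         H W \<psi> \<noteq> (\<lambda>A B. ennreal (H0 A B))"
proof -
  obtain B\<^sub>0 where B\<^sub>0: "\<And>B. W B\<^sub>0 \<le> W B"
    using coercive_attains_min[OF W_cont constants_pos(1)] W1 by blast
  obtain M \<xi> \<nu> where \<xi>: "norm \<xi> = 1" and \<nu>: "norm \<nu> = 1" and touch: "M \<bullet> (\<xi> \<otimes>\<^sub>t \<nu>) = \<psi> \<xi> \<nu>"
    and below: "\<forall>z n. norm n = 1 \<longrightarrow> M \<bullet> (z \<otimes>\<^sub>t n) \<le> \<psi> z n"
  proof (rule calibration_exists[OF \<psi>_cont constants_pos(3)])
    show "c_\<psi> * norm z \<le> \<psi> z \<nu>" if "norm \<nu> = 1" for z \<nu> using \<psi>1[OF that] by blast
    show "\<psi> (t *\<^sub>R z) \<nu> = t * \<psi> z \<nu>" if "norm \<nu> = 1" "0 < t" for z \<nu> t by (rule \<psi>2_hom[OF that])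
  qed blast
  obtain L where L: "L-lipschitz_on UNIV W" using W2 by blast
  have \<psi>0: "0 \<le> \<psi> \<xi> \<nu>" by (rule \<psi>_nonneg[OF \<nu>])
  have H_eq: "H W \<psi> (B\<^sub>0 + t *\<^sub>R (\<xi> \<otimes>\<^sub>t \<nu>)) B\<^sub>0 = ennreal (W B\<^sub>0 + \<psi> (t *\<^sub>R \<xi>) \<nu>)" if t: "0 < t" for t
  proof -
    have sum: "ennreal (W B\<^sub>0 + \<psi> (t *\<^sub>R \<xi>) \<nu>) = ennreal (W B\<^sub>0) + ennreal (t * \<psi> \<xi> \<nu>)"
      using W_nonneg \<psi>0 t by (simp add: \<psi>2_hom[OF \<nu> t])
    have "H W \<psi> (B\<^sub>0 + t *\<^sub>R (\<xi> \<otimes>\<^sub>t \<nu>)) B\<^sub>0 \<le> ennreal (W B\<^sub>0) + ennreal (t * \<psi> \<xi> \<nu>)"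
      by (rule H_upper_bound[OF L W_nonneg \<xi> \<nu> t \<psi>0 \<psi>2_hom[OF \<nu>] \<psi>2_sym[OF \<nu>]])
    moreover have "ennreal (W B\<^sub>0) + ennreal (t * \<psi> \<xi> \<nu>) \<le> H W \<psi> (B\<^sub>0 + t *\<^sub>R (\<xi> \<otimes>\<^sub>t \<nu>)) B\<^sub>0"
      using H_lower_bound[where W = W and \<psi> = \<psi> and w = "W B\<^sub>0" and M = M and A = "B\<^sub>0 + t *\<^sub>R (\<xi> \<otimes>\<^sub>t \<nu>)" and B = B\<^sub>0] B\<^sub>0 below
      by (simp add: touch)
    ultimately show ?thesis unfolding sum by (rule order_antisym)
  qed
  have not_affine: "\<not> (\<exists>p q. \<forall>t>0. H0 (B\<^sub>0 + t *\<^sub>R (\<xi> \<otimes>\<^sub>t \<nu>)) B\<^sub>0 = p * t + q)"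
    by (rule H0_not_affine) (simp add: norm_tensor \<xi> \<nu>)
  have "H W \<psi> \<noteq> (\<lambda>A B. ennreal (H0 A B))"
  proof
    assume eq: "H W \<psi> = (\<lambda>A B. ennreal (H0 A B))"
    \<comment> \<open>Along the ray the relaxed energy is affine with slope
      \<open>\<psi> \<xi> \<nu>\<close>. Both values are nonnegative, so equality of extended reals
      is equality of reals.\<close>
    have "H0 (B\<^sub>0 + t *\<^sub>R (\<xi> \<otimes>\<^sub>t \<nu>)) B\<^sub>0 = \<psi> \<xi> \<nu> * t + W B\<^sub>0" if t: "0 < t" for t
    proof -
      have "0 \<le> H0 (B\<^sub>0 + t *\<^sub>R (\<xi> \<otimes>\<^sub>t \<nu>)) B\<^sub>0" by (simp add: H0_def)
      moreover have "0 \<le> W B\<^sub>0 + t * \<psi> \<xi> \<nu>" using W_nonneg \<psi>0 t by simp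
      moreover have "ennreal (H0 (B\<^sub>0 + t *\<^sub>R (\<xi> \<otimes>\<^sub>t \<nu>)) B\<^sub>0) = ennreal (W B\<^sub>0 + t * \<psi> \<xi> \<nu>)"
        using H_eq[OF t] unfolding eq by (simp add: \<psi>2_hom[OF \<nu> t])
      ultimately show ?thesis by (simp add: mult.commute)
    qed
    then show False using not_affine by blast
  qed
  then show ?thesis using \<xi> \<nu> H_eq not_affine by blast
qed

end
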